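(* Let $N\ge 2$ and $1^*=N/(N-1)$. Let $f:\mathbb{R}\to\mathbb{R}$ satisfy: $(f_1)$ $f\in C^1(\mathbb{R})$; $(f_2)$ $f(s)=o(1)$ as $s\to 0$; $(f_3)$ there exist $c_1,c_2>0$ and $p\in[1,1^* )$ with $|f(s)|\le c_1+c_2|s|^{p-1}$ for all $s\in\mathbb{R}$; $(f_4)$ there exists $\theta>1$ with $0<\theta F(s)\le f(s)s$ for all $s\neq 0$, where $F(s)=\int_0^s f(t)\,dt$; $(f_5)$ $f$ is increasing. Let $V:\mathbb{R}^N\to\mathbb{R}$ satisfy: $(V_1)$ $V\in L^\infty(\mathbb{R}^N)$ and $V_0:=\inf_{\mathbb{R}^N}V>0$; $(V_3)$ $V\in C(\mathbb{R}^N)$, $\lim_{|x|\to+\infty}V(x)=V_\infty$ for some $V_\infty\in\mathbb{R}$, and $V\le V_\infty$ in $\mathbb{R}^N$. Then for every $\epsilon>0$ the problem $$-\epsilon\Delta_1 u+V(x)\frac{u}{|u|}=f(u)\ \text{in }\mathbb{R}^N,\qquad u\in BV(\mathbb{R}^N),$$ has a nontrivial bounded variation solution $u_\epsilon$.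
   Context: $BV(\mathbb{R}^N)$ is the space of $u\in L^1(\mathbb{R}^N)$ whose distributional gradient $Du$ is a finite vector Radon measure, with total variation $\int_{\mathbb{R}^N}|Du|$. For $\epsilon>0$, a function $u\in BV(\mathbb{R}^N)$ is called a bounded variation solution of the problem $-\epsilon\Delta_1 u+V(x)\frac{u}{|u|}=f(u)$ if, writing $\|w\|_{*}:=\epsilon\int_{\mathbb{R}^N}|Dw|+\int_{\mathbb{R}^N}V(x)|w|\,dx$, $$\|w\|_{*}-\|u\|_{*}\ge\int_{\mathbb{R}^N}f(u)(w-u)\,dx\quad\text{for all }w\in BV(\mathbb{R}^N).$$ *)

theory Defs
  imports "HOL-Analysis.Analysis"
begin

definition C1c_field :: "(real^'n \<Rightarrow> real^'n) \<Rightarrow> bool" where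
  "C1c_field \<phi> \<longleftrightarrow>
     (\<forall>x. \<phi> differentiable (at x)) \<and>
     (\<forall>i j. continuous_on UNIV (\<lambda>x. frechet_derivative \<phi> (at x) (axis j 1) $ i)) \<and>
     compact (closure {x. \<phi> x \<noteq> 0})"

definition divergence :: "(real^'n \<Rightarrow> real^'n) \<Rightarrow> real^'n \<Rightarrow> real" where
  "divergence \<phi> x = (\<Sum>i\<in>UNIV. frechet_derivative \<phi> (at x) (axis i 1) $ i)"

definition total_variation :: "(real^'n \<Rightarrow> real) \<Rightarrow> ereal" where
  "total_variation u =
     (SUP \<phi>\<in>{\<phi>. C1c_field \<phi> \<and> (\<forall>x. norm (\<phi> x) \<le> 1)}.
        ereal (integral\<^sup>L lebesgue (\<lambda>x. u x * divergence \<phi> x)))"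

definition BV :: "(real^'n \<Rightarrow> real) set" where
  "BV = {u. integrable lebesgue u \<and> total_variation u < \<infinity>}"

definition star_norm :: "real \<Rightarrow> (real^'n \<Rightarrow> real) \<Rightarrow> (real^'n \<Rightarrow> real) \<Rightarrow> real" where
  "star_norm \<epsilon> V w = \<epsilon> * real_of_ereal (total_variation w)
      + integral\<^sup>L lebesgue (\<lambda>x. V x * \<bar>w x\<bar>)"

definition BV_solution ::
  "real \<Rightarrow> (real^'n \<Rightarrow> real) \<Rightarrow> (real \<Rightarrow> real) \<Rightarrow> (real^'n \<Rightarrow> real) \<Rightarrow> bool" where
  "BV_solution \<epsilon> V f u \<longleftrightarrow> u \<in> BV \<and>
     (\<forall>w\<in>BV. star_norm \<epsilon> V w - star_norm \<epsilon> V u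
               \<ge> integral\<^sup>L lebesgue (\<lambda>x. f (u x) * (w x - u x)))"

definition primitive :: "(real \<Rightarrow> real) \<Rightarrow> real \<Rightarrow> real" where
  "primitive f s = (if 0 \<le> s then integral {0..s} f else - integral {s..0} f)"

end

theory Submission
  imports Defs "HOL-Complex_Analysis.Great_Picard"
begin

text \<open>
  Let \<open>I(u) = \<parallel>u\<parallel>\<^sub>* - \<integral> F(u)\<close>. Since \<open>F\<close> is strictly convex and superlinear, \<open>t \<mapsto> I(t u)\<close> is strictly concave with a
  maximum, and the solution is a minimiser of \<open>u \<mapsto> max\<^sub>t I(t u)\<close> over \<open>u \<noteq> 0\<close>, scaled so that the maximum is
  at \<open>t = 1\<close>: if the variational inequality failed for some \<open>w\<close>, moving \<open>u\<close> slightly towards \<open>w\<close> would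
  lower the maximum, by convexity of \<open>F\<close> alone.

  A minimising sequence cannot vanish, so after translations it converges in \<open>L\<^sup>1\<^sub>l\<^sub>o\<^sub>c\<close> to some \<open>u \<noteq> 0\<close>. Cutting
  the sequence into a near and a far part shows that the maximum of the energy of \<open>u\<close>, for the limit of
  the translated potentials, is at most the infimum \<open>c\<close>. That limit is a translate of \<open>V\<close> or the constant
  \<open>V\<^sub>\<infinity> \<ge> V\<close>; in both cases \<open>u\<close> or a translate of it is a minimiser for \<open>V\<close> itself.

  All embeddings of \<open>BV\<close> come from \<open>\<integral> |u(x + h) - u(x)| dx \<le> |h| \<integral> |Du|\<close>: comparing \<open>u\<close> with its averages over
  small balls gives the \<open>L\<^sup>q\<close> bounds for \<open>q < 1\<^sup>*\<close> (by a bootstrap in \<open>q\<close>), Lions' vanishing lemma and local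
  compactness, without the Sobolev inequality.
\<close>

section \<open>Total variation\<close>

text \<open>The norm is not differentiable, so there is no derivative to set to zero. Working with
  whole rays avoids this: a norm is linear on each ray, so only \<open>F\<close> bends the energy,
  and comparing the minimiser with \<open>(1 - s) u + s w\<close> uses of the norm nothing but
  homogeneity and the triangle inequality, while \<open>F\<close> enters through its tangent
  inequality. The other obstacle is the escape of mass by translation. The levels of
  \<open>V\<close> and of its limit need not be compared beforehand: translated potentials have the
  same lower bound \<open>c\<close> on their rays, and that is all the far part of a sequence has to
  obey.

  The exponent N/(N-1) is the fixed point of r -> 1 + r/N. An L^r bound, averaged over balls of
  suitable volume, controls the part of \<open>u\<close> above the level l by l^(-r/N), and these
  tails sum to an L^q bound for every q < 1 + r/N. A spare exponent q strictly between p and N/(N-1)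
  makes \<open>F\<close> negligible against |s|^q for large s; hence boundedness in L^q together
  with local L^1 convergence is enough to pass to the limit in local integrals of
  \<open>F\<close>.\<close>

definition tv :: "(real^'n \<Rightarrow> real) \<Rightarrow> real" where
  "tv u = real_of_ereal (total_variation u)"

lemma C1c_fieldI:
  fixes \<phi> :: "real^'n \<Rightarrow> real^'n"
  assumes d: "\<And>x. (\<phi> has_derivative \<phi>' x) (at x)"
    and c: "\<And>v. continuous_on UNIV (\<lambda>x. \<phi>' x v)"
    and s: "\<And>x. norm x > R \<Longrightarrow> \<phi> x = 0"
  shows "C1c_field \<phi>" "divergence \<phi> x = (\<Sum>i\<in>UNIV. \<phi>' x (axis i 1) $ i)"
proof -
  have eq: "frechet_derivative \<phi> (at x) = \<phi>' x" for x
    using frechet_derivative_at[OF d] by simp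
  have "bounded {x. \<phi> x \<noteq> 0}"
    unfolding bounded_iff by (rule exI[of _ R]) (use s in force)
  then show "C1c_field \<phi>"
    unfolding C1c_field_def eq using d c
    by (auto simp: differentiable_def compact_closure intro!: continuous_on_component)
  show "divergence \<phi> x = (\<Sum>i\<in>UNIV. \<phi>' x (axis i 1) $ i)"
    unfolding divergence_def eq ..
qed

text \<open>The definition asks for continuity of the partial derivatives only; linearity of the
  derivative extends it to every direction \<open>v\<close>, the form needed for chain and product
  rules.\<close>

lemma C1c_fieldE:
  fixes \<phi> :: "real^'n \<Rightarrow> real^'n"
  assumes "C1c_field \<phi>"
  obtains \<phi>' R where "\<And>x. (\<phi> has_derivative \<phi>' x) (at x)" "\<And>v. continuous_on UNIV (\<lambda>x. \<phi>' x v)"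
    "\<And>x. norm x > R \<Longrightarrow> \<phi> x = 0" "\<And>x. divergence \<phi> x = (\<Sum>i\<in>UNIV. \<phi>' x (axis i 1) $ i)" "R > 0"
proof -
  define \<phi>' where "\<phi>' x = frechet_derivative \<phi> (at x)" for x
  have d: "(\<phi> has_derivative \<phi>' x) (at x)" for x
    using assms unfolding C1c_field_def \<phi>'_def by (simp add: frechet_derivative_works)
  have c: "continuous_on UNIV (\<lambda>x. \<phi>' x v)" for v
  proof -
    have "\<phi>' x v = (\<Sum>j\<in>UNIV. v $ j *\<^sub>R \<phi>' x (axis j 1))" for x
    proof -
      interpret linear "\<phi>' x" using d has_derivative_linear by blast
      have "\<phi>' x v = \<phi>' x (\<Sum>j\<in>UNIV. v $ j *\<^sub>R axis j 1)"
        using basis_expansion[of v] by (simp add: scalar_mult_eq_scaleR)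
      then show ?thesis by (simp add: sum scale)
    qed
    moreover have "continuous_on UNIV (\<lambda>x. \<Sum>j\<in>UNIV. v $ j *\<^sub>R \<phi>' x (axis j 1))"
    proof (intro continuous_intros)
      fix j
      have "(\<lambda>x. \<phi>' x (axis j 1)) = (\<lambda>x. \<chi> i. \<phi>' x (axis j 1) $ i)" by simp
      moreover have "continuous_on UNIV (\<lambda>x. \<chi> i. \<phi>' x (axis j 1) $ i)"
        using assms unfolding C1c_field_def \<phi>'_def[symmetric]
        by (intro continuous_on_vec_lambda) auto
      ultimately show "continuous_on UNIV (\<lambda>x. \<phi>' x (axis j 1))" by metis
    qed
    ultimately show ?thesis by simp
  qed
  have "bounded {x. \<phi> x \<noteq> 0}"
    using assms unfolding C1c_field_def by simp
  then obtain R where "R > 0" "\<And>x. \<phi> x \<noteq> 0 \<Longrightarrow> norm x \<le> R"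
    unfolding bounded_pos by auto
  then show thesis
    using d c by (intro that[of \<phi>' R]) (auto simp: divergence_def \<phi>'_def not_less[symmetric])
qed

lemma has_derivative_eq_0_outside:
  fixes f :: "'a::real_normed_vector \<Rightarrow> 'b::real_normed_vector"
  assumes "(f has_derivative f') (at x)" "\<And>x. norm x > R \<Longrightarrow> f x = 0" "norm x > R"
  shows "f' = (\<lambda>_. 0)"
proof -
  have "(f has_derivative (\<lambda>_. 0)) (at x)"
  proof (rule has_derivative_transform_within_open[where s="- cball 0 R" and f="\<lambda>_. 0"])
    show "((\<lambda>_. 0) has_derivative (\<lambda>_. 0)) (at x)" by simp
  qed (use assms in \<open>auto simp: open_Compl\<close>)
  then show ?thesis using assms(1) has_derivative_unique by blast
qed

lemma divergence_bounded:
  assumes "C1c_field \<phi>"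
  obtains B where "\<And>x. \<bar>divergence \<phi> x\<bar> \<le> B" "B > 0"
    and "continuous_on UNIV (divergence \<phi>)"
proof -
  from assms obtain \<phi>' R where d: "\<And>x. (\<phi> has_derivative \<phi>' x) (at x)"
    "\<And>v. continuous_on UNIV (\<lambda>x. \<phi>' x v)"
    "\<And>x. norm x > R \<Longrightarrow> \<phi> x = 0" "\<And>x. divergence \<phi> x = (\<Sum>i\<in>UNIV. \<phi>' x (axis i 1) $ i)"
    by (rule C1c_fieldE) blast
  have cont: "continuous_on UNIV (divergence \<phi>)"
    unfolding d(4) [abs_def] by (intro continuous_intros d)
  then have "compact (divergence \<phi> ` cball 0 R)"
    by (meson compact_cball compact_continuous_image continuous_on_subset top_greatest)
  then obtain B where B: "\<And>x. norm x \<le> R \<Longrightarrow> \<bar>divergence \<phi> x\<bar> \<le> B"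
    unfolding compact_eq_bounded_closed bounded_iff by (metis dist_0_norm image_eqI mem_cball real_norm_def)
  have "divergence \<phi> x = 0" if "norm x > R" for x
    unfolding d(4) using has_derivative_eq_0_outside[OF d(1) d(3) that] by simp
  then have "\<bar>divergence \<phi> x\<bar> \<le> max B 1" for x
    using B[of x] by (cases "norm x \<le> R") auto
  then show thesis using that[of "max B 1"] cont by simp
qed

lemma divergence_measurable:
  "C1c_field \<phi> \<Longrightarrow> divergence \<phi> \<in> borel_measurable borel"
  by (metis borel_measurable_continuous_onI divergence_bounded)

lemma divergence_outside:
  assumes "C1c_field \<phi>"
  obtains R where "\<And>x. norm x > R \<Longrightarrow> divergence \<phi> x = 0" "R > 0"
proof -
  from assms obtain \<phi>' R where d: "\<And>x. (\<phi> has_derivative \<phi>' x) (at x)"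
    "\<And>v. continuous_on UNIV (\<lambda>x. \<phi>' x v)"
    "\<And>x. norm x > R \<Longrightarrow> \<phi> x = 0" "\<And>x. divergence \<phi> x = (\<Sum>i\<in>UNIV. \<phi>' x (axis i 1) $ i)" "R > 0"
    by (rule C1c_fieldE) blast
  show thesis
    using has_derivative_eq_0_outside[OF d(1) d(3)] d(5) by (intro that[of R]) (auto simp: d(4))
qed

lemma borel_measurable_lebesgue_of_borel [measurable_dest]:
  "f \<in> borel_measurable borel \<Longrightarrow> f \<in> borel_measurable lebesgue"
  by (simp add: measurable_completion)

lemma integrable_bounded_mult:
  fixes g h :: "'a \<Rightarrow> real"
  assumes "integrable M g" "h \<in> borel_measurable M" "\<And>x. \<bar>h x\<bar> \<le> B"
  shows "integrable M (\<lambda>x. g x * h x)"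
proof (rule Bochner_Integration.integrable_bound[of M "\<lambda>x. B * g x"])
  show "AE x in M. norm (g x * h x) \<le> norm (B * g x)"
    using assms(3) by (intro AE_I2)
      (simp add: abs_mult, metis abs_ge_zero abs_ge_self mult.commute mult_left_mono order_trans)
qed (use assms in auto)

lemma integrable_mult_divergence:
  assumes "integrable lebesgue u" "C1c_field \<phi>"
  shows "integrable lebesgue (\<lambda>x. u x * divergence \<phi> x)"
proof -
  obtain B where "\<And>x. \<bar>divergence \<phi> x\<bar> \<le> B"
    using divergence_bounded[OF assms(2)] by blast
  then show ?thesis
    using integrable_bounded_mult[OF assms(1)] divergence_measurable[OF assms(2)]
      borel_measurable_lebesgue_of_borel by blast
qed

lemma C1c_field_0: "C1c_field (\<lambda>_. 0)"
  by (rule C1c_fieldI[where \<phi>'="\<lambda>_ _. 0" and R=0]) auto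

lemma total_variation_nonneg: "0 \<le> total_variation (u :: real^'n \<Rightarrow> real)"
proof -
  have "divergence (\<lambda>_::real^'n. 0) x = 0" for x :: "real^'n"
    using C1c_fieldI(2)[of "\<lambda>_. 0" "\<lambda>_ _. 0" 0 x] by simp
  then have "ereal 0 = ereal (integral\<^sup>L lebesgue (\<lambda>x. u x * divergence (\<lambda>_::real^'n. 0) x))" by simp
  also have "\<dots> \<le> total_variation u"
    unfolding total_variation_def by (rule SUP_upper) (simp add: C1c_field_0)
  finally show ?thesis by (simp add: zero_ereal_def)
qed

lemma tv_nonneg: "0 \<le> tv u"
  unfolding tv_def using total_variation_nonneg by (rule real_of_ereal_pos)

lemma BV_integrable: "u \<in> BV \<Longrightarrow> integrable lebesgue u"
  by (simp add: BV_def)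

text \<open>Membership in \<open>BV\<close> guards against a default value:
  \<open>real_of_ereal\<close> maps infinity to 0, and \<open>tv u\<close> would then bound
  nothing.\<close>

lemma tv_upper:
  assumes "u \<in> BV" "C1c_field \<phi>" "\<And>x. norm (\<phi> x) \<le> 1"
  shows "(\<integral>x. u x * divergence \<phi> x \<partial>lebesgue) \<le> tv u"
proof -
  have "ereal (\<integral>x. u x * divergence \<phi> x \<partial>lebesgue) \<le> total_variation u"
    unfolding total_variation_def by (rule SUP_upper) (use assms in auto)
  moreover have "total_variation u = ereal (tv u)"
    using assms(1) total_variation_nonneg[of u] unfolding BV_def tv_def
    by (cases "total_variation u") auto
  ultimately show ?thesis by simp
qed

text \<open>One bound on the pairings, uniform over the fields, yields finiteness of the supremum
  and its estimate together.\<close>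

lemma tv_least:
  assumes "integrable lebesgue u"
    and "\<And>\<phi>. C1c_field \<phi> \<Longrightarrow> (\<And>x. norm (\<phi> x) \<le> 1) \<Longrightarrow> (\<integral>x. u x * divergence \<phi> x \<partial>lebesgue) \<le> B"
  shows "u \<in> BV" "tv u \<le> B"
proof -
  have le: "total_variation u \<le> ereal B"
    unfolding total_variation_def by (rule SUP_least) (use assms in auto)
  then show "u \<in> BV" using assms(1) unfolding BV_def by auto
  show "tv u \<le> B"
    using le total_variation_nonneg[of u] unfolding tv_def by (cases "total_variation u") auto
qed

lemma tv_approx:
  assumes "u \<in> BV" "e > 0"
  obtains \<phi> where "C1c_field \<phi>" "\<And>x. norm (\<phi> x) \<le> 1"
    "(\<integral>x. u x * divergence \<phi> x \<partial>lebesgue) > tv u - e"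
proof (rule ccontr)
  assume "\<not> thesis"
  then have "\<And>\<phi>. C1c_field \<phi> \<Longrightarrow> (\<And>x. norm (\<phi> x) \<le> 1) \<Longrightarrow> (\<integral>x. u x * divergence \<phi> x \<partial>lebesgue) \<le> tv u - e"
    using that by (meson not_less)
  then have "tv u \<le> tv u - e"
    using tv_least(2)[OF BV_integrable[OF assms(1)]] by blast
  then show False using assms(2) by simp
qed

lemma BV_cong_AE:
  assumes "u \<in> BV" "AE x in lebesgue. v x = u x" "v \<in> borel_measurable lebesgue"
  shows "v \<in> BV" "tv v = tv u"
proof -
  note [measurable] = assms(3) borel_measurable_integrable[OF BV_integrable[OF assms(1)]]
  have i: "integrable lebesgue v"
    using BV_integrable[OF assms(1)] assms(2) by (subst integrable_cong_AE[where g=u]) auto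
  have e: "(\<integral>x. v x * divergence \<phi> x \<partial>lebesgue) = (\<integral>x. u x * divergence \<phi> x \<partial>lebesgue)"
    if "C1c_field \<phi>" for \<phi>
    using assms(2) divergence_measurable[OF that]
    by (intro integral_cong_AE borel_measurable_times) (auto dest: borel_measurable_lebesgue_of_borel)
  have 1: "v \<in> BV \<and> tv v \<le> tv u"
    using tv_least[OF i, of "tv u"] tv_upper[OF assms(1)] e by metis
  then show "v \<in> BV" by simp
  moreover have "tv u \<le> tv v"
    using tv_least(2)[OF BV_integrable[OF assms(1)], of "tv v"] tv_upper[of v] e 1 by metis
  ultimately show "tv v = tv u" using 1 by simp
qed

lemma BV_scale:
  assumes "u \<in> BV" "c \<ge> 0"
  shows "(\<lambda>x. c * u x) \<in> BV" "tv (\<lambda>x. c * u x) = c * tv u"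
proof -
  have main: "(\<lambda>x. c * u x) \<in> BV \<and> tv (\<lambda>x. c * u x) \<le> c * tv u" if "u \<in> BV" "c \<ge> 0" for u and c
  proof -
    have "(\<integral>x. (c * u x) * divergence \<phi> x \<partial>lebesgue) \<le> c * tv u"
      if "C1c_field \<phi>" "\<And>x. norm (\<phi> x) \<le> 1" for \<phi>
    proof -
      have "(\<integral>x. (c * u x) * divergence \<phi> x \<partial>lebesgue) = c * (\<integral>x. u x * divergence \<phi> x \<partial>lebesgue)"
        by (simp add: mult.assoc)
      then show ?thesis using tv_upper[OF \<open>u \<in> BV\<close> that] \<open>c \<ge> 0\<close> by (simp add: mult_left_mono)
    qed
    then show ?thesis
      using tv_least[of "\<lambda>x. c * u x" "c * tv u"] BV_integrable[OF \<open>u \<in> BV\<close>] by auto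
  qed
  show "(\<lambda>x. c * u x) \<in> BV" using main assms by blast
  \<comment> \<open>The reverse inequality is the one just proved, applied to \<open>c * u\<close>
    with the factor \<open>1 / c\<close>.\<close>
  have "c * tv u \<le> tv (\<lambda>x. c * u x)"
  proof (cases "c = 0")
    case True then show ?thesis by (simp add: tv_nonneg)
  next
    case False
    then have "tv (\<lambda>x. (1/c) * (c * u x)) \<le> (1/c) * tv (\<lambda>x. c * u x)"
      using main[of "\<lambda>x. c * u x" "1/c"] main[OF assms] assms by auto
    then show ?thesis using False assms by (simp add: field_simps)
  qed
  then show "tv (\<lambda>x. c * u x) = c * tv u" using main[OF assms] by simp
qed

lemma C1c_field_uminus:
  assumes "C1c_field (\<phi> :: real^'n \<Rightarrow> real^'n)"
  shows "C1c_field (\<lambda>x. - \<phi> x)" "divergence (\<lambda>x. - \<phi> x) x = - divergence \<phi> x"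
proof -
  from assms obtain \<phi>' R where d: "\<And>x. (\<phi> has_derivative \<phi>' x) (at x)"
    "\<And>v. continuous_on UNIV (\<lambda>x. \<phi>' x v)"
    "\<And>x. norm x > R \<Longrightarrow> \<phi> x = 0" "\<And>x. divergence \<phi> x = (\<Sum>i\<in>UNIV. \<phi>' x (axis i 1) $ i)" "R > 0"
    by (rule C1c_fieldE) blast
  have *: "((\<lambda>x. - \<phi> x) has_derivative (\<lambda>v. - \<phi>' x v)) (at x)" for x
    by (intro derivative_intros d)
  have **: "continuous_on UNIV (\<lambda>x. - \<phi>' x v)" for v
    by (intro continuous_intros d)
  show "C1c_field (\<lambda>x. - \<phi> x)" "divergence (\<lambda>x. - \<phi> x) x = - divergence \<phi> x"
    using C1c_fieldI[OF * **, of R] d(3) by (auto simp: d(4) sum_negf)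
qed

lemma BV_uminus:
  assumes "u \<in> BV"
  shows "(\<lambda>x. - u x) \<in> BV" "tv (\<lambda>x. - u x) \<le> tv u"
proof -
  have "(\<integral>x. - u x * divergence \<phi> x \<partial>lebesgue) \<le> tv u"
    if "C1c_field \<phi>" "\<And>x. norm (\<phi> x) \<le> 1" for \<phi>
    using tv_upper[OF assms, of "\<lambda>x. - \<phi> x"] C1c_field_uminus[OF that(1)] that(2) by simp
  then show "(\<lambda>x. - u x) \<in> BV" "tv (\<lambda>x. - u x) \<le> tv u"
    using tv_least[of "\<lambda>x. - u x" "tv u"] BV_integrable[OF assms] by auto
qed

lemma BV_add:
  assumes "u \<in> BV" "v \<in> BV"
  shows "(\<lambda>x. u x + v x) \<in> BV" "tv (\<lambda>x. u x + v x) \<le> tv u + tv v"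
proof -
  have "(\<integral>x. (u x + v x) * divergence \<phi> x \<partial>lebesgue) \<le> tv u + tv v"
    if "C1c_field \<phi>" "\<And>x. norm (\<phi> x) \<le> 1" for \<phi>
    using tv_upper[OF assms(1) that] tv_upper[OF assms(2) that]
      integrable_mult_divergence[OF BV_integrable that(1), of u]
      integrable_mult_divergence[OF BV_integrable that(1), of v] assms
    by (simp add: distrib_right)
  then show "(\<lambda>x. u x + v x) \<in> BV" "tv (\<lambda>x. u x + v x) \<le> tv u + tv v"
    using tv_least[of "\<lambda>x. u x + v x" "tv u + tv v"] BV_integrable[OF assms(1)] BV_integrable[OF assms(2)]
    by auto
qed

lemma BV_diff:
  assumes "u \<in> BV" "v \<in> BV"
  shows "(\<lambda>x. u x - v x) \<in> BV"
  using BV_add(1)[OF assms(1) BV_uminus(1)[OF assms(2)]] by simp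

section \<open>Invariance under translations\<close>

lemma lebesgue_distr_translation:
  fixes a :: "'a::euclidean_space"
  shows "distr lebesgue lebesgue (\<lambda>x. a + x) = lebesgue" "(\<lambda>x. a + x) \<in> lebesgue \<rightarrow>\<^sub>M lebesgue"
proof -
  have eq: "(\<lambda>x. a + (\<Sum>j\<in>Basis. (1 * (x \<bullet> j)) *\<^sub>R j)) = (\<lambda>x. a + x)"
    by (simp add: euclidean_representation)
  show "(\<lambda>x. a + x) \<in> lebesgue \<rightarrow>\<^sub>M lebesgue"
    using lebesgue_affine_measurable[of "\<lambda>_. 1" a] eq by simp
  show "distr lebesgue lebesgue (\<lambda>x. a + x) = lebesgue"
    using lebesgue_affine_euclidean[of "\<lambda>_. 1" a] unfolding eq by (simp add: density_1)
qed

lemma lebesgue_translation: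
  fixes g :: "'a::euclidean_space \<Rightarrow> real"
  shows measurable_lebesgue_translation:
      "g \<in> borel_measurable lebesgue \<Longrightarrow> (\<lambda>x. g (x + a)) \<in> borel_measurable lebesgue"
    and integrable_lebesgue_translation:
      "integrable lebesgue g \<Longrightarrow> integrable lebesgue (\<lambda>x. g (x + a))"
    and integral_lebesgue_translation:
      "g \<in> borel_measurable lebesgue \<Longrightarrow> (\<integral>x. g (x + a) \<partial>lebesgue) = (\<integral>x. g x \<partial>lebesgue)"
proof -
  note m = lebesgue_distr_translation(2)[of a]
  show 1: "g \<in> borel_measurable lebesgue \<Longrightarrow> (\<lambda>x. g (x + a)) \<in> borel_measurable lebesgue"
    using measurable_compose[OF m, of g borel] by (simp add: add.commute)
  show "integrable lebesgue (\<lambda>x. g (x + a))" if "integrable lebesgue g"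
    using integrable_distr[OF m, of g] that unfolding lebesgue_distr_translation(1) by (simp add: add.commute)
  show "(\<integral>x. g (x + a) \<partial>lebesgue) = (\<integral>x. g x \<partial>lebesgue)" if "g \<in> borel_measurable lebesgue"
    using integral_distr[OF m that] unfolding lebesgue_distr_translation(1) by (simp add: add.commute)
qed

lemma AE_lebesgue_translation:
  fixes P :: "'a::euclidean_space \<Rightarrow> bool"
  assumes "AE x in lebesgue. P x"
  shows "AE x in lebesgue. P (x + a)"
proof -
  have "AE x in distr lebesgue lebesgue (\<lambda>x. a + x). P x"
    unfolding lebesgue_distr_translation(1) by (rule assms)
  then have "AE x in lebesgue. P (a + x)"
    by (rule AE_distrD[OF lebesgue_distr_translation(2)])
  then show ?thesis by (simp add: add.commute)
qed

lemma C1c_field_translation: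
  fixes \<phi> :: "real^'n \<Rightarrow> real^'n"
  assumes "C1c_field \<phi>"
  shows "C1c_field (\<lambda>x. \<phi> (x + a))" "divergence (\<lambda>x. \<phi> (x + a)) x = divergence \<phi> (x + a)"
proof -
  from assms obtain \<phi>' R where d: "\<And>x. (\<phi> has_derivative \<phi>' x) (at x)"
    "\<And>v. continuous_on UNIV (\<lambda>x. \<phi>' x v)"
    "\<And>x. norm x > R \<Longrightarrow> \<phi> x = 0" "\<And>x. divergence \<phi> x = (\<Sum>i\<in>UNIV. \<phi>' x (axis i 1) $ i)" "R > 0"
    by (rule C1c_fieldE) blast
  have *: "((\<lambda>x. \<phi> (x + a)) has_derivative \<phi>' (x + a)) (at x)" for x
  proof -
    have "((\<lambda>x. x + a) has_derivative (\<lambda>v. v)) (at x)" by (auto intro!: derivative_eq_intros)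
    from has_derivative_compose[OF this d(1)[of "x + a"]] show ?thesis .
  qed
  have **: "continuous_on UNIV (\<lambda>x. \<phi>' (x + a) v)" for v
    by (rule continuous_on_compose2[OF d(2)]) (auto intro!: continuous_intros)
  have ***: "\<phi> (x + a) = 0" if "norm x > R + norm a" for x
    using that norm_triangle_ineq4[of "x + a" a] by (intro d(3)) simp
  show "C1c_field (\<lambda>x. \<phi> (x + a))" "divergence (\<lambda>x. \<phi> (x + a)) x = divergence \<phi> (x + a)"
    using C1c_fieldI[OF * ** ***] d(4) by auto
qed

lemma BV_translation:
  assumes "u \<in> BV"
  shows "(\<lambda>x. u (x + a)) \<in> BV" "tv (\<lambda>x. u (x + a)) = tv u"
proof -
  have main: "(\<lambda>x. u (x + a)) \<in> BV \<and> tv (\<lambda>x. u (x + a)) \<le> tv u" if "u \<in> BV" for u :: "real^'a \<Rightarrow> real" and a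
  proof -
    have "(\<integral>x. u (x + a) * divergence \<phi> x \<partial>lebesgue) \<le> tv u"
      if \<phi>: "C1c_field \<phi>" "\<And>x. norm (\<phi> x) \<le> 1" for \<phi>
    proof -
      have *: "divergence (\<lambda>x. \<phi> (x + - a)) x = divergence \<phi> (x - a)" for x
        using C1c_field_translation(2)[OF \<phi>(1), of "- a" x] by simp
      have "(\<integral>x. u (x + a) * divergence \<phi> x \<partial>lebesgue) = (\<integral>x. u (x + a) * divergence (\<lambda>x. \<phi> (x + - a)) (x + a) \<partial>lebesgue)"
        unfolding * by simp
      also have "\<dots> = (\<integral>x. u x * divergence (\<lambda>x. \<phi> (x + - a)) x \<partial>lebesgue)"
        using C1c_field_translation(1)[OF \<phi>(1), of "- a"] integrable_mult_divergence[OF BV_integrable[OF \<open>u \<in> BV\<close>]]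
        by (subst integral_lebesgue_translation[where g="\<lambda>x. u x * divergence (\<lambda>x. \<phi> (x + - a)) x"]) auto
      also have "\<dots> \<le> tv u"
        using C1c_field_translation(1)[OF \<phi>(1), of "- a"] \<phi>(2) \<open>u \<in> BV\<close> by (intro tv_upper) auto
      finally show ?thesis .
    qed
    then show ?thesis
      using tv_least[OF integrable_lebesgue_translation[OF BV_integrable[OF that]]] by blast
  qed
  show "(\<lambda>x. u (x + a)) \<in> BV" using main assms by blast
  \<comment> \<open>Translating back by \<open>- a\<close> exchanges the roles of the two
    functions.\<close>
  have "tv u \<le> tv (\<lambda>x. u (x + a))"
    using main[of "\<lambda>x. u (x + a)" "- a"] main[OF assms] by simp
  then show "tv (\<lambda>x. u (x + a)) = tv u" using main[OF assms, of a] by simp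
qed

section \<open>Compactly supported test functions\<close>

text \<open>Carrying the derivative as an argument lets later statements refer to it without a
  choice operator.\<close>

definition C1c_fun :: "(real^'n \<Rightarrow> real) \<Rightarrow> (real^'n \<Rightarrow> real^'n \<Rightarrow> real) \<Rightarrow> bool" where
  "C1c_fun \<psi> \<psi>' \<longleftrightarrow> (\<forall>x. (\<psi> has_derivative \<psi>' x) (at x)) \<and>
     (\<forall>v. continuous_on UNIV (\<lambda>x. \<psi>' x v)) \<and> (\<exists>R>0. \<forall>x. norm x > R \<longrightarrow> \<psi> x = 0)"

lemma linear_sum_axis:
  fixes L :: "real^'n \<Rightarrow> real"
  assumes "linear L"
  shows "(\<Sum>i\<in>UNIV. L (axis i 1) * v $ i) = L v"
proof -
  interpret linear L by fact
  have "L v = L (\<Sum>j\<in>UNIV. v $ j *\<^sub>R axis j 1)"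
    using basis_expansion[of v] by (simp add: scalar_mult_eq_scaleR)
  then show ?thesis by (simp add: sum scale mult.commute)
qed

text \<open>Compact support is asked of \<open>\<phi>\<close> alone, so that the factor may be
  \<open>cutoff R\<close> as well as \<open>1 - cutoff R\<close>.\<close>

lemma C1c_field_scaleR:
  fixes \<xi> :: "real^'n \<Rightarrow> real" and \<phi> :: "real^'n \<Rightarrow> real^'n"
  assumes d: "\<And>x. (\<xi> has_derivative \<xi>' x) (at x)" and c: "\<And>v. continuous_on UNIV (\<lambda>x. \<xi>' x v)"
    and "C1c_field \<phi>"
  shows "C1c_field (\<lambda>x. \<xi> x *\<^sub>R \<phi> x)"
    "divergence (\<lambda>x. \<xi> x *\<^sub>R \<phi> x) x = \<xi> x * divergence \<phi> x + \<xi>' x (\<phi> x)"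
proof -
  from assms(3) obtain \<phi>' R where e: "\<And>x. (\<phi> has_derivative \<phi>' x) (at x)"
    "\<And>v. continuous_on UNIV (\<lambda>x. \<phi>' x v)"
    "\<And>x. norm x > R \<Longrightarrow> \<phi> x = 0" "\<And>x. divergence \<phi> x = (\<Sum>i\<in>UNIV. \<phi>' x (axis i 1) $ i)" "R > 0"
    by (rule C1c_fieldE) blast
  have c\<xi>: "continuous_on UNIV \<xi>" "continuous_on UNIV \<phi>"
    by (rule has_derivative_continuous_on[of _ _ \<xi>'], simp add: d)
      (rule has_derivative_continuous_on[of _ _ \<phi>'], simp add: e)
  have 1: "((\<lambda>x. \<xi> x *\<^sub>R \<phi> x) has_derivative (\<lambda>v. \<xi> x *\<^sub>R \<phi>' x v + \<xi>' x v *\<^sub>R \<phi> x)) (at x)" for x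
    by (rule has_derivative_scaleR[OF d e(1)])
  have 2: "continuous_on UNIV (\<lambda>x. \<xi> x *\<^sub>R \<phi>' x v + \<xi>' x v *\<^sub>R \<phi> x)" for v
    by (intro continuous_intros c\<xi> c e)
  have 3: "\<xi> x *\<^sub>R \<phi> x = 0" if "norm x > R" for x using e(3)[OF that] by simp
  show "C1c_field (\<lambda>x. \<xi> x *\<^sub>R \<phi> x)" by (rule C1c_fieldI(1)[OF 1 2 3])
  have "(\<Sum>i\<in>UNIV. \<xi>' x (axis i 1) * \<phi> x $ i) = \<xi>' x (\<phi> x)"
    by (rule linear_sum_axis[OF has_derivative_linear[OF d]])
  then show "divergence (\<lambda>x. \<xi> x *\<^sub>R \<phi> x) x = \<xi> x * divergence \<phi> x + \<xi>' x (\<phi> x)"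
    by (subst C1c_fieldI(2)[OF 1 2 3]) (auto simp: sum.distrib e(4) sum_distrib_left)
qed

text \<open>Such fields probe the variation in the single direction \<open>h\<close>, which is all
  that a translate by \<open>h\<close> can see.\<close>

lemma C1c_field_direction:
  fixes \<psi> :: "real^'n \<Rightarrow> real"
  assumes "C1c_fun \<psi> \<psi>'"
  shows "C1c_field (\<lambda>x. \<psi> x *\<^sub>R h)" "divergence (\<lambda>x. \<psi> x *\<^sub>R h) x = \<psi>' x h"
proof -
  have d: "(\<psi> has_derivative \<psi>' x) (at x)" "continuous_on UNIV (\<lambda>x. \<psi>' x v)" for x v
    using assms unfolding C1c_fun_def by auto
  obtain R where R: "\<And>x. norm x > R \<Longrightarrow> \<psi> x = 0" using assms unfolding C1c_fun_def by auto
  have 1: "((\<lambda>x. \<psi> x *\<^sub>R h) has_derivative (\<lambda>v. \<psi>' x v *\<^sub>R h)) (at x)" for x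
    by (rule has_derivative_scaleR_left[OF d(1)])
  have 2: "continuous_on UNIV (\<lambda>x. \<psi>' x v *\<^sub>R h)" for v
    by (intro continuous_intros d)
  have 3: "\<psi> x *\<^sub>R h = 0" if "norm x > R" for x using R[OF that] by simp
  show "C1c_field (\<lambda>x. \<psi> x *\<^sub>R h)" by (rule C1c_fieldI(1)[OF 1 2 3])
  show "divergence (\<lambda>x. \<psi> x *\<^sub>R h) x = \<psi>' x h"
    using linear_sum_axis[OF has_derivative_linear[OF d(1)[of x]], of h]
    by (subst C1c_fieldI(2)[OF 1 2 3]) auto
qed

lemma C1c_fun_bounded:
  assumes "C1c_fun \<psi> \<psi>'"
  obtains B where "\<And>x. \<bar>\<psi>' x h\<bar> \<le> B" "\<And>x. \<bar>\<psi> x\<bar> \<le> B" "B \<ge> 0"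
proof -
  have "\<exists>B. \<forall>x. \<bar>g x\<bar> \<le> B" if "continuous_on UNIV g" "\<And>x. norm x > R \<Longrightarrow> g x = 0" for g :: "real^'n \<Rightarrow> real" and R
  proof -
    have "compact (g ` cball 0 R)"
      by (intro compact_continuous_image continuous_on_subset[OF that(1)]) auto
    then obtain B where B: "\<And>x. norm x \<le> R \<Longrightarrow> \<bar>g x\<bar> \<le> B"
      unfolding compact_eq_bounded_closed bounded_iff by (metis dist_0_norm image_eqI mem_cball real_norm_def)
    have "\<bar>g x\<bar> \<le> max B 0" for x
      using B[of x] that(2)[of x] by (cases "norm x \<le> R") auto
    then show ?thesis by blast
  qed
  note b = this
  have d: "(\<psi> has_derivative \<psi>' x) (at x)" "continuous_on UNIV (\<lambda>x. \<psi>' x v)" for x v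
    using assms unfolding C1c_fun_def by auto
  obtain R where R: "\<And>x. norm x > R \<Longrightarrow> \<psi> x = 0" using assms unfolding C1c_fun_def by auto
  have "continuous_on UNIV \<psi>"
    by (rule has_derivative_continuous_on) (use d in simp)
  then obtain B1 where B1: "\<And>x. \<bar>\<psi> x\<bar> \<le> B1" using b[of \<psi> R] R by blast
  have "\<psi>' x h = 0" if "norm x > R" for x
    using has_derivative_eq_0_outside[OF d(1) R that] by simp
  then obtain B2 where B2: "\<And>x. \<bar>\<psi>' x h\<bar> \<le> B2" using b[OF d(2)] by blast
  show thesis
    by (rule that[of "max B1 B2"]) (use B1 B2 order_trans[OF abs_ge_zero B1] in \<open>auto simp: le_max_iff_disj\<close>)
qed

lemma C1c_fun_continuous:
  assumes "C1c_fun \<psi> \<psi>'"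
  shows "continuous_on UNIV \<psi>" "continuous_on UNIV (\<lambda>x. \<psi>' x v)"
  using assms unfolding C1c_fun_def by (auto intro: has_derivative_continuous_on)

lemma C1c_fun_measurable:
  assumes "C1c_fun \<psi> \<psi>'"
  shows "\<psi> \<in> borel_measurable borel" "(\<lambda>x. \<psi>' x v) \<in> borel_measurable borel"
  using C1c_fun_continuous[OF assms] by (auto intro: borel_measurable_continuous_onI)

lemma integrable_indicator_cball:
  "integrable lebesgue (indicator (cball a d) :: 'a::euclidean_space \<Rightarrow> real)"
  by (simp add: integrable_completion emeasure_lborel_cball_finite[unfolded infinity_ennreal_def] integrable_indicator_iff less_top)

text \<open>The translation is put on the smooth factor, since \<open>u\<close> has no pointwise
  derivative. The difference quotients of \<open>\<psi>\<close> are bounded by its Lipschitz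
  constant in direction \<open>h\<close>, and this constant times |u| dominates.\<close>

lemma has_derivative_translated_pairing:
  fixes u :: "real^'n \<Rightarrow> real"
  assumes "C1c_fun \<psi> \<psi>'" "integrable lebesgue u"
  shows "((\<lambda>s. \<integral>x. u x * \<psi> (x + s *\<^sub>R h) \<partial>lebesgue) has_real_derivative
           (\<integral>x. u x * \<psi>' (x + s *\<^sub>R h) h \<partial>lebesgue)) (at s)"
proof -
  obtain B where B: "\<And>x. \<bar>\<psi>' x h\<bar> \<le> B" "\<And>x. \<bar>\<psi> x\<bar> \<le> B" "B \<ge> 0"
    using C1c_fun_bounded[OF assms(1)] by blast
  have d: "(\<psi> has_derivative \<psi>' x) (at x)" for x
    using assms unfolding C1c_fun_def by auto
  have ds: "((\<lambda>s. \<psi> (x + s *\<^sub>R h)) has_real_derivative \<psi>' (x + s *\<^sub>R h) h) (at s)" for x s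
  proof -
    have 1: "((\<lambda>s. x + s *\<^sub>R h) has_derivative (\<lambda>v. v *\<^sub>R h)) (at s)"
      by (auto intro!: derivative_eq_intros)
    have "((\<lambda>s. \<psi> (x + s *\<^sub>R h)) has_derivative (\<lambda>v. \<psi>' (x + s *\<^sub>R h) (v *\<^sub>R h))) (at s)"
      using has_derivative_compose[OF 1 d] .
    moreover have "\<psi>' (x + s *\<^sub>R h) (v *\<^sub>R h) = \<psi>' (x + s *\<^sub>R h) h * v" for v
      using linear_scale[OF has_derivative_linear[OF d]] by simp
    ultimately show ?thesis by (simp add: has_field_derivative_def)
  qed
  have lip: "\<bar>\<psi> (x + s *\<^sub>R h) - \<psi> (x + r *\<^sub>R h)\<bar> \<le> B * \<bar>s - r\<bar>" for x s r
    using field_differentiable_bound[of UNIV "\<lambda>s. \<psi> (x + s *\<^sub>R h)" "\<lambda>s. \<psi>' (x + s *\<^sub>R h) h" B s r]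
      ds B(1) by auto
  have m[measurable]: "u \<in> borel_measurable lebesgue" using assms(2) by auto
  have m1[measurable]: "(\<lambda>x. \<psi> (x + s *\<^sub>R h)) \<in> borel_measurable lebesgue"
    "(\<lambda>x. \<psi>' (x + s *\<^sub>R h) h) \<in> borel_measurable lebesgue" for s
    using C1c_fun_measurable[OF assms(1)] by (auto intro!: borel_measurable_lebesgue_of_borel)
  have i: "integrable lebesgue (\<lambda>x. u x * \<psi> (x + s *\<^sub>R h))" for s
    by (rule integrable_bounded_mult[OF assms(2) m1(1) B(2)])
  show ?thesis
    unfolding has_field_derivative_iff tendsto_at_iff_sequentially comp_def
  proof (intro allI impI)
    fix X :: "nat \<Rightarrow> real" assume X: "\<forall>i. X i \<in> UNIV - {s}" "X \<longlonglongrightarrow> s"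
    have eq: "((\<integral>x. u x * \<psi> (x + X n *\<^sub>R h) \<partial>lebesgue) - (\<integral>x. u x * \<psi> (x + s *\<^sub>R h) \<partial>lebesgue)) / (X n - s)
       = (\<integral>x. u x * ((\<psi> (x + X n *\<^sub>R h) - \<psi> (x + s *\<^sub>R h)) / (X n - s)) \<partial>lebesgue)" for n
      by (subst Bochner_Integration.integral_diff[OF i i, symmetric], subst integral_divide_zero[symmetric])
        (simp add: right_diff_distrib)
    show "(\<lambda>n. ((\<integral>x. u x * \<psi> (x + X n *\<^sub>R h) \<partial>lebesgue) - (\<integral>x. u x * \<psi> (x + s *\<^sub>R h) \<partial>lebesgue)) / (X n - s))
        \<longlonglongrightarrow> (\<integral>x. u x * \<psi>' (x + s *\<^sub>R h) h \<partial>lebesgue)"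
      unfolding eq
    proof (rule integral_dominated_convergence[where w="\<lambda>x. B * \<bar>u x\<bar>"])
      show "integrable lebesgue (\<lambda>x. B * \<bar>u x\<bar>)" using assms(2) by auto
      show "AE x in lebesgue. (\<lambda>n. u x * ((\<psi> (x + X n *\<^sub>R h) - \<psi> (x + s *\<^sub>R h)) / (X n - s)))
          \<longlonglongrightarrow> u x * \<psi>' (x + s *\<^sub>R h) h"
      proof (intro AE_I2 tendsto_mult_left)
        fix x
        show "(\<lambda>n. (\<psi> (x + X n *\<^sub>R h) - \<psi> (x + s *\<^sub>R h)) / (X n - s)) \<longlonglongrightarrow> \<psi>' (x + s *\<^sub>R h) h"
          using ds[of x s] X unfolding has_field_derivative_iff tendsto_at_iff_sequentially comp_def by blast
      qed
      show "AE x in lebesgue. norm (u x * ((\<psi> (x + X n *\<^sub>R h) - \<psi> (x + s *\<^sub>R h)) / (X n - s))) \<le> B * \<bar>u x\<bar>" for n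
      proof (intro AE_I2)
        fix x
        have "\<bar>(\<psi> (x + X n *\<^sub>R h) - \<psi> (x + s *\<^sub>R h)) / (X n - s)\<bar> \<le> B"
          using lip[of x "X n" s] X(1) by (auto simp: abs_divide divide_simps)
        then show "norm (u x * ((\<psi> (x + X n *\<^sub>R h) - \<psi> (x + s *\<^sub>R h)) / (X n - s))) \<le> B * \<bar>u x\<bar>"
          unfolding real_norm_def abs_mult mult.commute[of B] by (rule mult_left_mono) simp
      qed
    qed measurable
  qed
qed

lemma C1c_fun_translation:
  fixes \<psi> :: "real^'n \<Rightarrow> real"
  assumes "C1c_fun \<psi> \<psi>'"
  shows "C1c_fun (\<lambda>x. \<psi> (x + a)) (\<lambda>x. \<psi>' (x + a))"
proof -
  obtain R where R: "R > 0" "\<And>x. norm x > R \<Longrightarrow> \<psi> x = 0" using assms unfolding C1c_fun_def by auto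
  have "((\<lambda>x. \<psi> (x + a)) has_derivative \<psi>' (x + a)) (at x)" for x
  proof -
    have "((\<lambda>x. x + a) has_derivative (\<lambda>v. v)) (at x)" by (auto intro!: derivative_eq_intros)
    from has_derivative_compose[OF this] assms show ?thesis unfolding C1c_fun_def by metis
  qed
  moreover have "continuous_on UNIV (\<lambda>x. \<psi>' (x + a) v)" for v
    by (rule continuous_on_compose2[OF C1c_fun_continuous(2)[OF assms]]) (auto intro!: continuous_intros)
  moreover have "\<psi> (x + a) = 0" if "norm x > R + norm a" for x
    using that norm_triangle_ineq4[of "x + a" a] by (intro R(2)) simp
  moreover have "R + norm a > 0" using R(1) by (simp add: add_pos_nonneg)
  ultimately show ?thesis unfolding C1c_fun_def by blast
qed

text \<open>\<open>G\<close> runs from the pairing with the translated function to the original one.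
  Its derivative is a pairing of \<open>u\<close> with a divergence, hence controlled by
  \<open>tv u\<close>, and the mean value theorem on [-1, 0] concludes.\<close>

lemma BV_translation_pairing:
  fixes u :: "real^'n \<Rightarrow> real"
  assumes "u \<in> BV" "C1c_fun \<psi> \<psi>'" "\<And>x. \<bar>\<psi> x\<bar> \<le> 1"
  shows "(\<integral>x. (u (x + h) - u x) * \<psi> x \<partial>lebesgue) \<le> norm h * tv u"
proof (cases "h = 0")
  case False
  note i = BV_integrable[OF assms(1)]
  define G where "G s = (\<integral>x. u x * \<psi> (x + s *\<^sub>R h) \<partial>lebesgue)" for s
  define G' where "G' s = (\<integral>x. u x * \<psi>' (x + s *\<^sub>R h) h \<partial>lebesgue)" for s
  have DG: "(G has_real_derivative G' s) (at s)" for s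
    unfolding G_def[abs_def] G'_def by (rule has_derivative_translated_pairing[OF assms(2) i])
  have bnd: "- G' s \<le> norm h * tv u" for s
  proof -
    define \<eta> where "\<eta> x = \<psi> (x + s *\<^sub>R h)" for x
    have \<eta>: "C1c_fun \<eta> (\<lambda>x. \<psi>' (x + s *\<^sub>R h))"
      unfolding \<eta>_def[abs_def] by (rule C1c_fun_translation[OF assms(2)])
    \<comment> \<open>A unit vector opposite to \<open>h\<close>: the sign turns the upper bound of
      \<open>tv_upper\<close> into the bound on \<open>- G' s\<close>, which is what
      \<open>G (-1) - G 0\<close> requires.\<close>
    define k where "k = (- 1 / norm h) *\<^sub>R h"
    have lin: "\<psi>' x k = (- 1 / norm h) * \<psi>' x h" for x
      unfolding k_def using assms(2) linear_scale[OF has_derivative_linear] unfolding C1c_fun_def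
      by (metis real_scaleR_def)
    have "(\<integral>x. u x * divergence (\<lambda>x. \<eta> x *\<^sub>R k) x \<partial>lebesgue) \<le> tv u"
    proof (rule tv_upper[OF assms(1) C1c_field_direction(1)[OF \<eta>]])
      have "norm k = 1" using False by (simp add: k_def)
      then show "norm (\<eta> x *\<^sub>R k) \<le> 1" for x using assms(3) by (simp add: \<eta>_def)
    qed
    moreover have "(\<integral>x. u x * divergence (\<lambda>x. \<eta> x *\<^sub>R k) x \<partial>lebesgue) = (- 1 / norm h) * G' s"
      unfolding C1c_field_direction(2)[OF \<eta>] lin G'_def
      by (subst integral_mult_right_zero[symmetric]) (simp add: mult_ac)
    ultimately show ?thesis using False by (simp add: field_simps)
  qed
  have "\<exists>z>-1. z < 0 \<and> G 0 - G (-1) = (0 - (-1)) * G' z"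
    by (rule MVT2) (use DG in auto)
  then obtain z where "G 0 - G (-1) = G' z" by auto
  then have le: "G (-1) - G 0 \<le> norm h * tv u" using bnd[of z] by simp
  have [measurable]: "\<psi> \<in> borel_measurable lebesgue"
    using C1c_fun_measurable[OF assms(2)] by (auto intro!: borel_measurable_lebesgue_of_borel)
  have ii: "integrable lebesgue (\<lambda>x. v x * \<psi> (x + a))" if "integrable lebesgue v" for a and v :: "real^'n \<Rightarrow> real"
    by (rule integrable_bounded_mult[OF that measurable_lebesgue_translation assms(3)]) measurable
  have "G (-1) = (\<integral>x. u (x + h) * \<psi> ((x + h) - h) \<partial>lebesgue)"
    unfolding G_def using ii[OF i, of "- h"]
    by (subst integral_lebesgue_translation[where a=h and g="\<lambda>x. u x * \<psi> (x - h)"]) auto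
  moreover have "G 0 = (\<integral>x. u x * \<psi> x \<partial>lebesgue)" unfolding G_def by simp
  ultimately have "(\<integral>x. (u (x + h) - u x) * \<psi> x \<partial>lebesgue) = G (-1) - G 0"
    using ii[OF i, of 0] ii[OF integrable_lebesgue_translation[OF i, of h], of 0]
    by (simp add: left_diff_distrib)
  then show ?thesis using le by simp
qed simp

text \<open>Translation invariance makes the integral of the i-th component, shifted along the i-th
  axis, constant in the shift; its derivative at 0 is the integral of one summand of the
  divergence.\<close>

lemma integral_divergence_eq_0:
  fixes \<phi> :: "real^'n \<Rightarrow> real^'n"
  assumes "C1c_field \<phi>"
  shows "(\<integral>x. divergence \<phi> x \<partial>lebesgue) = 0"
proof -
  from assms obtain \<phi>' R where d: "\<And>x. (\<phi> has_derivative \<phi>' x) (at x)"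
    "\<And>v. continuous_on UNIV (\<lambda>x. \<phi>' x v)"
    "\<And>x. norm x > R \<Longrightarrow> \<phi> x = 0" "\<And>x. divergence \<phi> x = (\<Sum>i\<in>UNIV. \<phi>' x (axis i 1) $ i)" "R > 0"
    by (rule C1c_fieldE) blast
  \<comment> \<open>Provides the integrable factor of the differentiation lemma. The margin 1 beyond
    the support keeps shifted supports inside the ball as long as |s| < 1.\<close>
  define u :: "real^'n \<Rightarrow> real" where "u = indicator (cball 0 (R + 1))"
  have iu: "integrable lebesgue u"
    unfolding u_def by (rule integrable_indicator_cball)
  have *: "(\<integral>x. \<phi>' x (axis i 1) $ i \<partial>lebesgue) = 0 \<and> integrable lebesgue (\<lambda>x. \<phi>' x (axis i 1) $ i)" for i
  proof -
    let ?\<psi> = "\<lambda>x. \<phi> x $ i" and ?\<psi>' = "\<lambda>x v. \<phi>' x v $ i"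
    have \<psi>: "C1c_fun ?\<psi> ?\<psi>'"
      unfolding C1c_fun_def using d by (auto intro!: continuous_intros derivative_intros exI[of _ R]
          bounded_linear.has_derivative[OF bounded_linear_vec_nth])
    define G where "G s = (\<integral>x. u x * ?\<psi> (x + s *\<^sub>R axis i 1) \<partial>lebesgue)" for s
    have DG: "(G has_real_derivative (\<integral>x. u x * ?\<psi>' (x + 0 *\<^sub>R axis i 1) (axis i 1) \<partial>lebesgue)) (at 0)"
      unfolding G_def[abs_def] by (rule has_derivative_translated_pairing[OF \<psi> iu])
    have m: "?\<psi> \<in> borel_measurable lebesgue"
      using C1c_fun_measurable[OF \<psi>] by (auto intro!: borel_measurable_lebesgue_of_borel)
    have "G s = (\<integral>x. ?\<psi> x \<partial>lebesgue)" if "\<bar>s\<bar> < 1" for s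
    proof -
      have "u x * ?\<psi> (x + s *\<^sub>R axis i 1) = ?\<psi> (x + s *\<^sub>R axis i 1)" for x
      proof (cases "norm x \<le> R + 1")
        case False
        have "norm (s *\<^sub>R axis i 1 :: real^'n) < 1" using that by (simp add: norm_axis_1)
        then have "norm (x + s *\<^sub>R axis i 1) > R"
          using False norm_triangle_ineq4[of "x + s *\<^sub>R axis i 1" "s *\<^sub>R axis i 1"] by simp
        then show ?thesis using d(3) by simp
      qed (simp add: u_def)
      then show ?thesis unfolding G_def by (simp only: integral_lebesgue_translation[OF m])
    qed
    note G_const = this
    have "(G has_real_derivative 0) (at 0)"
      by (rule has_field_derivative_transform_within_open[where S="{-1<..<1}" and f="\<lambda>_. \<integral>x. ?\<psi> x \<partial>lebesgue"])
        (simp_all add: G_const abs_less_iff)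
    then have i0: "(\<integral>x. u x * ?\<psi>' x (axis i 1) \<partial>lebesgue) = 0"
      using DERIV_unique[OF DG] by simp
    have eq: "u x * ?\<psi>' x (axis i 1) = ?\<psi>' x (axis i 1)" for x
    proof (cases "norm x \<le> R")
      case False
      then have "norm x > R" by simp
      from has_derivative_eq_0_outside[OF d(1) d(3) this] show ?thesis by simp
    qed (simp add: u_def)
    obtain B where "\<And>x. \<bar>?\<psi>' x (axis i 1)\<bar> \<le> B" using C1c_fun_bounded[OF \<psi>] by blast
    then have "integrable lebesgue (\<lambda>x. u x * ?\<psi>' x (axis i 1))"
      using C1c_fun_measurable[OF \<psi>] by (intro integrable_bounded_mult[OF iu]) (auto intro!: borel_measurable_lebesgue_of_borel)
    then show ?thesis using i0 unfolding eq by simp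
  qed
  then show ?thesis unfolding d(4) by (subst Bochner_Integration.integral_sum) auto
qed

section \<open>Cutoff functions\<close>

text \<open>The reason for the outer square in \<open>cutoff\<close>: it removes the kink of the
  positive part at 0.\<close>

lemma has_real_derivative_pos_part_square:
  "((\<lambda>s::real. (max 0 s)\<^sup>2) has_real_derivative 2 * max 0 s) (at s)"
proof -
  consider "s > 0" | "s < 0" | "s = 0" by linarith
  then show ?thesis
  proof cases
    case 1
    have "((\<lambda>s::real. s\<^sup>2) has_real_derivative 2 * max 0 s) (at s)"
      using 1 by (auto intro!: derivative_eq_intros)
    then show ?thesis
      by (rule has_field_derivative_transform_within_open[where S="{0<..}"]) (use 1 in auto)
  next
    case 2
    have "((\<lambda>s::real. 0) has_real_derivative 2 * max 0 s) (at s)"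
      using 2 by (auto intro!: derivative_eq_intros)
    then show ?thesis
      by (rule has_field_derivative_transform_within_open[where S="{..<0}"]) (use 2 in auto)
  next
    case 3
    have "((\<lambda>h::real. (max 0 h)\<^sup>2 / h) \<longlongrightarrow> 0) (at 0)"
    proof (rule Lim_null_comparison[of _ "\<lambda>h. \<bar>h\<bar>"])
      show "\<forall>\<^sub>F h::real in at 0. norm ((max 0 h)\<^sup>2 / h) \<le> \<bar>h\<bar>"
        by (rule always_eventually) (auto simp: max_def power2_eq_square)
      show "((\<lambda>h::real. \<bar>h\<bar>) \<longlongrightarrow> 0) (at 0)" by (intro tendsto_eq_intros) auto
    qed
    then show ?thesis using 3 by (simp add: DERIV_def)
  qed
qed

definition cutoff :: "real \<Rightarrow> real^'n \<Rightarrow> real" where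
  "cutoff R x = (max 0 (1 - (norm x)\<^sup>2 / R\<^sup>2))\<^sup>2"

definition cutoff' :: "real \<Rightarrow> real^'n \<Rightarrow> real^'n \<Rightarrow> real" where
  "cutoff' R x v = 2 * max 0 (1 - (norm x)\<^sup>2 / R\<^sup>2) * (- (2 * (x \<bullet> v)) / R\<^sup>2)"

lemma cutoff_bounds: "0 \<le> cutoff R x" "cutoff R x \<le> 1"
proof -
  have "max 0 (1 - (norm x)\<^sup>2 / R\<^sup>2) \<le> 1" by simp
  then show "cutoff R x \<le> 1" unfolding cutoff_def using power_le_one[of "max 0 (1 - (norm x)\<^sup>2 / R\<^sup>2)" 2] by simp
qed (simp add: cutoff_def)

lemma has_derivative_cutoff:
  fixes x :: "real^'n"
  shows "(cutoff R has_derivative cutoff' R x) (at x)"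
proof -
  have 1: "((\<lambda>x::real^'n. 1 - (norm x)\<^sup>2 / R\<^sup>2) has_derivative (\<lambda>v. - (2 * (x \<bullet> v)) / R\<^sup>2)) (at x)"
    unfolding power2_norm_eq_inner divide_inverse
    by (auto intro!: derivative_eq_intros simp: inner_commute algebra_simps)
  have 2: "((\<lambda>s::real. (max 0 s)\<^sup>2) has_derivative (\<lambda>v. 2 * max 0 (1 - (norm x)\<^sup>2 / R\<^sup>2) * v)) (at (1 - (norm x)\<^sup>2 / R\<^sup>2))"
    using has_real_derivative_pos_part_square unfolding has_field_derivative_def by blast
  show ?thesis
    unfolding cutoff_def[abs_def] cutoff'_def[abs_def] using has_derivative_compose[OF 1 2] .
qed

lemma continuous_cutoff': "continuous_on UNIV (\<lambda>x. cutoff' R x v)"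
  unfolding cutoff'_def divide_inverse by (intro continuous_intros)

lemma cutoff_outside: "R > 0 \<Longrightarrow> norm x > R \<Longrightarrow> cutoff R x = 0"
  unfolding cutoff_def by (simp add: divide_simps max_def power_mono)

lemma cutoff'_outside:
  assumes "R > 0" "norm x > R"
  shows "cutoff' R x v = 0"
  using assms unfolding cutoff'_def by (simp add: divide_simps max_def power_mono)

lemma cutoff'_bound:
  assumes "R > 0"
  shows "\<bar>cutoff' R x v\<bar> \<le> 4 / R * norm v"
proof (cases "norm x \<le> R")
  case True
  have "\<bar>x \<bullet> v\<bar> \<le> R * norm v"
    using Cauchy_Schwarz_ineq2[of x v] True by (meson mult_right_mono norm_ge_zero order_trans)
  moreover have "\<bar>2 * max 0 (1 - (norm x)\<^sup>2 / R\<^sup>2)\<bar> \<le> 2" by simp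
  ultimately have "\<bar>2 * max 0 (1 - (norm x)\<^sup>2 / R\<^sup>2)\<bar> * \<bar>x \<bullet> v\<bar> \<le> 2 * (R * norm v)"
    by (intro mult_mono) auto
  then have "\<bar>2 * max 0 (1 - (norm x)\<^sup>2 / R\<^sup>2)\<bar> * \<bar>x \<bullet> v\<bar> * (2 / R\<^sup>2) \<le> 2 * (R * norm v) * (2 / R\<^sup>2)"
    by (rule mult_right_mono) simp
  then show ?thesis using assms unfolding cutoff'_def
    by (simp add: abs_mult power2_eq_square mult_ac)
next
  case False
  then show ?thesis using cutoff'_outside[of R x v] assms by simp
qed

lemma cutoff_tendsto_1: "(\<lambda>n. cutoff (real (Suc n)) x) \<longlonglongrightarrow> 1"
proof -
  have "(\<lambda>n. (max 0 (1 - (norm x)\<^sup>2 * (inverse (real (Suc n)))\<^sup>2))\<^sup>2) \<longlonglongrightarrow> (max 0 (1 - (norm x)\<^sup>2 * 0\<^sup>2))\<^sup>2"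
    by (intro tendsto_intros LIMSEQ_inverse_real_of_nat)
  then show ?thesis unfolding cutoff_def by (simp add: divide_inverse power_inverse)
qed

lemma cutoff_measurable: "cutoff R \<in> borel_measurable borel"
  by (intro borel_measurable_continuous_onI) (auto simp: cutoff_def[abs_def] divide_inverse intro!: continuous_intros)

lemma C1c_field_add:
  fixes \<phi> :: "real^'n \<Rightarrow> real^'n"
  assumes "C1c_field \<phi>" "C1c_field \<phi>2"
  shows "C1c_field (\<lambda>x. \<phi> x + \<phi>2 x)" "divergence (\<lambda>x. \<phi> x + \<phi>2 x) x = divergence \<phi> x + divergence \<phi>2 x"
proof -
  from assms(1) obtain \<phi>' R where d: "\<And>x. (\<phi> has_derivative \<phi>' x) (at x)"
    "\<And>v. continuous_on UNIV (\<lambda>x. \<phi>' x v)"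
    "\<And>x. norm x > R \<Longrightarrow> \<phi> x = 0" "\<And>x. divergence \<phi> x = (\<Sum>i\<in>UNIV. \<phi>' x (axis i 1) $ i)" "R > 0"
    by (rule C1c_fieldE) blast
  from assms(2) obtain \<phi>2' R2 where e: "\<And>x. (\<phi>2 has_derivative \<phi>2' x) (at x)"
    "\<And>v. continuous_on UNIV (\<lambda>x. \<phi>2' x v)"
    "\<And>x. norm x > R2 \<Longrightarrow> \<phi>2 x = 0" "\<And>x. divergence \<phi>2 x = (\<Sum>i\<in>UNIV. \<phi>2' x (axis i 1) $ i)" "R2 > 0"
    by (rule C1c_fieldE) blast
  have 1: "((\<lambda>x. \<phi> x + \<phi>2 x) has_derivative (\<lambda>v. \<phi>' x v + \<phi>2' x v)) (at x)" for x
    by (intro derivative_intros d e)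
  have 2: "continuous_on UNIV (\<lambda>x. \<phi>' x v + \<phi>2' x v)" for v
    by (intro continuous_intros d e)
  have 3: "\<phi> x + \<phi>2 x = 0" if "norm x > max R R2" for x using d(3) e(3) that by simp
  show "C1c_field (\<lambda>x. \<phi> x + \<phi>2 x)" "divergence (\<lambda>x. \<phi> x + \<phi>2 x) x = divergence \<phi> x + divergence \<phi>2 x"
    using C1c_fieldI(1)[OF 1 2, of "max R R2"] C1c_fieldI(2)[OF 1 2, of "max R R2"] 3
    by (simp_all add: d(4) e(4) sum.distrib)
qed

text \<open>A field \<open>\<phi>\<close> testing the near part and a field \<open>\<psi>\<close>
  testing the far part are glued into the convex combination \<open>\<eta>\<close>, which is again
  admissible for \<open>u\<close>. This bounds the sum of both variations by a single
  \<open>tv u\<close>. The error is the derivative of the cutoff in direction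
  \<open>\<psi> x - \<phi> x\<close>, a vector of length at most 2, which accounts for 8/R.\<close>

lemma BV_cutoff:
  fixes u :: "real^'n \<Rightarrow> real"
  assumes "u \<in> BV" "R > 0"
  shows "(\<lambda>x. cutoff R x * u x) \<in> BV" "(\<lambda>x. (1 - cutoff R x) * u x) \<in> BV"
    "tv (\<lambda>x. cutoff R x * u x) + tv (\<lambda>x. (1 - cutoff R x) * u x) \<le> tv u + 8 / R * (\<integral>x. \<bar>u x\<bar> \<partial>lebesgue)"
proof -
  note i = BV_integrable[OF assms(1)]
  let ?\<xi> = "cutoff R :: real^'n \<Rightarrow> real"
  have m[measurable]: "?\<xi> \<in> borel_measurable lebesgue"
    by (rule borel_measurable_lebesgue_of_borel[OF cutoff_measurable])
  have [measurable]: "u \<in> borel_measurable lebesgue" using i by auto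
  have b: "\<bar>?\<xi> x\<bar> \<le> 1" "\<bar>1 - ?\<xi> x\<bar> \<le> 1" for x using cutoff_bounds[of R x] by auto
  have i1: "integrable lebesgue (\<lambda>x. ?\<xi> x * u x)"
    using integrable_bounded_mult[OF i m b(1)] by (simp add: mult.commute)
  have i2: "integrable lebesgue (\<lambda>x. (1 - ?\<xi> x) * u x)"
    using integrable_bounded_mult[OF i _ b(2)] by (simp add: mult.commute)
  define K where "K = tv u + 8 / R * (\<integral>x. \<bar>u x\<bar> \<partial>lebesgue)"
  have main: "(\<integral>x. ?\<xi> x * u x * divergence \<phi> x \<partial>lebesgue) + (\<integral>x. (1 - ?\<xi> x) * u x * divergence \<psi> x \<partial>lebesgue) \<le> K"
    if \<phi>: "C1c_field \<phi>" "\<And>x. norm (\<phi> x) \<le> 1" and \<psi>: "C1c_field \<psi>" "\<And>x. norm (\<psi> x) \<le> 1" for \<phi> \<psi>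
  proof -
    have d: "((\<lambda>x. 1 - ?\<xi> x) has_derivative (\<lambda>v. - cutoff' R x v)) (at x)" for x
      using has_derivative_diff[OF has_derivative_const has_derivative_cutoff, of "1::real"] by simp
    note p1 = C1c_field_scaleR[OF has_derivative_cutoff continuous_cutoff' \<phi>(1), of R]
    note p2 = C1c_field_scaleR[OF d _ \<psi>(1), OF continuous_on_minus[OF continuous_cutoff']]
    note p = C1c_field_add[OF p1(1) p2(1)]
    define \<eta> where "\<eta> = (\<lambda>x. ?\<xi> x *\<^sub>R \<phi> x + (1 - ?\<xi> x) *\<^sub>R \<psi> x)"
    have \<eta>: "C1c_field \<eta>" unfolding \<eta>_def by (rule p(1))
    have n: "norm (\<eta> x) \<le> 1" for x
    proof -
      have "norm (\<eta> x) \<le> ?\<xi> x * norm (\<phi> x) + (1 - ?\<xi> x) * norm (\<psi> x)"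
        unfolding \<eta>_def using cutoff_bounds[of R x]
        by (metis (no_types, lifting) abs_of_nonneg diff_ge_0_iff_ge norm_scaleR norm_triangle_ineq)
      also have "\<dots> \<le> ?\<xi> x * 1 + (1 - ?\<xi> x) * 1"
        using cutoff_bounds[of R x] \<phi>(2) \<psi>(2) by (intro add_mono mult_left_mono) auto
      finally show ?thesis by simp
    qed
    have lin: "cutoff' R x (\<psi> x) - cutoff' R x (\<phi> x) = cutoff' R x (\<psi> x - \<phi> x)" for x
      by (metis has_derivative_cutoff has_derivative_linear linear_diff)
    have eq: "?\<xi> x * u x * divergence \<phi> x + (1 - ?\<xi> x) * u x * divergence \<psi> x
        = u x * divergence \<eta> x + u x * cutoff' R x (\<psi> x - \<phi> x)" for x
      unfolding \<eta>_def p(2) p1(2) p2(2) lin[symmetric] by (simp add: algebra_simps)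
    have le: "u x * cutoff' R x (\<psi> x - \<phi> x) \<le> 8 / R * \<bar>u x\<bar>" for x
    proof -
      have "\<bar>cutoff' R x (\<psi> x - \<phi> x)\<bar> \<le> 4 / R * norm (\<psi> x - \<phi> x)" by (rule cutoff'_bound[OF assms(2)])
      also have "\<dots> \<le> 4 / R * 2"
        using norm_triangle_ineq4[of "\<psi> x" "\<phi> x"] \<phi>(2)[of x] \<psi>(2)[of x] assms(2)
        by (intro mult_left_mono) auto
      finally have "\<bar>u x\<bar> * \<bar>cutoff' R x (\<psi> x - \<phi> x)\<bar> \<le> \<bar>u x\<bar> * (8 / R)"
        by (intro mult_left_mono) auto
      then show ?thesis using abs_ge_self[of "u x * cutoff' R x (\<psi> x - \<phi> x)"]
        by (simp add: abs_mult mult.commute)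
    qed
    have ia: "integrable lebesgue (\<lambda>x. ?\<xi> x * u x * divergence \<phi> x)"
      "integrable lebesgue (\<lambda>x. (1 - ?\<xi> x) * u x * divergence \<psi> x)"
      "integrable lebesgue (\<lambda>x. u x * divergence \<eta> x)"
      using integrable_mult_divergence i i1 i2 \<phi> \<psi> \<eta> by blast+
    have "(\<integral>x. ?\<xi> x * u x * divergence \<phi> x \<partial>lebesgue) + (\<integral>x. (1 - ?\<xi> x) * u x * divergence \<psi> x \<partial>lebesgue)
       = (\<integral>x. ?\<xi> x * u x * divergence \<phi> x + (1 - ?\<xi> x) * u x * divergence \<psi> x \<partial>lebesgue)"
      using ia by simp
    also have "\<dots> \<le> (\<integral>x. u x * divergence \<eta> x + 8 / R * \<bar>u x\<bar> \<partial>lebesgue)"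
    proof (rule integral_mono)
      show "integrable lebesgue (\<lambda>x. ?\<xi> x * u x * divergence \<phi> x + (1 - ?\<xi> x) * u x * divergence \<psi> x)"
        using ia by simp
      show "integrable lebesgue (\<lambda>x. u x * divergence \<eta> x + 8 / R * \<bar>u x\<bar>)" using ia i by simp
      show "?\<xi> x * u x * divergence \<phi> x + (1 - ?\<xi> x) * u x * divergence \<psi> x
          \<le> u x * divergence \<eta> x + 8 / R * \<bar>u x\<bar>" for x
        unfolding eq using le by simp
    qed
    also have "\<dots> = (\<integral>x. u x * divergence \<eta> x \<partial>lebesgue) + 8 / R * (\<integral>x. \<bar>u x\<bar> \<partial>lebesgue)"
      using ia(3) i by simp
    also have "\<dots> \<le> K" unfolding K_def using tv_upper[OF assms(1) \<eta> n] by simp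
    finally show ?thesis .
  qed
  have z: "divergence (\<lambda>_::real^'n. 0) x = 0" for x :: "real^'n"
    using C1c_fieldI(2)[of "\<lambda>_. 0" "\<lambda>_ _. 0" 0 x] by simp
  show B1: "(\<lambda>x. ?\<xi> x * u x) \<in> BV"
  proof (rule tv_least(1)[OF i1])
    fix \<phi> :: "real^'n \<Rightarrow> real^'n" assume "C1c_field \<phi>" "\<And>x. norm (\<phi> x) \<le> 1"
    from main[OF this C1c_field_0] show "(\<integral>x. ?\<xi> x * u x * divergence \<phi> x \<partial>lebesgue) \<le> K" by (simp add: z)
  qed
  show B2: "(\<lambda>x. (1 - ?\<xi> x) * u x) \<in> BV"
  proof (rule tv_least(1)[OF i2])
    fix \<phi> :: "real^'n \<Rightarrow> real^'n" assume "C1c_field \<phi>" "\<And>x. norm (\<phi> x) \<le> 1"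
    from main[OF C1c_field_0 _ this] show "(\<integral>x. (1 - ?\<xi> x) * u x * divergence \<phi> x \<partial>lebesgue) \<le> K" by (simp add: z)
  qed
  \<comment> \<open>The two fields may be chosen independently, so each can be nearly optimal for
    its own part.\<close>
  show "tv (\<lambda>x. ?\<xi> x * u x) + tv (\<lambda>x. (1 - ?\<xi> x) * u x) \<le> tv u + 8 / R * (\<integral>x. \<bar>u x\<bar> \<partial>lebesgue)"
  proof (rule field_le_epsilon)
    fix e :: real assume "e > 0"
    then have e: "e / 2 > 0" by simp
    obtain \<phi> where \<phi>: "C1c_field \<phi>" "\<And>x. norm (\<phi> x) \<le> 1"
      "(\<integral>x. ?\<xi> x * u x * divergence \<phi> x \<partial>lebesgue) > tv (\<lambda>x. ?\<xi> x * u x) - e / 2"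
      by (rule tv_approx[OF B1 e]) blast
    obtain \<psi> where \<psi>: "C1c_field \<psi>" "\<And>x. norm (\<psi> x) \<le> 1"
      "(\<integral>x. (1 - ?\<xi> x) * u x * divergence \<psi> x \<partial>lebesgue) > tv (\<lambda>x. (1 - ?\<xi> x) * u x) - e / 2"
      by (rule tv_approx[OF B2 e]) blast
    show "tv (\<lambda>x. ?\<xi> x * u x) + tv (\<lambda>x. (1 - ?\<xi> x) * u x) \<le> tv u + 8 / R * (\<integral>x. \<bar>u x\<bar> \<partial>lebesgue) + e"
      using main[OF \<phi>(1,2) \<psi>(1,2)] \<phi>(3) \<psi>(3) unfolding K_def by linarith
  qed
qed

lemma cutoff_integrable:
  assumes "R > 0"
  shows "integrable lebesgue (cutoff R :: real^'n \<Rightarrow> real)"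
proof -
  have iu: "integrable lebesgue (indicator (cball 0 R) :: real^'n \<Rightarrow> real)"
    by (rule integrable_indicator_cball)
  have "integrable lebesgue (\<lambda>x::real^'n. indicator (cball 0 R) x * cutoff R x)"
    by (rule integrable_bounded_mult[OF iu borel_measurable_lebesgue_of_borel[OF cutoff_measurable], where B=1])
      (simp add: cutoff_bounds)
  moreover have eq: "indicator (cball 0 R) x * cutoff R x = cutoff R x" for x :: "real^'n"
    using cutoff_outside[OF assms, of x] by (cases "norm x \<le> R") auto
  ultimately show ?thesis unfolding eq by simp
qed

text \<open>Provides a nonzero element of \<open>BV\<close>, so that the infimum defining the ground
  level is taken over a nonempty set. By the product rule the pairing equals the integral of a
  divergence, which is 0, minus a term supported in the ball.\<close>

lemma cutoff_BV:
  assumes "R > 0"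
  shows "(cutoff R :: real^'n \<Rightarrow> real) \<in> BV"
proof (rule tv_least(1)[OF cutoff_integrable[OF assms]])
  fix \<phi> :: "real^'n \<Rightarrow> real^'n" assume \<phi>: "C1c_field \<phi>" "\<And>x. norm (\<phi> x) \<le> 1"
  note p = C1c_field_scaleR[OF has_derivative_cutoff continuous_cutoff' \<phi>(1), of R]
  have iu: "integrable lebesgue (indicator (cball 0 R) :: real^'n \<Rightarrow> real)"
    by (rule integrable_indicator_cball)
  have i: "integrable lebesgue (\<lambda>x. cutoff R x * divergence \<phi> x)"
    by (rule integrable_mult_divergence[OF cutoff_integrable[OF assms] \<phi>(1)])
  have le: "- cutoff' R x (\<phi> x) \<le> 4 / R * indicator (cball 0 R) x" for x
  proof (cases "norm x \<le> R")
    case True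
    have "\<bar>cutoff' R x (\<phi> x)\<bar> \<le> 4 / R * norm (\<phi> x)" by (rule cutoff'_bound[OF assms])
    also have "\<dots> \<le> 4 / R * 1" using \<phi>(2) assms by (intro mult_left_mono) auto
    finally show ?thesis using True by (simp add: abs_le_iff)
  next
    case False
    then show ?thesis by (simp add: cutoff'_outside[OF assms])
  qed
  have 0: "cutoff R x * divergence \<phi> x = divergence (\<lambda>x. cutoff R x *\<^sub>R \<phi> x) x - cutoff' R x (\<phi> x)" for x
    unfolding p(2) by simp
  obtain B where B: "\<And>x. \<bar>divergence (\<lambda>x. cutoff R x *\<^sub>R \<phi> x) x\<bar> \<le> B"
    using divergence_bounded[OF p(1)] by blast
  have "divergence (\<lambda>x. cutoff R x *\<^sub>R \<phi> x) x = indicator (cball 0 R) x * divergence (\<lambda>x. cutoff R x *\<^sub>R \<phi> x) x" for x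
    using cutoff'_outside[OF assms, of x] cutoff_outside[OF assms, of x]
    by (cases "norm x \<le> R") (auto simp: p(2))
  from this[symmetric] have id: "integrable lebesgue (\<lambda>x. divergence (\<lambda>x. cutoff R x *\<^sub>R \<phi> x) x)"
    using integrable_bounded_mult[OF iu borel_measurable_lebesgue_of_borel[OF divergence_measurable[OF p(1)]] B]
    by (simp only:)
  have "(\<integral>x. cutoff R x * divergence \<phi> x \<partial>lebesgue)
    \<le> (\<integral>x. divergence (\<lambda>x. cutoff R x *\<^sub>R \<phi> x) x + 4 / R * indicator (cball 0 R) x \<partial>lebesgue)"
    by (rule integral_mono) (use i id iu le 0 in auto)
  also have "\<dots> = 4 / R * (\<integral>x. indicator (cball 0 R :: (real^'n) set) x \<partial>lebesgue)"
    using id iu integral_divergence_eq_0[OF p(1)] by simp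
  finally show "(\<integral>x. cutoff R x * divergence \<phi> x \<partial>lebesgue) \<le> 4 / R * (\<integral>x. indicator (cball 0 R :: (real^'n) set) x \<partial>lebesgue)" .
qed

section \<open>The translation estimate\<close>

text \<open>Polynomials are the smooth approximants of the duality argument below.\<close>

lemma real_polynomial_function_C1:
  fixes p :: "'a::real_normed_vector \<Rightarrow> real"
  assumes "real_polynomial_function p"
  shows "\<exists>p'. (\<forall>x. (p has_derivative p' x) (at x)) \<and> (\<forall>v. continuous_on UNIV (\<lambda>x. p' x v))"
  using assms
proof induction
  case (linear f)
  then show ?case by (intro exI[of _ "\<lambda>_. f"]) (auto intro: bounded_linear_imp_has_derivative)
next
  case (const c)
  then show ?case by (intro exI[of _ "\<lambda>_ _. 0"]) auto
next
  case (add f g)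
  then obtain f' g' where "\<forall>x. (f has_derivative f' x) (at x)" "\<forall>v. continuous_on UNIV (\<lambda>x. f' x v)"
    "\<forall>x. (g has_derivative g' x) (at x)" "\<forall>v. continuous_on UNIV (\<lambda>x. g' x v)" by blast
  then show ?case
    by (intro exI[of _ "\<lambda>x v. f' x v + g' x v"]) (auto intro!: continuous_intros derivative_intros)
next
  case (mult f g)
  then obtain f' g' where *: "\<forall>x. (f has_derivative f' x) (at x)" "\<forall>v. continuous_on UNIV (\<lambda>x. f' x v)"
    "\<forall>x. (g has_derivative g' x) (at x)" "\<forall>v. continuous_on UNIV (\<lambda>x. g' x v)" by blast
  have "continuous_on UNIV f" "continuous_on UNIV g"
    using * by (auto intro: has_derivative_continuous_on)
  with * show ?case
    by (intro exI[of _ "\<lambda>x v. f x * g' x v + f' x v * g x"]) (auto intro!: continuous_intros has_derivative_mult)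
qed

lemma C1c_fun_cutoff_mult:
  fixes p :: "real^'n \<Rightarrow> real"
  assumes "R > 0" "\<And>x. (p has_derivative p' x) (at x)" "\<And>v. continuous_on UNIV (\<lambda>x. p' x v)"
  shows "C1c_fun (\<lambda>x. cutoff R x * p x) (\<lambda>x v. cutoff R x * p' x v + cutoff' R x v * p x)"
proof -
  have "continuous_on UNIV p" "continuous_on UNIV (cutoff R :: real^'n \<Rightarrow> real)"
    using assms(2) has_derivative_cutoff by (auto intro: has_derivative_continuous_on)
  then show ?thesis
    unfolding C1c_fun_def using assms cutoff_outside[OF assms(1)]
    by (auto intro!: continuous_intros continuous_cutoff' has_derivative_mult has_derivative_cutoff exI[of _ R])
qed

text \<open>The ideal test function is the sign of \<open>w\<close>. It is the a.e. limit of
  continuous functions, which are clipped, cut off, and replaced on a large ball by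
  Stone-Weierstrass polynomials; the bound \<open>B\<close> survives each of these steps.\<close>

lemma integral_abs_le_by_duality:
  fixes w :: "real^'n \<Rightarrow> real"
  assumes w: "integrable lebesgue w"
    and B: "\<And>\<psi> \<psi>'. C1c_fun \<psi> \<psi>' \<Longrightarrow> (\<And>x. \<bar>\<psi> x\<bar> \<le> 1) \<Longrightarrow> (\<integral>x. w x * \<psi> x \<partial>lebesgue) \<le> B"
  shows "(\<integral>x. \<bar>w x\<bar> \<partial>lebesgue) \<le> B"
proof -
  have [measurable]: "w \<in> borel_measurable lebesgue" using w by auto
  have "(\<lambda>x. sgn (w x)) \<in> borel_measurable lebesgue" by measurable
  then have "(\<lambda>x. sgn (w x)) measurable_on UNIV"
    by (intro lebesgue_measurable_imp_measurable_on_real) auto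
  then obtain Z g where Z: "negligible Z" and g: "\<And>n::nat. continuous_on UNIV (g n)"
    "\<And>x. x \<notin> Z \<Longrightarrow> (\<lambda>n. g n x) \<longlonglongrightarrow> sgn (w x)"
    unfolding measurable_on_def by auto
  \<comment> \<open>Clipping preserves the limit because \<open>sgn\<close> takes its values in
    [-1, 1].\<close>
  define k where "k n x = max (-1) (min 1 (g n x))" for n x
  have k: "continuous_on UNIV (k n)" "\<bar>k n x\<bar> \<le> 1" for n x
    unfolding k_def by (intro continuous_intros g) auto
  have klim: "(\<lambda>n. k n x) \<longlonglongrightarrow> sgn (w x)" if "x \<notin> Z" for x
  proof -
    have "(\<lambda>n. k n x) \<longlonglongrightarrow> max (-1) (min 1 (sgn (w x)))"
      unfolding k_def by (intro tendsto_intros g that)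
    then show ?thesis by (simp add: sgn_if split: if_splits)
  qed
  have mk[measurable]: "k n \<in> borel_measurable lebesgue" for n
    by (intro borel_measurable_lebesgue_of_borel borel_measurable_continuous_onI k)
  have mc[measurable]: "(cutoff R :: real^'n \<Rightarrow> real) \<in> borel_measurable lebesgue" for R
    by (intro borel_measurable_lebesgue_of_borel cutoff_measurable)
  have cb: "\<bar>cutoff R x\<bar> \<le> 1" for R and x :: "real^'n"
    by (simp add: cutoff_bounds)
  have kb: "\<bar>cutoff R x * k n x\<bar> \<le> 1" for R n x
    using mult_mono[OF cb[of R x] k(2)[of n x]] by (simp add: abs_mult)
  have ik: "integrable lebesgue (\<lambda>x. w x * (cutoff R x * k n x))" for R n
    by (rule integrable_bounded_mult[OF w _ kb]) measurable
  have le: "(\<integral>x. w x * (cutoff (real (Suc n)) x * k n x) \<partial>lebesgue) \<le> B" for n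
  proof -
    let ?R = "real (Suc n)" and ?I = "\<integral>x. \<bar>w x\<bar> \<partial>lebesgue"
    have *: "(\<integral>x. w x * (cutoff ?R x * k n x) \<partial>lebesgue) \<le> (1 + e) * B + e * ?I" if e: "e > 0" for e :: real
    proof -
      obtain p where p: "real_polynomial_function p" "\<And>x. x \<in> cball 0 ?R \<Longrightarrow> \<bar>k n x - p x\<bar> < e"
        using Stone_Weierstrass_real_polynomial_function[OF compact_cball continuous_on_subset[OF k(1)] e, of 0 ?R n]
        by blast
      obtain p' where p': "\<And>x. (p has_derivative p' x) (at x)" "\<And>v. continuous_on UNIV (\<lambda>x. p' x v)"
        using real_polynomial_function_C1[OF p(1)] by blast
      \<comment> \<open>On the ball the polynomial is within \<open>e\<close> of a function bounded
        by 1; the division restores the bound 1 that \<open>B\<close> demands of a test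
        function.\<close>
      define q where "q x = p x / (1 + e)" for x
      have q: "(q has_derivative (\<lambda>v. p' x v / (1 + e))) (at x)" for x
        unfolding q_def[abs_def] using p'(1) e by (auto intro!: derivative_eq_intros)
      have q': "continuous_on UNIV (\<lambda>x. p' x v / (1 + e))" for v
        using e by (intro continuous_intros p') auto
      have pe: "(1 + e) * q x = p x" for x using e by (simp add: q_def)
      have qc: "\<bar>cutoff ?R x * q x\<bar> \<le> 1" for x
      proof (cases "norm x \<le> ?R")
        case True
        then have "\<bar>p x\<bar> \<le> 1 + e" using p(2)[of x] k(2)[of n x] by auto
        then have "\<bar>q x\<bar> \<le> 1" using e by (simp add: q_def)
        then show ?thesis using mult_mono[OF cb[of ?R x] \<open>\<bar>q x\<bar> \<le> 1\<close>] by (simp add: abs_mult)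
      next
        case False
        then have "cutoff ?R x = 0" by (intro cutoff_outside) auto
        then show ?thesis by simp
      qed
      have cf: "C1c_fun (\<lambda>x. cutoff ?R x * q x) (\<lambda>x v. cutoff ?R x * (p' x v / (1 + e)) + cutoff' ?R x v * q x)"
        by (rule C1c_fun_cutoff_mult[OF _ q q']) auto
      have mq[measurable]: "(\<lambda>x. cutoff ?R x * q x) \<in> borel_measurable lebesgue"
        by (intro borel_measurable_lebesgue_of_borel C1c_fun_measurable(1)[OF cf])
      have iq: "integrable lebesgue (\<lambda>x. w x * (cutoff ?R x * q x))"
        by (rule integrable_bounded_mult[OF w mq qc])
      have "(\<integral>x. w x * (cutoff ?R x * k n x) \<partial>lebesgue) \<le> (\<integral>x. (1 + e) * (w x * (cutoff ?R x * q x)) + e * \<bar>w x\<bar> \<partial>lebesgue)"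
      proof (rule integral_mono)
        show "w x * (cutoff ?R x * k n x) \<le> (1 + e) * (w x * (cutoff ?R x * q x)) + e * \<bar>w x\<bar>" for x
        proof -
          have "\<bar>cutoff ?R x * (k n x - p x)\<bar> \<le> e"
          proof (cases "norm x \<le> ?R")
            case True
            then have kp: "\<bar>k n x - p x\<bar> \<le> e" using p(2)[of x] by auto
            show ?thesis using mult_mono[OF cb[of ?R x] kp] by (simp add: abs_mult)
          next
            case False
            then have "cutoff ?R x = 0" by (intro cutoff_outside) auto
            then show ?thesis using e by simp
          qed
          then have "\<bar>w x\<bar> * \<bar>cutoff ?R x * (k n x - p x)\<bar> \<le> \<bar>w x\<bar> * e" by (intro mult_left_mono) auto
          then have "w x * (cutoff ?R x * (k n x - p x)) \<le> e * \<bar>w x\<bar>"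
            using abs_ge_self[of "w x * (cutoff ?R x * (k n x - p x))"] by (simp add: abs_mult mult.commute)
          moreover have eq: "(1 + e) * (w x * (cutoff ?R x * q x)) = w x * (cutoff ?R x * p x)"
            unfolding pe[symmetric] by (simp add: mult_ac)
          ultimately show ?thesis unfolding eq by (simp add: right_diff_distrib)
        qed
        show "integrable lebesgue (\<lambda>x. w x * (cutoff ?R x * k n x))" by (rule ik)
        show "integrable lebesgue (\<lambda>x. (1 + e) * (w x * (cutoff ?R x * q x)) + e * \<bar>w x\<bar>)"
          using iq w by (intro Bochner_Integration.integrable_add integrable_mult_right integrable_abs)
      qed
      also have "\<dots> = (1 + e) * (\<integral>x. w x * (cutoff ?R x * q x) \<partial>lebesgue) + e * ?I"
        using iq w by (subst Bochner_Integration.integral_add) auto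
      also have "\<dots> \<le> (1 + e) * B + e * ?I"
        using B[OF cf qc] e by (simp add: mult_left_mono)
      finally show ?thesis .
    qed
    have "((\<lambda>e. (1 + e) * B + e * ?I) \<longlongrightarrow> (1 + 0) * B + 0 * ?I) (at_right 0)"
      by (intro tendsto_intros)
    moreover have "\<forall>\<^sub>F e in at_right 0. (\<integral>x. w x * (cutoff ?R x * k n x) \<partial>lebesgue) \<le> (1 + e) * B + e * ?I"
      using * by (auto simp: eventually_at_right_field intro!: exI[of _ 1])
    ultimately have "(\<integral>x. w x * (cutoff ?R x * k n x) \<partial>lebesgue) \<le> (1 + 0) * B + 0 * ?I"
      by (intro tendsto_lowerbound) auto
    then show ?thesis by simp
  qed
  have "(\<lambda>n. \<integral>x. w x * (cutoff (real (Suc n)) x * k n x) \<partial>lebesgue) \<longlonglongrightarrow> (\<integral>x. \<bar>w x\<bar> \<partial>lebesgue)"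
  proof (rule integral_dominated_convergence[where w="\<lambda>x. \<bar>w x\<bar>"])
    have "AE x in lebesgue. x \<notin> Z" using Z by (simp add: negligible_iff_null_sets AE_not_in)
    then show "AE x in lebesgue. (\<lambda>n. w x * (cutoff (real (Suc n)) x * k n x)) \<longlonglongrightarrow> \<bar>w x\<bar>"
    proof eventually_elim
      case (elim x)
      have "(\<lambda>n. w x * (cutoff (real (Suc n)) x * k n x)) \<longlonglongrightarrow> w x * (1 * sgn (w x))"
        by (intro tendsto_intros cutoff_tendsto_1 klim elim)
      then show ?case by (simp add: abs_sgn)
    qed
    show "AE x in lebesgue. norm (w x * (cutoff (real (Suc n)) x * k n x)) \<le> \<bar>w x\<bar>" for n
      using kb by (intro AE_I2) (simp add: abs_mult mult_left_le)
  qed (use w in \<open>auto intro: borel_measurable_integrable ik\<close>)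
  then show ?thesis by (rule LIMSEQ_le_const2) (use le in blast)
qed

lemma BV_translation_integral:
  fixes u :: "real^'n \<Rightarrow> real"
  assumes "u \<in> BV"
  shows "(\<integral>x. \<bar>u (x + h) - u x\<bar> \<partial>lebesgue) \<le> norm h * tv u"
proof (rule integral_abs_le_by_duality)
  show "integrable lebesgue (\<lambda>x. u (x + h) - u x)"
    using BV_integrable[OF assms] by (intro Bochner_Integration.integrable_diff integrable_lebesgue_translation)
qed (rule BV_translation_pairing[OF assms])

section \<open>Averages over balls\<close>

text \<open>Fubini's theorem is applied to \<open>lborel\<close>, and the joint measurability of
  \<open>u (x + h)\<close> in both variables is obtained from Borel measurability of
  \<open>u\<close>.\<close>

lemma BV_borel_representative:
  assumes "u \<in> BV"
  obtains v where "v \<in> borel_measurable borel" "AE x in lebesgue. v x = u x" "v \<in> BV" "tv v = tv u"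
proof -
  have "u \<in> borel_measurable lebesgue" using BV_integrable[OF assms] by auto
  then obtain v where v: "v \<in> borel_measurable lborel" "AE x in lborel. u x = v x"
    using completion_ex_borel_measurable_real by blast
  have "AE x in lebesgue. v x = u x" using AE_completion[OF v(2)] by (auto simp: eq_commute)
  moreover have "v \<in> borel_measurable borel" using v by simp
  ultimately show thesis
    using that BV_cong_AE[OF assms] borel_measurable_lebesgue_of_borel by blast
qed

lemma ball_measure_eq:
  "d \<ge> 0 \<Longrightarrow> measure lborel (ball 0 d :: (real^'n) set) = unit_ball_vol (real CARD('n)) * d ^ CARD('n)"
  using content_ball[of d "0::real^'n"] by simp

lemma ball_measure_pos: "d > 0 \<Longrightarrow> measure lborel (ball 0 d :: (real^'n) set) > 0"
  by (simp add: ball_measure_eq unit_ball_vol_pos)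

lemma integrable_indicator_ball:
  "integrable lborel (indicator (ball a d) :: 'a::euclidean_space \<Rightarrow> real)"
  by (simp add: integrable_indicator_iff emeasure_lborel_ball_finite[unfolded infinity_ennreal_def] less_top)

lemma integral_ball_translate:
  fixes u :: "real^'n \<Rightarrow> real"
  assumes "u \<in> borel_measurable borel"
  shows "(\<integral>h. indicator (ball 0 d) h * u (x + h) \<partial>lborel) = (\<integral>y. indicator (ball x d) y * u y \<partial>lborel)"
proof -
  have m: "(\<lambda>h. indicator (ball x d) h * u h) \<in> borel_measurable borel"
    using assms by (intro borel_measurable_times borel_measurable_indicator) auto
  have "(\<integral>h. indicator (ball 0 d) h * u (x + h) \<partial>lborel) = (\<integral>h. indicator (ball x d) (h + x) * u (h + x) \<partial>lborel)"
    by (intro Bochner_Integration.integral_cong) (auto simp: indicator_def dist_norm add.commute)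
  also have "\<dots> = (\<integral>h. indicator (ball x d) (h + x) * u (h + x) \<partial>lebesgue)"
    using measurable_compose[OF _ m, of "\<lambda>h. h + x" borel] by (subst integral_completion) auto
  also have "\<dots> = (\<integral>h. indicator (ball x d) h * u h \<partial>lebesgue)"
    using m by (subst integral_lebesgue_translation[where g="\<lambda>h. indicator (ball x d) h * u h"])
      (auto intro!: borel_measurable_lebesgue_of_borel)
  also have "\<dots> = (\<integral>h. indicator (ball x d) h * u h \<partial>lborel)"
    using m by (subst integral_completion) auto
  finally show ?thesis .
qed

lemma integrable_borel_lebesgue:
  fixes u :: "'a::euclidean_space \<Rightarrow> real"
  assumes "u \<in> borel_measurable borel"
  shows "integrable lebesgue u \<longleftrightarrow> integrable lborel u"
  using assms by (intro integrable_completion) simp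

text \<open>By Fubini, the total oscillation is an integral over |h| < d of the translation
  estimate, and each such \<open>h\<close> contributes at most \<open>d * tv u\<close>.\<close>

lemma BV_average_oscillation:
  fixes u :: "real^'n \<Rightarrow> real"
  assumes u: "u \<in> BV" "u \<in> borel_measurable borel" and d: "d > 0"
  defines "D \<equiv> \<lambda>x. \<integral>h. indicator (ball 0 d) h * \<bar>u (x + h) - u x\<bar> \<partial>lborel"
  shows "integrable lborel (\<lambda>h. indicator (ball 0 d) h * \<bar>u (x + h)\<bar>)"
    "integrable lborel (\<lambda>h. indicator (ball 0 d) h * \<bar>u (x + h) - u x\<bar>)"
    "integrable lborel D" "(\<integral>x. D x \<partial>lborel) \<le> measure lborel (ball 0 d :: (real^'n) set) * d * tv u"
proof -
  let ?B = "ball 0 d :: (real^'n) set"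
  note [measurable] = u(2)
  have [measurable]: "?B \<in> sets borel" by simp
  have iu: "integrable lborel u" using BV_integrable[OF u(1)] integrable_borel_lebesgue[OF u(2)] by simp
  have it: "integrable lborel (\<lambda>h. u (h + x))" for x
    using integrable_lebesgue_translation[OF BV_integrable[OF u(1)], of x]
    by (subst integrable_borel_lebesgue[symmetric]) auto
  have ib: "integrable lborel (indicator ?B :: real^'n \<Rightarrow> real)"
    by (rule integrable_indicator_ball)
  have i1: "integrable lborel (\<lambda>h. indicator ?B h * \<bar>u (x + h)\<bar>)" for x
    using integrable_bounded_mult[OF integrable_abs[OF it[of x]], of "indicator ?B" 1]
      borel_measurable_indicator[of ?B borel]
    by (simp add: mult.commute add.commute)
  show "integrable lborel (\<lambda>h. indicator ?B h * \<bar>u (x + h)\<bar>)" by (rule i1)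
  have i2: "integrable lborel (\<lambda>h. indicator ?B h * \<bar>u (x + h) - u x\<bar>)" for x
  proof (rule Bochner_Integration.integrable_bound)
    show "integrable lborel (\<lambda>h. indicator ?B h * \<bar>u (x + h)\<bar> + indicator ?B h * \<bar>u x\<bar>)"
      using i1 ib by auto
  qed (auto simp: indicator_def)
  show "integrable lborel (\<lambda>h. indicator ?B h * \<bar>u (x + h) - u x\<bar>)" by (rule i2)
  have D0: "D x \<ge> 0" for x unfolding D_def by (intro integral_nonneg_AE) auto
  have Dm[measurable]: "D \<in> borel_measurable borel"
    unfolding D_def by measurable
  have nD: "ennreal (D x) = (\<integral>\<^sup>+h. ennreal (indicator ?B h * \<bar>u (x + h) - u x\<bar>) \<partial>lborel)" for x
    unfolding D_def by (rule nn_integral_eq_integral[symmetric, OF i2]) auto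
  have inner: "(\<integral>\<^sup>+x. ennreal (indicator ?B h * \<bar>u (x + h) - u x\<bar>) \<partial>lborel) \<le> ennreal (d * tv u) * indicator ?B h" for h
  proof (cases "h \<in> ?B")
    case True
    have ii: "integrable lborel (\<lambda>x. \<bar>u (x + h) - u x\<bar>)" using it iu by auto
    have "(\<integral>\<^sup>+x. ennreal (indicator ?B h * \<bar>u (x + h) - u x\<bar>) \<partial>lborel) = ennreal (\<integral>x. \<bar>u (x + h) - u x\<bar> \<partial>lborel)"
      using True by (simp add: nn_integral_eq_integral[OF ii])
    also have "(\<integral>x. \<bar>u (x + h) - u x\<bar> \<partial>lborel) = (\<integral>x. \<bar>u (x + h) - u x\<bar> \<partial>lebesgue)"
      by (subst integral_completion) auto
    also have "ennreal \<dots> \<le> ennreal (d * tv u)"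
      using BV_translation_integral[OF u(1), of h] True mult_right_mono[OF _ tv_nonneg[of u], of "norm h" d]
      by (intro ennreal_leI) auto
    finally show ?thesis using True by simp
  qed simp
  have "(\<integral>\<^sup>+x. ennreal (D x) \<partial>lborel) = (\<integral>\<^sup>+h. (\<integral>\<^sup>+x. ennreal (indicator ?B h * \<bar>u (x + h) - u x\<bar>) \<partial>lborel) \<partial>lborel)"
    unfolding nD by (rule lborel_pair.Fubini') measurable
  also have "\<dots> \<le> (\<integral>\<^sup>+h. ennreal (d * tv u) * indicator ?B h \<partial>lborel)"
    by (intro nn_integral_mono inner)
  also have "\<dots> = ennreal (d * tv u) * emeasure lborel ?B"
    by (rule nn_integral_cmult_indicator) simp
  also have "\<dots> = ennreal (measure lborel ?B * d * tv u)"
    using d tv_nonneg[of u] emeasure_lborel_ball_finite[of "0::real^'n" d]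
    by (subst emeasure_eq_ennreal_measure) (auto simp: ennreal_mult[symmetric] mult_ac)
  finally have nn: "(\<integral>\<^sup>+x. ennreal (D x) \<partial>lborel) \<le> ennreal (measure lborel ?B * d * tv u)" .
  show iD: "integrable lborel D"
    using nn D0 by (intro integrableI_nonneg) (auto simp: less_top[symmetric] top_unique)
  show "(\<integral>x. D x \<partial>lborel) \<le> measure lborel ?B * d * tv u"
    using nn D0 d tv_nonneg[of u] by (subst (asm) nn_integral_eq_integral[OF iD]) (auto simp: ennreal_le_iff)
qed

text \<open>Where |u| exceeds twice the bound \<open>l\<close> on the local averages, at least half
  of |u| must be oscillation. Hence the large values have an integral of order
  \<open>d * tv u\<close>, whatever their size.\<close>

lemma BV_large_values:
  fixes u :: "real^'n \<Rightarrow> real"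
  assumes u: "u \<in> BV" "u \<in> borel_measurable borel" and d: "d > 0" and l: "l \<ge> 0"
    and avg: "\<And>x. (\<integral>h. indicator (ball 0 d) h * \<bar>u (x + h)\<bar> \<partial>lborel) \<le> l * measure lborel (ball 0 d :: (real^'n) set)"
  shows "(\<integral>x. (if \<bar>u x\<bar> > 2 * l then \<bar>u x\<bar> else 0) \<partial>lebesgue) \<le> 2 * d * tv u"
proof -
  let ?B = "ball 0 d :: (real^'n) set" and ?m = "measure lborel (ball 0 d :: (real^'n) set)"
  note [measurable] = u(2)
  have [measurable]: "?B \<in> sets borel" by simp
  note osc = BV_average_oscillation[OF u d]
  define D where "D x = (\<integral>h. indicator ?B h * \<bar>u (x + h) - u x\<bar> \<partial>lborel)" for x
  have m: "?m > 0" by (rule ball_measure_pos[OF d])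
  have ib: "integrable lborel (indicator ?B :: real^'n \<Rightarrow> real)"
    by (rule integrable_indicator_ball)
  have D: "?m * \<bar>u x\<bar> - l * ?m \<le> D x" for x
  proof -
    have "?m * \<bar>u x\<bar> = (\<integral>h. indicator ?B h * \<bar>u x\<bar> \<partial>lborel)" by simp
    also have "\<dots> \<le> (\<integral>h. indicator ?B h * \<bar>u (x + h) - u x\<bar> + indicator ?B h * \<bar>u (x + h)\<bar> \<partial>lborel)"
    proof (rule integral_mono)
      show "integrable lborel (\<lambda>h. indicator ?B h * \<bar>u x\<bar>)" using ib by simp
      show "integrable lborel (\<lambda>h. indicator ?B h * \<bar>u (x + h) - u x\<bar> + indicator ?B h * \<bar>u (x + h)\<bar>)"
        using osc(1,2)[of x] by (rule Bochner_Integration.integrable_add[rotated])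
    qed (auto simp: indicator_def)
    also have "\<dots> = D x + (\<integral>h. indicator ?B h * \<bar>u (x + h)\<bar> \<partial>lborel)"
      unfolding D_def using osc(1,2)[of x] by (intro Bochner_Integration.integral_add) auto
    finally show ?thesis using avg[of x] by simp
  qed
  have D0: "D x \<ge> 0" for x unfolding D_def by (intro integral_nonneg_AE) auto
  have le: "(if \<bar>u x\<bar> > 2 * l then \<bar>u x\<bar> else 0) \<le> 2 / ?m * D x" for x
  proof (cases "\<bar>u x\<bar> > 2 * l")
    case True
    have "?m * (\<bar>u x\<bar> / 2) \<le> ?m * (\<bar>u x\<bar> - l)"
      by (rule mult_left_mono) (use True m in auto)
    then have "?m * (\<bar>u x\<bar> / 2) \<le> D x" using D[of x] by (simp add: algebra_simps)
    then show ?thesis using True m by (simp add: field_simps)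
  qed (use D0 m in auto)
  have iu: "integrable lborel u" using BV_integrable[OF u(1)] integrable_borel_lebesgue[OF u(2)] by simp
  have "(\<integral>x. (if \<bar>u x\<bar> > 2 * l then \<bar>u x\<bar> else 0) \<partial>lebesgue) = (\<integral>x. (if \<bar>u x\<bar> > 2 * l then \<bar>u x\<bar> else 0) \<partial>lborel)"
    by (subst integral_completion) auto
  also have "\<dots> \<le> (\<integral>x. 2 / ?m * D x \<partial>lborel)"
  proof (rule integral_mono)
    show "integrable lborel (\<lambda>x. if \<bar>u x\<bar> > 2 * l then \<bar>u x\<bar> else 0)"
      by (rule Bochner_Integration.integrable_bound[OF iu]) auto
    show "integrable lborel (\<lambda>x. 2 / ?m * D x)" unfolding D_def by (intro integrable_mult_right osc(3))
  qed (rule le)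
  also have "\<dots> = 2 / ?m * (\<integral>x. D x \<partial>lborel)" by simp
  also have "\<dots> \<le> 2 / ?m * (?m * d * tv u)"
    using osc(4) m unfolding D_def by (intro mult_left_mono) auto
  also have "\<dots> = 2 * d * tv u" using m by simp
  finally show ?thesis .
qed

section \<open>Subcritical integrability\<close>

text \<open>Takes the place of Hoelder's inequality when averages over a ball are estimated through
  an L^r bound.\<close>

lemma abs_le_add_powr:
  fixes s \<mu> r :: real
  assumes "\<mu> > 0" "r \<ge> 1"
  shows "\<bar>s\<bar> \<le> \<mu> + \<mu> powr (1 - r) * \<bar>s\<bar> powr r"
proof (cases "\<bar>s\<bar> \<le> \<mu>")
  case False
  then have s: "\<bar>s\<bar> > 0" using assms by linarith
  have "\<bar>s\<bar> = \<bar>s\<bar> powr (1 - r) * \<bar>s\<bar> powr r"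
    using s by (simp flip: powr_add)
  also have "\<dots> \<le> \<mu> powr (1 - r) * \<bar>s\<bar> powr r"
    by (intro mult_right_mono powr_mono2') (use False assms in auto)
  finally show ?thesis using assms by simp
qed (use assms in \<open>simp add: add_increasing2\<close>)

text \<open>The higher the level \<open>l\<close>, the smaller the ball on which an L^r bound still
  keeps the averages of |u| below l/2; its radius, of order l^(-r/N), is the decay of the
  tail.\<close>

lemma BV_tail_estimate:
  fixes u :: "real^'n \<Rightarrow> real"
  assumes u: "u \<in> BV" "u \<in> borel_measurable borel" and r: "r \<ge> 1" and C: "C > 0"
    and iu: "integrable lebesgue (\<lambda>x. \<bar>u x\<bar> powr r)" "(\<integral>x. \<bar>u x\<bar> powr r \<partial>lebesgue) \<le> C" and l: "l > 0"
  shows "(\<integral>x. (if \<bar>u x\<bar> > l then \<bar>u x\<bar> else 0) \<partial>lebesgue) \<le>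
    2 * ((C / unit_ball_vol (real CARD('n))) powr (1 / real CARD('n)) * (l / 4) powr (- r / real CARD('n))) * tv u"
proof -
  let ?N = "CARD('n)" and ?\<omega> = "unit_ball_vol (real CARD('n))"
  note [measurable] = u(2)
  define \<mu> where "\<mu> = l / 4"
  have \<mu>: "\<mu> > 0" using l by (simp add: \<mu>_def)
  have N: "real ?N > 0" by simp
  have \<omega>: "?\<omega> > 0" by (rule unit_ball_vol_pos) simp
  \<comment> \<open>Chosen so that the ball has volume \<open>C * \<mu> powr (- r)\<close>: both
    terms of \<open>abs_le_add_powr\<close> then contribute \<open>\<mu>\<close> to the average, and
    the threshold of \<open>BV_large_values\<close>, twice the bound \<open>2 * \<mu>\<close>, is
    exactly \<open>l\<close>.\<close>
  define d where "d = (C / ?\<omega>) powr (1 / real ?N) * \<mu> powr (- r / real ?N)"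
  have d: "d > 0" 
  proof -
    have "(C / ?\<omega>) powr (1 / real ?N) > 0" "\<mu> powr (- r / real ?N) > 0"
      using divide_pos_pos[OF C \<omega>] \<mu> by (metis less_irrefl powr_gt_zero)+
    then show ?thesis unfolding d_def by (rule mult_pos_pos)
  qed
  let ?B = "ball 0 d :: (real^'n) set"
  have [measurable]: "?B \<in> sets borel" by simp
  have dN: "d ^ ?N = (C / ?\<omega>) * \<mu> powr (- r)"
  proof -
    have "d ^ ?N = d powr real ?N" using d by (simp add: powr_realpow)
    also have "\<dots> = ((C / ?\<omega>) powr (1 / real ?N)) powr real ?N * (\<mu> powr (- r / real ?N)) powr real ?N"
      unfolding d_def by (rule powr_mult)
    also have "\<dots> = (C / ?\<omega>) * \<mu> powr (- r)"
      using C \<omega> by (simp add: powr_powr abs_of_pos)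
    finally show ?thesis .
  qed
  define m where "m = measure lborel ?B"
  have m: "m = C * \<mu> powr (- r)"
    unfolding m_def using d less_imp_neq[OF \<omega>] by (simp add: ball_measure_eq dN)
  have ib: "integrable lborel (indicator ?B :: real^'n \<Rightarrow> real)"
    by (rule integrable_indicator_ball)
  have "(\<integral>x. (if \<bar>u x\<bar> > 2 * (2 * \<mu>) then \<bar>u x\<bar> else 0) \<partial>lebesgue) \<le> 2 * d * tv u"
  proof (rule BV_large_values[OF u d])
    fix x :: "real^'n"
    have ir: "integrable lborel (\<lambda>h. \<bar>u (h + x)\<bar> powr r)"
      using integrable_lebesgue_translation[OF iu(1), of x] by (subst integrable_borel_lebesgue[symmetric]) auto
    have irle: "(\<integral>h. \<bar>u (h + x)\<bar> powr r \<partial>lborel) \<le> C"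
    proof -
      have "(\<integral>h. \<bar>u (h + x)\<bar> powr r \<partial>lborel) = (\<integral>h. \<bar>u (h + x)\<bar> powr r \<partial>lebesgue)"
        by (subst integral_completion) auto
      also have "\<dots> = (\<integral>x. \<bar>u x\<bar> powr r \<partial>lebesgue)"
        by (rule integral_lebesgue_translation[where g="\<lambda>x. \<bar>u x\<bar> powr r"]) (use iu in auto)
      finally show ?thesis using iu by simp
    qed
    have "(\<integral>h. indicator ?B h * \<bar>u (x + h)\<bar> \<partial>lborel) \<le> (\<integral>h. \<mu> * indicator ?B h + \<mu> powr (1 - r) * \<bar>u (h + x)\<bar> powr r \<partial>lborel)"
    proof (rule integral_mono)
      show "integrable lborel (\<lambda>h. indicator ?B h * \<bar>u (x + h)\<bar>)"
        by (rule BV_average_oscillation(1)[OF u d])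
      show "integrable lborel (\<lambda>h. \<mu> * indicator ?B h + \<mu> powr (1 - r) * \<bar>u (h + x)\<bar> powr r)"
        using ib ir by simp
      show "indicator ?B h * \<bar>u (x + h)\<bar> \<le> \<mu> * indicator ?B h + \<mu> powr (1 - r) * \<bar>u (h + x)\<bar> powr r" for h
        using abs_le_add_powr[OF \<mu> r, of "u (h + x)"] by (auto simp: indicator_def add.commute)
    qed
    also have "\<dots> = \<mu> * m + \<mu> powr (1 - r) * (\<integral>h. \<bar>u (h + x)\<bar> powr r \<partial>lborel)"
      using ib ir by (simp add: m_def)
    also have "\<dots> \<le> \<mu> * m + \<mu> powr (1 - r) * C"
      using irle by (intro add_left_mono mult_left_mono) auto
    also have "\<mu> powr (1 - r) * C = \<mu> * m"
      using \<mu> powr_add[of \<mu> 1 "- r"] unfolding m by simp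
    finally show "(\<integral>h. indicator ?B h * \<bar>u (x + h)\<bar> \<partial>lborel) \<le> 2 * \<mu> * measure lborel ?B"
      by (simp add: m_def)
  qed (use \<mu> in auto)
  then show ?thesis unfolding \<mu>_def d_def by simp
qed

text \<open>The \<open>itself\<close> argument fixes the dimension, which no other parameter
  mentions. The constant depends on \<open>K\<close> only, the uniformity that lets the bootstrap be
  iterated.\<close>

definition BV_Lr_bound :: "('n::finite) itself \<Rightarrow> real \<Rightarrow> bool" where
  "BV_Lr_bound T r \<longleftrightarrow> (\<forall>K. \<exists>C. \<forall>u :: real^'n \<Rightarrow> real. u \<in> BV \<longrightarrow> u \<in> borel_measurable borel \<longrightarrow>
     (\<integral>x. \<bar>u x\<bar> \<partial>lebesgue) \<le> K \<longrightarrow> tv u \<le> K \<longrightarrow>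
     integrable lebesgue (\<lambda>x. \<bar>u x\<bar> powr r) \<and> (\<integral>x. \<bar>u x\<bar> powr r \<partial>lebesgue) \<le> C)"

lemma BV_Lr_bound_1: "BV_Lr_bound T 1"
  unfolding BV_Lr_bound_def
  by (auto intro!: exI integrable_abs dest: BV_integrable)

text \<open>The term with \<open>2 ^ k < \<bar>s\<bar> \<le> 2 ^ Suc k\<close> alone dominates the
  power when |s| > 1, and |s| itself does so otherwise. Integrating the series turns tail bounds at
  dyadic levels into an L^q bound.\<close>

lemma powr_le_dyadic_sum:
  fixes s q :: real
  assumes "q \<ge> 1"
  shows "ennreal (\<bar>s\<bar> powr q) \<le> ennreal \<bar>s\<bar> +
     (\<Sum>k. ennreal (2 powr (real (Suc k) * (q - 1)) * (if \<bar>s\<bar> > 2 ^ k then \<bar>s\<bar> else 0)))"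
proof (cases "\<bar>s\<bar> \<le> 1")
  case True
  have "\<bar>s\<bar> powr q \<le> \<bar>s\<bar>"
  proof (cases "s = 0")
    case False
    have "\<bar>s\<bar> powr q \<le> \<bar>s\<bar> powr 1" by (rule powr_mono') (use True assms in auto)
    then show ?thesis using False by simp
  qed auto
  then show ?thesis by (intro add_increasing2) (auto intro: ennreal_leI)
next
  case False
  define P where "P n \<longleftrightarrow> \<bar>s\<bar> \<le> 2 ^ n" for n :: nat
  obtain n where "P n" unfolding P_def using real_arch_pow[of 2 "\<bar>s\<bar>"] by (auto intro: less_imp_le)
  define n0 where "n0 = (LEAST n. P n)"
  have n0: "P n0" unfolding n0_def using \<open>P n\<close> by (rule LeastI)
  have "n0 \<noteq> 0" using n0 False unfolding P_def by (intro notI) simp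
  then obtain k where k: "n0 = Suc k" by (cases n0) auto
  then have "\<not> P k" unfolding n0_def using not_less_Least by (metis lessI)
  then have lo: "\<bar>s\<bar> > 2 ^ k" unfolding P_def by simp
  have hi: "\<bar>s\<bar> \<le> 2 ^ Suc k" using n0 unfolding k P_def .
  have "\<bar>s\<bar> powr q = \<bar>s\<bar> powr (q - 1) * \<bar>s\<bar>"
    using False powr_add[of "\<bar>s\<bar>" "q - 1" 1] by simp
  also have "\<dots> \<le> (2 ^ Suc k) powr (q - 1) * \<bar>s\<bar>"
    by (intro mult_right_mono powr_mono2) (use assms hi in auto)
  also have "(2 ^ Suc k) powr (q - 1) = 2 powr (real (Suc k) * (q - 1))"
    by (subst powr_realpow[symmetric]) (auto simp: powr_powr)
  finally have "ennreal (\<bar>s\<bar> powr q) \<le> ennreal (2 powr (real (Suc k) * (q - 1)) * (if \<bar>s\<bar> > 2 ^ k then \<bar>s\<bar> else 0))"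
    using lo by (auto intro: ennreal_leI)
  also have "\<dots> \<le> (\<Sum>k. ennreal (2 powr (real (Suc k) * (q - 1)) * (if \<bar>s\<bar> > 2 ^ k then \<bar>s\<bar> else 0)))"
  proof -
    have "a k \<le> (\<Sum>k. a k)" for a :: "nat \<Rightarrow> ennreal"
      using sum_le_suminf[of a "{k}"] by simp
    then show ?thesis .
  qed
  finally show ?thesis by (intro add_increasing) auto
qed

text \<open>The tail above 2^k is at most a multiple of 2^(-kr/N), its weight in the dyadic series
  is 2^((k+1)(q-1)); the products form a geometric series whose ratio \<open>\<rho>\<close> is below
  1 exactly when q < 1 + r/N.\<close>

lemma BV_Lr_bound_step:
  assumes P: "BV_Lr_bound TYPE('n::finite) r" and r: "r \<ge> 1" and q: "q \<ge> 1" "q < 1 + r / real CARD('n)"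
  shows "BV_Lr_bound TYPE('n) q"
  unfolding BV_Lr_bound_def
proof
  fix K :: real
  let ?N = "real CARD('n)"
  obtain C0 where C0: "\<And>u :: real^'n \<Rightarrow> real. u \<in> BV \<Longrightarrow> u \<in> borel_measurable borel \<Longrightarrow>
     (\<integral>x. \<bar>u x\<bar> \<partial>lebesgue) \<le> K \<Longrightarrow> tv u \<le> K \<Longrightarrow>
     integrable lebesgue (\<lambda>x. \<bar>u x\<bar> powr r) \<and> (\<integral>x. \<bar>u x\<bar> powr r \<partial>lebesgue) \<le> C0"
    using P unfolding BV_Lr_bound_def by blast
  \<comment> \<open>The tail estimate divides the volume of a ball out of \<open>C\<close>, so
    \<open>C\<close> must be strictly positive.\<close>
  define C where "C = max C0 1"
  have C: "C > 0" "C0 \<le> C" unfolding C_def by auto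
  define A where "A = 2 * ((C / unit_ball_vol ?N) powr (1 / ?N) * 4 powr (r / ?N)) * \<bar>K\<bar>"
  define \<rho> where "\<rho> = 2 powr (q - 1 - r / ?N)"
  have \<rho>: "0 < \<rho>" "\<rho> < 1"
    unfolding \<rho>_def using q by (auto simp: powr_less_one)
  define S where "S = A * 2 powr (q - 1) * (1 / (1 - \<rho>))"
  have A: "A \<ge> 0" unfolding A_def by simp
  have S: "S \<ge> 0" unfolding S_def using A \<rho> by simp
  have Ssum: "(\<Sum>k. ennreal (2 powr (real (Suc k) * (q - 1)) * (A * (2 ^ k) powr (- r / ?N)))) = ennreal S"
  proof -
    have eq: "2 powr (real (Suc k) * (q - 1)) * (A * (2 ^ k) powr (- r / ?N)) = A * 2 powr (q - 1) * \<rho> ^ k" for k :: nat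
    proof -
      have "\<rho> ^ k = 2 powr (real k * (q - 1 - r / ?N))"
        unfolding \<rho>_def by (subst powr_realpow[symmetric]) (auto simp: powr_powr mult.commute)
      moreover have "(2 ^ k) powr (- r / ?N) = 2 powr (real k * (- r / ?N))"
        by (subst powr_realpow[symmetric]) (auto simp: powr_powr)
      moreover have "2 powr (real (Suc k) * (q - 1)) * 2 powr (real k * (- r / ?N)) = 2 powr (q - 1) * 2 powr (real k * (q - 1 - r / ?N))"
        by (simp only: powr_add[symmetric]) (simp add: algebra_simps)
      ultimately show ?thesis by (simp only: mult_ac)
    qed
    have "(\<lambda>k. A * 2 powr (q - 1) * \<rho> ^ k) sums S"
      unfolding S_def using \<rho> by (intro sums_mult geometric_sums) auto
    then show ?thesis
      unfolding eq using A \<rho> by (subst suminf_ennreal2) (auto simp: sums_iff)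
  qed
  show "\<exists>C. \<forall>u :: real^'n \<Rightarrow> real. u \<in> BV \<longrightarrow> u \<in> borel_measurable borel \<longrightarrow>
     (\<integral>x. \<bar>u x\<bar> \<partial>lebesgue) \<le> K \<longrightarrow> tv u \<le> K \<longrightarrow>
     integrable lebesgue (\<lambda>x. \<bar>u x\<bar> powr q) \<and> (\<integral>x. \<bar>u x\<bar> powr q \<partial>lebesgue) \<le> C"
  proof (rule exI[of _ "\<bar>K\<bar> + S"], intro allI impI)
    fix u :: "real^'n \<Rightarrow> real"
    assume u: "u \<in> BV" "u \<in> borel_measurable borel" and K: "(\<integral>x. \<bar>u x\<bar> \<partial>lebesgue) \<le> K" "tv u \<le> K"
    have mu[measurable]: "u \<in> borel_measurable lebesgue" by (rule borel_measurable_lebesgue_of_borel[OF u(2)])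
    note iu = BV_integrable[OF u(1)]
    have ir: "integrable lebesgue (\<lambda>x. \<bar>u x\<bar> powr r)" "(\<integral>x. \<bar>u x\<bar> powr r \<partial>lebesgue) \<le> C"
      using C0[OF u K] C(2) by auto
    have tail: "(\<integral>x. (if \<bar>u x\<bar> > l then \<bar>u x\<bar> else 0) \<partial>lebesgue) \<le> A * l powr (- r / ?N)" if l: "l > 0" for l
    proof -
      have "(l / 4) powr (- r / ?N) = l powr (- r / ?N) * 4 powr (r / ?N)"
        using l powr_divide[of l 4 "- r / ?N"] powr_minus_divide[of 4 "r / ?N"] by simp
      then have "2 * ((C / unit_ball_vol ?N) powr (1 / ?N) * (l / 4) powr (- r / ?N)) * tv u
        = 2 * ((C / unit_ball_vol ?N) powr (1 / ?N) * 4 powr (r / ?N)) * l powr (- r / ?N) * tv u" by (simp only: mult_ac)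
      also have "\<dots> \<le> 2 * ((C / unit_ball_vol ?N) powr (1 / ?N) * 4 powr (r / ?N)) * l powr (- r / ?N) * \<bar>K\<bar>"
        by (intro mult_left_mono mult_nonneg_nonneg) (use K in auto)
      also have "\<dots> = A * l powr (- r / ?N)" unfolding A_def by (simp only: mult_ac)
      finally show ?thesis using BV_tail_estimate[OF u r C(1) ir l] by linarith
    qed
    have it: "integrable lebesgue (\<lambda>x. if \<bar>u x\<bar> > l then \<bar>u x\<bar> else 0)" for l
      by (rule Bochner_Integration.integrable_bound[OF iu]) auto
    have "(\<integral>\<^sup>+x. ennreal (\<bar>u x\<bar> powr q) \<partial>lebesgue) \<le> (\<integral>\<^sup>+x. ennreal \<bar>u x\<bar> +
        (\<Sum>k. ennreal (2 powr (real (Suc k) * (q - 1)) * (if \<bar>u x\<bar> > 2 ^ k then \<bar>u x\<bar> else 0))) \<partial>lebesgue)"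
      by (intro nn_integral_mono powr_le_dyadic_sum q)
    also have "\<dots> = (\<integral>\<^sup>+x. ennreal \<bar>u x\<bar> \<partial>lebesgue) +
        (\<integral>\<^sup>+x. (\<Sum>k. ennreal (2 powr (real (Suc k) * (q - 1)) * (if \<bar>u x\<bar> > 2 ^ k then \<bar>u x\<bar> else 0))) \<partial>lebesgue)"
      by (rule nn_integral_add) measurable
    also have "(\<integral>\<^sup>+x. (\<Sum>k. ennreal (2 powr (real (Suc k) * (q - 1)) * (if \<bar>u x\<bar> > 2 ^ k then \<bar>u x\<bar> else 0))) \<partial>lebesgue)
      = (\<Sum>k. (\<integral>\<^sup>+x. ennreal (2 powr (real (Suc k) * (q - 1)) * (if \<bar>u x\<bar> > 2 ^ k then \<bar>u x\<bar> else 0)) \<partial>lebesgue))"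
      by (rule nn_integral_suminf) measurable
    also have "\<dots> \<le> (\<Sum>k. ennreal (2 powr (real (Suc k) * (q - 1)) * (A * (2 ^ k) powr (- r / ?N))))"
    proof (rule suminf_le)
      fix k :: nat
      have "(\<integral>\<^sup>+x. ennreal (2 powr (real (Suc k) * (q - 1)) * (if \<bar>u x\<bar> > 2 ^ k then \<bar>u x\<bar> else 0)) \<partial>lebesgue)
        = ennreal (\<integral>x. 2 powr (real (Suc k) * (q - 1)) * (if \<bar>u x\<bar> > 2 ^ k then \<bar>u x\<bar> else 0) \<partial>lebesgue)"
        by (rule nn_integral_eq_integral) (use it[of "2 ^ k"] in auto)
      also have "(\<integral>x. 2 powr (real (Suc k) * (q - 1)) * (if \<bar>u x\<bar> > 2 ^ k then \<bar>u x\<bar> else 0) \<partial>lebesgue)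
        = 2 powr (real (Suc k) * (q - 1)) * (\<integral>x. (if \<bar>u x\<bar> > 2 ^ k then \<bar>u x\<bar> else 0) \<partial>lebesgue)" by simp
      also have "ennreal \<dots> \<le> ennreal (2 powr (real (Suc k) * (q - 1)) * (A * (2 ^ k) powr (- r / ?N)))"
        by (intro ennreal_leI mult_left_mono tail) auto
      finally show "(\<integral>\<^sup>+x. ennreal (2 powr (real (Suc k) * (q - 1)) * (if \<bar>u x\<bar> > 2 ^ k then \<bar>u x\<bar> else 0)) \<partial>lebesgue)
        \<le> ennreal (2 powr (real (Suc k) * (q - 1)) * (A * (2 ^ k) powr (- r / ?N)))" .
    qed auto
    also have "\<dots> = ennreal S" by (rule Ssum)
    also have "(\<integral>\<^sup>+x. ennreal \<bar>u x\<bar> \<partial>lebesgue) = ennreal (\<integral>x. \<bar>u x\<bar> \<partial>lebesgue)"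
      by (rule nn_integral_eq_integral) (use iu in auto)
    also have "\<dots> + ennreal S = ennreal ((\<integral>x. \<bar>u x\<bar> \<partial>lebesgue) + S)"
      using S by (intro ennreal_plus[symmetric]) auto
    also have "\<dots> \<le> ennreal (\<bar>K\<bar> + S)" using K by (intro ennreal_leI) auto
    finally have nn: "(\<integral>\<^sup>+x. ennreal (\<bar>u x\<bar> powr q) \<partial>lebesgue) \<le> ennreal (\<bar>K\<bar> + S)" by simp
    have i: "integrable lebesgue (\<lambda>x. \<bar>u x\<bar> powr q)"
      by (rule integrableI_nonneg) (use nn in \<open>auto simp: less_top[symmetric] top_unique\<close>)
    moreover have "ennreal (\<integral>x. \<bar>u x\<bar> powr q \<partial>lebesgue) \<le> ennreal (\<bar>K\<bar> + S)"
      using nn nn_integral_eq_integral[OF i] by simp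
    then have "(\<integral>x. \<bar>u x\<bar> powr q \<partial>lebesgue) \<le> \<bar>K\<bar> + S"
      using S by (subst (asm) ennreal_le_iff) auto
    ultimately show "integrable lebesgue (\<lambda>x. \<bar>u x\<bar> powr q) \<and> (\<integral>x. \<bar>u x\<bar> powr q \<partial>lebesgue) \<le> \<bar>K\<bar> + S" ..
  qed
qed

text \<open>Iterating \<open>r \<mapsto> 1 + s r\<close> with \<open>s < 1/N\<close> from \<open>r = 1\<close> converges to \<open>1 / (1 - s)\<close>,
  which exceeds \<open>q\<close> if \<open>s\<close> is close to \<open>1/N\<close>.\<close>

lemma BV_Lr_bound_subcritical:
  assumes N: "CARD('n::finite) \<ge> 2" and q: "q \<ge> 1" "q < real CARD('n) / (real CARD('n) - 1)"
  shows "BV_Lr_bound TYPE('n) q"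
proof -
  let ?N = "real CARD('n)"
  have N2: "?N \<ge> 2" using N by simp
  \<comment> \<open>The subcritical bound on \<open>q\<close>, rewritten: any \<open>s\<close>
    between these two numbers has \<open>1 / (1 - s)\<close> above \<open>q\<close>.\<close>
  have "1 - 1 / q < 1 / ?N" using q N2 by (simp add: field_simps)
  then obtain s where s: "1 - 1 / q < s" "s < 1 / ?N" using dense by blast
  have "1 - 1 / q \<ge> 0" using q by simp
  then have s0: "s > 0" using s(1) by linarith
  have "1 / ?N < 1" using N2 by simp
  then have s1: "s < 1" using s by linarith
  define \<rho> where "\<rho> k = (\<Sum>i<Suc k. s ^ i)" for k
  have \<rho>Suc: "\<rho> (Suc k) = 1 + s * \<rho> k" for k
    unfolding \<rho>_def by (subst sum.lessThan_Suc_shift) (simp add: sum_distrib_left distrib_left)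
  have \<rho>1: "\<rho> k \<ge> 1" for k
  proof (induction k)
    case (Suc k)
    then show ?case unfolding \<rho>Suc using s0 by simp
  qed (simp add: \<rho>_def)
  have P: "BV_Lr_bound TYPE('n) (\<rho> k)" for k
  proof (induction k)
    case 0 then show ?case using BV_Lr_bound_1 by (simp add: \<rho>_def)
  next
    case (Suc k)
    have "s * \<rho> k < 1 / ?N * \<rho> k" using s(2) \<rho>1[of k] by (intro mult_strict_right_mono) auto
    then show ?case
      using \<rho>1[of "Suc k"] by (intro BV_Lr_bound_step[OF Suc \<rho>1]) (auto simp: \<rho>Suc)
  qed
  have "(\<lambda>k. s ^ k) sums (1 / (1 - s))" using s0 s1 by (intro geometric_sums) auto
  then have "\<rho> \<longlonglongrightarrow> 1 / (1 - s)" unfolding sums_def \<rho>_def by (rule LIMSEQ_Suc)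
  moreover have "q < 1 / (1 - s)" using s(1) s1 q by (simp add: field_simps)
  ultimately have "\<forall>\<^sub>F k in sequentially. q < \<rho> k" by (rule order_tendstoD(1))
  then obtain k where k: "q < \<rho> k" by (auto simp: eventually_sequentially)
  show ?thesis
    unfolding BV_Lr_bound_def
  proof
    fix K :: real
    obtain C0 where C0: "\<And>u :: real^'n \<Rightarrow> real. u \<in> BV \<Longrightarrow> u \<in> borel_measurable borel \<Longrightarrow>
       (\<integral>x. \<bar>u x\<bar> \<partial>lebesgue) \<le> K \<Longrightarrow> tv u \<le> K \<Longrightarrow>
       integrable lebesgue (\<lambda>x. \<bar>u x\<bar> powr \<rho> k) \<and> (\<integral>x. \<bar>u x\<bar> powr \<rho> k \<partial>lebesgue) \<le> C0"
      using P[of k] unfolding BV_Lr_bound_def by blast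
    show "\<exists>C. \<forall>u :: real^'n \<Rightarrow> real. u \<in> BV \<longrightarrow> u \<in> borel_measurable borel \<longrightarrow>
     (\<integral>x. \<bar>u x\<bar> \<partial>lebesgue) \<le> K \<longrightarrow> tv u \<le> K \<longrightarrow>
     integrable lebesgue (\<lambda>x. \<bar>u x\<bar> powr q) \<and> (\<integral>x. \<bar>u x\<bar> powr q \<partial>lebesgue) \<le> C"
    proof (rule exI[of _ "K + C0"], intro allI impI)
      fix u :: "real^'n \<Rightarrow> real"
      assume u: "u \<in> BV" "u \<in> borel_measurable borel" and K: "(\<integral>x. \<bar>u x\<bar> \<partial>lebesgue) \<le> K" "tv u \<le> K"
      have [measurable]: "u \<in> borel_measurable lebesgue" by (rule borel_measurable_lebesgue_of_borel[OF u(2)])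
      \<comment> \<open>The iteration overshoots \<open>q\<close>; interpolation with the exponent 1
        brings it back.\<close>
      have le: "\<bar>u x\<bar> powr q \<le> \<bar>u x\<bar> + \<bar>u x\<bar> powr \<rho> k" for x
      proof (cases "\<bar>u x\<bar> \<le> 1")
        case True
        have "\<bar>u x\<bar> powr q \<le> \<bar>u x\<bar> powr 1" by (rule powr_mono') (use True q in auto)
        then show ?thesis by (simp add: add_increasing2)
      next
        case False
        then have "\<bar>u x\<bar> powr q \<le> \<bar>u x\<bar> powr \<rho> k" by (intro powr_mono) (use k in auto)
        then show ?thesis by simp
      qed
      have i: "integrable lebesgue (\<lambda>x. \<bar>u x\<bar> + \<bar>u x\<bar> powr \<rho> k)"
        using C0[OF u K] BV_integrable[OF u(1)] by simp
      have iq: "integrable lebesgue (\<lambda>x. \<bar>u x\<bar> powr q)"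
        by (rule Bochner_Integration.integrable_bound[OF i]) (use le in auto)
      moreover have "(\<integral>x. \<bar>u x\<bar> powr q \<partial>lebesgue) \<le> (\<integral>x. \<bar>u x\<bar> + \<bar>u x\<bar> powr \<rho> k \<partial>lebesgue)"
        by (rule integral_mono[OF iq i le])
      moreover have "(\<integral>x. \<bar>u x\<bar> + \<bar>u x\<bar> powr \<rho> k \<partial>lebesgue) \<le> K + C0"
        using C0[OF u K] BV_integrable[OF u(1)] K by simp
      ultimately show "integrable lebesgue (\<lambda>x. \<bar>u x\<bar> powr q) \<and> (\<integral>x. \<bar>u x\<bar> powr q \<partial>lebesgue) \<le> K + C0" by simp
    qed
  qed
qed

lemma BV_Lq_bound:
  assumes "CARD('n::finite) \<ge> 2" "q \<ge> 1" "q < real CARD('n) / (real CARD('n) - 1)"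
  obtains C where "C > 0" "\<And>u :: real^'n \<Rightarrow> real. u \<in> BV \<Longrightarrow> (\<integral>x. \<bar>u x\<bar> \<partial>lebesgue) \<le> K \<Longrightarrow> tv u \<le> K \<Longrightarrow>
     integrable lebesgue (\<lambda>x. \<bar>u x\<bar> powr q) \<and> (\<integral>x. \<bar>u x\<bar> powr q \<partial>lebesgue) \<le> C"
proof -
  obtain C0 where C0: "\<And>u :: real^'n \<Rightarrow> real. u \<in> BV \<Longrightarrow> u \<in> borel_measurable borel \<Longrightarrow>
       (\<integral>x. \<bar>u x\<bar> \<partial>lebesgue) \<le> K \<Longrightarrow> tv u \<le> K \<Longrightarrow>
       integrable lebesgue (\<lambda>x. \<bar>u x\<bar> powr q) \<and> (\<integral>x. \<bar>u x\<bar> powr q \<partial>lebesgue) \<le> C0"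
    using BV_Lr_bound_subcritical[OF assms] unfolding BV_Lr_bound_def by blast
  show thesis
  proof (rule that[of "max C0 1"])
    fix u :: "real^'n \<Rightarrow> real" assume u: "u \<in> BV" and K: "(\<integral>x. \<bar>u x\<bar> \<partial>lebesgue) \<le> K" "tv u \<le> K"
    obtain v where v: "v \<in> borel_measurable borel" "AE x in lebesgue. v x = u x" "v \<in> BV" "tv v = tv u"
      by (rule BV_borel_representative[OF u]) blast
    have [measurable]: "u \<in> borel_measurable lebesgue" "v \<in> borel_measurable lebesgue"
      using BV_integrable[OF u] BV_integrable[OF v(3)] by auto
    have "(\<integral>x. \<bar>v x\<bar> \<partial>lebesgue) = (\<integral>x. \<bar>u x\<bar> \<partial>lebesgue)"
      by (intro integral_cong_AE) (use v(2) in auto)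
    then have "integrable lebesgue (\<lambda>x. \<bar>v x\<bar> powr q) \<and> (\<integral>x. \<bar>v x\<bar> powr q \<partial>lebesgue) \<le> C0"
      using C0[OF v(3,1)] K v(4) by simp
    moreover have "integrable lebesgue (\<lambda>x. \<bar>v x\<bar> powr q) = integrable lebesgue (\<lambda>x. \<bar>u x\<bar> powr q)"
      by (intro integrable_cong_AE) (use v(2) in auto)
    moreover have "(\<integral>x. \<bar>v x\<bar> powr q \<partial>lebesgue) = (\<integral>x. \<bar>u x\<bar> powr q \<partial>lebesgue)"
      by (intro integral_cong_AE) (use v(2) in auto)
    ultimately show "integrable lebesgue (\<lambda>x. \<bar>u x\<bar> powr q) \<and> (\<integral>x. \<bar>u x\<bar> powr q \<partial>lebesgue) \<le> max C0 1" by auto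
  qed simp
qed

text \<open>This is Lions' vanishing lemma; no Sobolev inequality is needed for it.\<close>

lemma BV_vanishing:
  fixes u :: "real^'n \<Rightarrow> real"
  assumes u: "u \<in> BV" and d: "0 < d" "d \<le> 1" and k: "k \<ge> 0"
    and small: "\<And>y. (\<integral>x. indicator (ball y 1) x * \<bar>u x\<bar> \<partial>lebesgue) \<le> k"
  shows "(\<integral>x. (if \<bar>u x\<bar> > 2 * (k / measure lborel (ball 0 d :: (real^'n) set)) then \<bar>u x\<bar> else 0) \<partial>lebesgue) \<le> 2 * d * tv u"
proof -
  let ?B = "ball 0 d :: (real^'n) set"
  let ?m = "measure lborel ?B"
  have m: "?m > 0" by (rule ball_measure_pos[OF d(1)])
  obtain v where v: "v \<in> borel_measurable borel" "AE x in lebesgue. v x = u x" "v \<in> BV" "tv v = tv u"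
    by (rule BV_borel_representative[OF u]) blast
  have [measurable]: "u \<in> borel_measurable lebesgue" "v \<in> borel_measurable lebesgue"
    using BV_integrable[OF u] BV_integrable[OF v(3)] by auto
  have iv: "integrable lebesgue (\<lambda>y. indicator (ball x e) y * \<bar>v y\<bar>)" for x e
    using integrable_bounded_mult[OF integrable_abs[OF BV_integrable[OF v(3)]], of "indicator (ball x e)" 1]
      borel_measurable_lebesgue_of_borel[OF borel_measurable_indicator[of "ball x e" borel]]
    by (simp add: mult.commute)
  have "(\<integral>x. (if \<bar>v x\<bar> > 2 * (k / ?m) then \<bar>v x\<bar> else 0) \<partial>lebesgue) \<le> 2 * d * tv v"
  proof (rule BV_large_values[OF v(3,1) d(1)])
    fix x
    have "(\<integral>h. indicator ?B h * \<bar>v (x + h)\<bar> \<partial>lborel) = (\<integral>y. indicator (ball x d) y * \<bar>v y\<bar> \<partial>lborel)"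
      by (rule integral_ball_translate[where u="\<lambda>x. \<bar>v x\<bar>"]) (use v(1) in auto)
    also have "\<dots> = (\<integral>y. indicator (ball x d) y * \<bar>v y\<bar> \<partial>lebesgue)"
      using v(1) borel_measurable_indicator[of "ball x d" borel] by (subst integral_completion) (auto intro!: borel_measurable_times)
    also have "\<dots> \<le> (\<integral>y. indicator (ball x 1) y * \<bar>v y\<bar> \<partial>lebesgue)"
      by (rule integral_mono[OF iv iv]) (use d in \<open>auto simp: indicator_def\<close>)
    also have "\<dots> = (\<integral>y. indicator (ball x 1) y * \<bar>u y\<bar> \<partial>lebesgue)"
      by (intro integral_cong_AE borel_measurable_times borel_measurable_lebesgue_of_borel[OF borel_measurable_indicator])
        (use v(2) in auto)
    also have "\<dots> \<le> k" by (rule small)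
    finally show "(\<integral>h. indicator ?B h * \<bar>v (x + h)\<bar> \<partial>lborel) \<le> k / ?m * ?m" using m by simp
  qed (use k m in auto)
  moreover have "(\<integral>x. (if \<bar>v x\<bar> > 2 * (k / ?m) then \<bar>v x\<bar> else 0) \<partial>lebesgue) = (\<integral>x. (if \<bar>u x\<bar> > 2 * (k / ?m) then \<bar>u x\<bar> else 0) \<partial>lebesgue)"
    by (intro integral_cong_AE) (use v(2) in auto)
  ultimately show ?thesis using v(4) by simp
qed

section \<open>Compactness\<close>

definition L1loc_lim :: "(nat \<Rightarrow> 'a::euclidean_space \<Rightarrow> real) \<Rightarrow> ('a \<Rightarrow> real) \<Rightarrow> bool" where
  "L1loc_lim w v \<longleftrightarrow> (\<forall>R. (\<lambda>n. \<integral>x. indicator (ball 0 R) x * \<bar>w n x - v x\<bar> \<partial>lebesgue) \<longlonglongrightarrow> 0)"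

text \<open>Fatou's lemma, for a bound that is known only from some index on.\<close>

lemma nn_integral_le_of_AE_tendsto:
  assumes m: "\<And>n::nat. f n \<in> borel_measurable M" and g: "g \<in> borel_measurable M"
    and lim: "AE x in M. (\<lambda>n. f n x) \<longlonglongrightarrow> (g x :: ennreal)"
    and le: "\<forall>\<^sub>F n in sequentially. (\<integral>\<^sup>+x. f n x \<partial>M) \<le> C"
  shows "(\<integral>\<^sup>+x. g x \<partial>M) \<le> C"
proof -
  have "(\<integral>\<^sup>+x. g x \<partial>M) = (\<integral>\<^sup>+x. liminf (\<lambda>n. f n x) \<partial>M)"
    by (intro nn_integral_cong_AE) (use lim in eventually_elim, auto simp: lim_imp_Liminf)
  also have "\<dots> \<le> liminf (\<lambda>n. \<integral>\<^sup>+x. f n x \<partial>M)" by (rule nn_integral_liminf[OF m])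
  also have "\<dots> \<le> C"
    using le by (intro Liminf_le) auto
  finally show ?thesis .
qed

lemma integrable_indicator_mult:
  fixes g :: "'a::euclidean_space \<Rightarrow> real"
  assumes "integrable lebesgue g" "A \<in> sets lebesgue"
  shows "integrable lebesgue (\<lambda>x. indicator A x * g x)"
  using integrable_bounded_mult[OF assms(1) borel_measurable_indicator[OF assms(2)], of 1]
  by (simp add: mult.commute)

lemma nn_integral_indicator_abs:
  fixes g :: "'a::euclidean_space \<Rightarrow> real"
  assumes "integrable lebesgue g" "A \<in> sets lebesgue"
  shows "(\<integral>\<^sup>+x. ennreal (indicator A x * \<bar>g x\<bar>) \<partial>lebesgue) = ennreal (\<integral>x. indicator A x * \<bar>g x\<bar> \<partial>lebesgue)"
  by (rule nn_integral_eq_integral) (use assms in \<open>auto intro!: integrable_indicator_mult\<close>)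

lemma convergent_of_summable_abs_diff:
  fixes a :: "nat \<Rightarrow> real"
  assumes "summable (\<lambda>k. \<bar>a (Suc k) - a k\<bar>)"
  shows "convergent a"
proof -
  have "summable (\<lambda>k. a (Suc k) - a k)" using assms by (rule summable_rabs_cancel)
  then have "convergent (\<lambda>n. \<Sum>k<n. (a (Suc k) - a k))" by (simp add: summable_iff_convergent)
  then have "convergent (\<lambda>n. a n - a 0)" by (simp add: sum_lessThan_telescope)
  then show ?thesis using convergent_diff_const_right_iff[of a "a 0"] by simp
qed

text \<open>The Riesz-Fischer argument. The k-th difference of a fast subsequence is measured on the
  ball of radius k, so a single subsequence converges a.e. on the whole space.\<close>

lemma L1loc_complete:
  fixes w :: "nat \<Rightarrow> 'a::euclidean_space \<Rightarrow> real"
  assumes w: "\<And>n. integrable lebesgue (w n)" and K: "\<And>n. (\<integral>x. \<bar>w n x\<bar> \<partial>lebesgue) \<le> K"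
    and Cauchy: "\<And>R e. e > 0 \<Longrightarrow> \<exists>M. \<forall>i\<ge>M. \<forall>j\<ge>M. (\<integral>x. indicator (ball 0 R) x * \<bar>w i x - w j x\<bar> \<partial>lebesgue) \<le> e"
  obtains v where "integrable lebesgue v" "(\<integral>x. \<bar>v x\<bar> \<partial>lebesgue) \<le> K" "L1loc_lim w v"
proof -
  have mw[measurable]: "w n \<in> borel_measurable lebesgue" for n using w by auto
  have [measurable]: "ball (0::'a) R \<in> sets lebesgue" for R by simp
  have K0: "K \<ge> 0" using K[of 0] by (rule order_trans[rotated]) auto
  have "\<exists>M. \<forall>i\<ge>M. \<forall>j\<ge>M. (\<integral>x. indicator (ball 0 (real k)) x * \<bar>w i x - w j x\<bar> \<partial>lebesgue) \<le> (1/2) ^ k" for k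
    by (rule Cauchy) simp
  then obtain M where M: "\<And>k i j. i \<ge> M k \<Longrightarrow> j \<ge> M k \<Longrightarrow>
      (\<integral>x. indicator (ball 0 (real k)) x * \<bar>w i x - w j x\<bar> \<partial>lebesgue) \<le> (1/2) ^ k" by metis
  \<comment> \<open>The sum makes \<open>s\<close> monotone and at least \<open>M k\<close>; the
    summand \<open>k\<close> makes it unbounded.\<close>
  define s where "s k = k + (\<Sum>i\<le>k. M i)" for k
  have sM: "s k \<ge> M k" for k
    unfolding s_def by (simp add: member_le_sum trans_le_add2)
  have sSuc: "s (Suc k) \<ge> s k" for k unfolding s_def by simp
  have sk: "s k \<ge> k" for k unfolding s_def by simp
  define D where "D k x = indicator (ball 0 (real k)) x * \<bar>w (s (Suc k)) x - w (s k) x\<bar>" for k x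
  have mD[measurable]: "D k \<in> borel_measurable lebesgue" for k
    unfolding D_def by measurable
  have D0: "D k x \<ge> 0" for k x unfolding D_def by simp
  have iD: "(\<integral>\<^sup>+x. ennreal (D k x) \<partial>lebesgue) \<le> ennreal ((1/2) ^ k)" for k
    unfolding D_def using M[where k=k and i="s (Suc k)" and j="s k"] sM[of k] sSuc[of k] w
    by (subst nn_integral_indicator_abs) (auto intro: ennreal_leI)
  have "(\<integral>\<^sup>+x. (\<Sum>k. ennreal (D k x)) \<partial>lebesgue) = (\<Sum>k. \<integral>\<^sup>+x. ennreal (D k x) \<partial>lebesgue)"
    by (rule nn_integral_suminf) measurable
  also have "\<dots> \<le> (\<Sum>k. ennreal ((1/2) ^ k))"
    by (intro suminf_le iD) auto
  also have "\<dots> = ennreal (\<Sum>k. (1/2) ^ k)"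
    by (rule suminf_ennreal2) (auto intro: summable_geometric)
  finally have "(\<integral>\<^sup>+x. (\<Sum>k. ennreal (D k x)) \<partial>lebesgue) < \<infinity>"
    by (simp add: order_le_less_trans)
  then have fin: "AE x in lebesgue. (\<Sum>k. ennreal (D k x)) \<noteq> \<infinity>"
    by (intro nn_integral_PInf_AE) auto
  \<comment> \<open>Where the sequence diverges \<open>lim\<close> is an arbitrary value; this
    concerns a null set only and does not disturb measurability.\<close>
  define v where "v x = lim (\<lambda>n. w (s n) x)" for x
  have mv[measurable]: "v \<in> borel_measurable lebesgue"
    unfolding v_def by (rule borel_measurable_lim_metric) measurable
  have conv: "AE x in lebesgue. (\<lambda>n. w (s n) x) \<longlonglongrightarrow> v x"
    using fin
  proof eventually_elim
    case (elim x)
    have sD: "summable (\<lambda>k. D k x)"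
      using elim D0 by (intro summable_suminf_not_top) (auto simp: infinity_ennreal_def)
    obtain k0 :: nat where k0: "norm x < real k0" using reals_Archimedean2 by blast
    have "summable (\<lambda>k. \<bar>w (s (Suc k)) x - w (s k) x\<bar>)"
    proof (rule summable_comparison_test_ev[OF _ sD])
      show "\<forall>\<^sub>F k in sequentially. norm \<bar>w (s (Suc k)) x - w (s k) x\<bar> \<le> D k x"
        using eventually_ge_at_top[of k0]
        by eventually_elim (use k0 in \<open>auto simp: D_def indicator_def\<close>)
    qed
    then show ?case
      unfolding v_def using convergent_of_summable_abs_diff[of "\<lambda>k. w (s k) x"] by (simp add: convergent_LIMSEQ_iff)
  qed
  have nv: "(\<integral>\<^sup>+x. ennreal \<bar>v x\<bar> \<partial>lebesgue) \<le> ennreal K"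
  proof (rule nn_integral_le_of_AE_tendsto[where f="\<lambda>n x. ennreal \<bar>w (s n) x\<bar>"])
    show "AE x in lebesgue. (\<lambda>n. ennreal \<bar>w (s n) x\<bar>) \<longlonglongrightarrow> ennreal \<bar>v x\<bar>"
      using conv by eventually_elim (intro tendsto_ennrealI tendsto_rabs)
    have "(\<integral>\<^sup>+x. ennreal \<bar>w n x\<bar> \<partial>lebesgue) \<le> ennreal K" for n
      using K[of n] w[of n] by (subst nn_integral_eq_integral) (auto intro: ennreal_leI)
    then show "\<forall>\<^sub>F n in sequentially. (\<integral>\<^sup>+x. ennreal \<bar>w (s n) x\<bar> \<partial>lebesgue) \<le> ennreal K" by simp
  qed measurable
  have iav: "integrable lebesgue (\<lambda>x. \<bar>v x\<bar>)"
    by (rule integrableI_nonneg) (use nv in \<open>auto simp: less_top[symmetric] top_unique\<close>)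
  then have iv: "integrable lebesgue v" by (simp add: integrable_abs_iff)
  have "ennreal (\<integral>x. \<bar>v x\<bar> \<partial>lebesgue) \<le> ennreal K"
    using nv nn_integral_eq_integral[OF iav] by simp
  then have vK: "(\<integral>x. \<bar>v x\<bar> \<partial>lebesgue) \<le> K" using K0 by (subst (asm) ennreal_le_iff) auto
  have "L1loc_lim w v"
    unfolding L1loc_lim_def
  proof
    fix R :: real
    show "(\<lambda>n. \<integral>x. indicator (ball 0 R) x * \<bar>w n x - v x\<bar> \<partial>lebesgue) \<longlonglongrightarrow> 0"
    proof (rule LIMSEQ_I)
      fix e :: real assume e: "e > 0"
      then obtain M0 where M0: "\<And>i j. i \<ge> M0 \<Longrightarrow> j \<ge> M0 \<Longrightarrow>
          (\<integral>x. indicator (ball 0 R) x * \<bar>w i x - w j x\<bar> \<partial>lebesgue) \<le> e / 2"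
        using Cauchy[of "e/2" R] by auto
      have "norm ((\<integral>x. indicator (ball 0 R) x * \<bar>w n x - v x\<bar> \<partial>lebesgue) - 0) < e" if n: "n \<ge> M0" for n
      proof -
        \<comment> \<open>Letting the second index run through the subsequence transfers the Cauchy
          estimate to \<open>v\<close>, so the full sequence converges.\<close>
        have "(\<integral>\<^sup>+x. ennreal (indicator (ball 0 R) x * \<bar>w n x - v x\<bar>) \<partial>lebesgue) \<le> ennreal (e/2)"
        proof (rule nn_integral_le_of_AE_tendsto[where f="\<lambda>k x. ennreal (indicator (ball 0 R) x * \<bar>w n x - w (s k) x\<bar>)"])
          show "AE x in lebesgue. (\<lambda>k. ennreal (indicator (ball 0 R) x * \<bar>w n x - w (s k) x\<bar>)) \<longlonglongrightarrow> ennreal (indicator (ball 0 R) x * \<bar>w n x - v x\<bar>)"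
            using conv by eventually_elim (intro tendsto_ennrealI tendsto_intros)
          show "\<forall>\<^sub>F k in sequentially. (\<integral>\<^sup>+x. ennreal (indicator (ball 0 R) x * \<bar>w n x - w (s k) x\<bar>) \<partial>lebesgue) \<le> ennreal (e/2)"
            using eventually_ge_at_top[of M0]
          proof eventually_elim
            case (elim k)
            then have "s k \<ge> M0" using sk[of k] by linarith
            then show ?case using M0[OF n, of "s k"] w
              by (subst nn_integral_indicator_abs) (auto intro: ennreal_leI)
          qed
        qed measurable
        then have "ennreal (\<integral>x. indicator (ball 0 R) x * \<bar>w n x - v x\<bar> \<partial>lebesgue) \<le> ennreal (e/2)"
          using w iv by (subst (asm) nn_integral_indicator_abs) auto
        then have "(\<integral>x. indicator (ball 0 R) x * \<bar>w n x - v x\<bar> \<partial>lebesgue) \<le> e/2"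
          using e by (subst (asm) ennreal_le_iff) auto
        moreover have "(\<integral>x. indicator (ball 0 R) x * \<bar>w n x - v x\<bar> \<partial>lebesgue) \<ge> 0"
          by (intro integral_nonneg_AE) auto
        ultimately show ?thesis using e by simp
      qed
      then show "\<exists>no. \<forall>n\<ge>no. norm ((\<integral>x. indicator (ball 0 R) x * \<bar>w n x - v x\<bar> \<partial>lebesgue) - 0) < e" by blast
    qed
  qed
  then show thesis using that iv vK by blast
qed

lemma L1loc_pairing_tendsto:
  fixes w :: "nat \<Rightarrow> 'a::euclidean_space \<Rightarrow> real"
  assumes w: "\<And>n. integrable lebesgue (w n)" and v: "integrable lebesgue v" and lim: "L1loc_lim w v"
    and g: "g \<in> borel_measurable lebesgue" "\<And>x. \<bar>g x\<bar> \<le> B" "\<And>x. norm x > R \<Longrightarrow> g x = 0"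
  shows "(\<lambda>n. \<integral>x. w n x * g x \<partial>lebesgue) \<longlonglongrightarrow> (\<integral>x. v x * g x \<partial>lebesgue)"
proof (rule Lim_transform2)
  have iw: "integrable lebesgue (\<lambda>x. h x * g x)" if "integrable lebesgue h" for h
    by (rule integrable_bounded_mult[OF that g(1,2)])
  have B: "B \<ge> 0" using g(2)[of 0] by (rule order_trans[rotated]) simp
  have "(\<lambda>n. (\<integral>x. v x * g x \<partial>lebesgue) - (\<integral>x. w n x * g x \<partial>lebesgue)) \<longlonglongrightarrow> 0"
  proof (rule Lim_null_comparison)
    show "\<forall>\<^sub>F n in sequentially. norm ((\<integral>x. v x * g x \<partial>lebesgue) - (\<integral>x. w n x * g x \<partial>lebesgue))
        \<le> B * (\<integral>x. indicator (ball 0 (R + 1)) x * \<bar>w n x - v x\<bar> \<partial>lebesgue)"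
    proof (intro always_eventually allI)
      fix n
      have i: "integrable lebesgue (\<lambda>x. B * (indicator (ball 0 (R + 1)) x * \<bar>w n x - v x\<bar>))"
        using w v by (intro integrable_mult_right integrable_indicator_mult integrable_abs Bochner_Integration.integrable_diff) auto
      have "norm ((\<integral>x. v x * g x \<partial>lebesgue) - (\<integral>x. w n x * g x \<partial>lebesgue)) = norm (\<integral>x. v x * g x - w n x * g x \<partial>lebesgue)"
        using iw[OF v] iw[OF w] by simp
      also have "\<dots> \<le> (\<integral>x. B * (indicator (ball 0 (R + 1)) x * \<bar>w n x - v x\<bar>) \<partial>lebesgue)"
      proof (rule order_trans[OF integral_norm_bound integral_mono])
        show "norm (v x * g x - w n x * g x) \<le> B * (indicator (ball 0 (R + 1)) x * \<bar>w n x - v x\<bar>)" for x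
        proof (cases "norm x > R")
          case False
          have "\<bar>v x * g x - w n x * g x\<bar> = \<bar>g x\<bar> * \<bar>w n x - v x\<bar>"
            unfolding left_diff_distrib[symmetric] abs_mult by (simp add: abs_minus_commute mult.commute)
          also have "\<dots> \<le> B * \<bar>w n x - v x\<bar>" by (intro mult_right_mono g) auto
          finally show ?thesis using False by (simp add: indicator_def)
        qed (use g(3)[of x] B in auto)
      qed (use iw[OF v] iw[OF w] i in auto)
      finally show "norm ((\<integral>x. v x * g x \<partial>lebesgue) - (\<integral>x. w n x * g x \<partial>lebesgue))
        \<le> B * (\<integral>x. indicator (ball 0 (R + 1)) x * \<bar>w n x - v x\<bar> \<partial>lebesgue)" by simp
    qed
    show "(\<lambda>n. B * (\<integral>x. indicator (ball 0 (R + 1)) x * \<bar>w n x - v x\<bar> \<partial>lebesgue)) \<longlonglongrightarrow> 0"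
      using lim unfolding L1loc_lim_def by (intro tendsto_mult_right_zero) auto
  qed
  then show "(\<lambda>n. (\<integral>x. v x * g x \<partial>lebesgue) - (\<integral>x. w n x * g x \<partial>lebesgue)) \<longlonglongrightarrow> 0" .
qed simp

lemma L1loc_divergence_tendsto:
  fixes w :: "nat \<Rightarrow> real^'n \<Rightarrow> real"
  assumes w: "\<And>n. integrable lebesgue (w n)" and v: "integrable lebesgue v" and lim: "L1loc_lim w v"
    and \<phi>: "C1c_field \<phi>"
  shows "(\<lambda>n. \<integral>x. w n x * divergence \<phi> x \<partial>lebesgue) \<longlonglongrightarrow> (\<integral>x. v x * divergence \<phi> x \<partial>lebesgue)"
proof -
  obtain R where "\<And>x. norm x > R \<Longrightarrow> divergence \<phi> x = 0" using divergence_outside[OF \<phi>] by blast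
  moreover obtain B where "\<And>x. \<bar>divergence \<phi> x\<bar> \<le> B" using divergence_bounded[OF \<phi>] by blast
  ultimately show ?thesis
    using L1loc_pairing_tendsto[OF w v lim borel_measurable_lebesgue_of_borel[OF divergence_measurable[OF \<phi>]]] by blast
qed

text \<open>The variation is a supremum of pairings, each continuous under L1loc convergence because
  a divergence is bounded with bounded support; hence it is lower semicontinuous.\<close>

lemma BV_L1loc_limit:
  fixes w :: "nat \<Rightarrow> real^'n \<Rightarrow> real"
  assumes w: "\<And>n. w n \<in> BV" "\<And>n. tv (w n) \<le> K" and v: "integrable lebesgue v" and lim: "L1loc_lim w v"
  shows "v \<in> BV" "tv v \<le> K"
proof -
  have "(\<integral>x. v x * divergence \<phi> x \<partial>lebesgue) \<le> K" if \<phi>: "C1c_field \<phi>" "\<And>x. norm (\<phi> x) \<le> 1" for \<phi>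
  proof (rule LIMSEQ_le_const2[OF L1loc_divergence_tendsto[OF BV_integrable[OF w(1)] v lim \<phi>(1)]])
    show "\<exists>N. \<forall>n\<ge>N. (\<integral>x. w n x * divergence \<phi> x \<partial>lebesgue) \<le> K"
      using tv_upper[OF w(1) \<phi>] w(2) order_trans by blast
  qed
  then show "v \<in> BV" "tv v \<le> K" using tv_least[OF v] by blast+
qed

text \<open>For a fixed radius the averages are uniformly bounded and Lipschitz, as an Arzela-Ascoli
  argument needs, while as \<open>d\<close> shrinks they approximate \<open>u\<close> in L^1
  uniformly over bounded sets of \<open>BV\<close>. \<open>G\<close> is left unnormalised; the
  volume is divided out only where \<open>u\<close> is compared with it.\<close>

lemma BV_ball_average:
  fixes u :: "real^'n \<Rightarrow> real"
  assumes u: "u \<in> BV" "u \<in> borel_measurable borel" and d: "d > 0"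
  defines "G \<equiv> \<lambda>x. \<integral>h. indicator (ball 0 d) h * u (x + h) \<partial>lborel"
  shows "\<bar>G x\<bar> \<le> (\<integral>x. \<bar>u x\<bar> \<partial>lebesgue)" "\<bar>G x - G y\<bar> \<le> norm (x - y) * tv u"
    "integrable lebesgue (\<lambda>x. u x - G x / measure lborel (ball 0 d :: (real^'n) set))"
    "(\<integral>x. \<bar>u x - G x / measure lborel (ball 0 d :: (real^'n) set)\<bar> \<partial>lebesgue) \<le> d * tv u"
    "G \<in> borel_measurable borel"
proof -
  let ?B = "ball 0 d :: (real^'n) set" and ?m = "measure lborel (ball 0 d :: (real^'n) set)"
  note [measurable] = u(2)
  have [measurable]: "?B \<in> sets borel" by simp
  have m: "?m > 0" by (rule ball_measure_pos[OF d])
  note osc = BV_average_oscillation[OF u d]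
  have ib: "integrable lborel (indicator ?B :: real^'n \<Rightarrow> real)"
    by (rule integrable_indicator_ball)
  have it: "integrable lborel (\<lambda>h. u (h + x))" for x
    using integrable_lebesgue_translation[OF BV_integrable[OF u(1)], of x]
    by (subst integrable_borel_lebesgue[symmetric]) auto
  have i1: "integrable lborel (\<lambda>h. indicator ?B h * u (x + h))" for x
    using integrable_bounded_mult[OF it[of x], of "indicator ?B" 1] borel_measurable_indicator[of ?B borel]
    by (simp add: mult.commute add.commute)
  show Gm[measurable]: "G \<in> borel_measurable borel" unfolding G_def by measurable
  have Gle: "\<bar>\<integral>h. indicator ?B h * g h \<partial>lborel\<bar> \<le> (\<integral>h. \<bar>g h\<bar> \<partial>lborel)"
    if "integrable lborel g" for g :: "real^'n \<Rightarrow> real"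
  proof -
    have "\<bar>\<integral>h. indicator ?B h * g h \<partial>lborel\<bar> \<le> (\<integral>h. \<bar>indicator ?B h * g h\<bar> \<partial>lborel)"
      using integral_norm_bound[of lborel "\<lambda>h. indicator ?B h * g h"] by simp
    also have "\<dots> \<le> (\<integral>h. \<bar>g h\<bar> \<partial>lborel)"
    proof (rule integral_mono)
      show "integrable lborel (\<lambda>h. \<bar>indicator ?B h * g h\<bar>)"
        using integrable_bounded_mult[OF that, of "indicator ?B" 1] borel_measurable_indicator[of ?B borel]
        by (intro integrable_abs) (simp add: mult.commute)
    qed (use that in \<open>auto simp: indicator_def\<close>)
    finally show ?thesis .
  qed
  have tr: "(\<integral>h. \<bar>u (h + x)\<bar> \<partial>lborel) = (\<integral>x. \<bar>u x\<bar> \<partial>lebesgue)" for x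
  proof -
    have "(\<integral>h. \<bar>u (h + x)\<bar> \<partial>lborel) = (\<integral>h. \<bar>u (h + x)\<bar> \<partial>lebesgue)"
      by (subst integral_completion) auto
    also have "\<dots> = (\<integral>x. \<bar>u x\<bar> \<partial>lebesgue)"
      by (rule integral_lebesgue_translation[where g="\<lambda>x. \<bar>u x\<bar>"]) (use BV_integrable[OF u(1)] in auto)
    finally show ?thesis .
  qed
  show "\<bar>G x\<bar> \<le> (\<integral>x. \<bar>u x\<bar> \<partial>lebesgue)" for x
    using Gle[OF it[of x]] tr[of x] unfolding G_def by (simp add: add.commute)
  show "\<bar>G x - G y\<bar> \<le> norm (x - y) * tv u" for x y
  proof -
    have "G x - G y = (\<integral>h. indicator ?B h * (u (h + x) - u (h + y)) \<partial>lborel)"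
      unfolding G_def using i1[of x] i1[of y] by (simp add: right_diff_distrib add.commute)
    then have "\<bar>G x - G y\<bar> \<le> (\<integral>h. \<bar>u (h + x) - u (h + y)\<bar> \<partial>lborel)"
      using Gle[OF Bochner_Integration.integrable_diff[OF it it]] by simp
    also have "\<dots> = (\<integral>h. \<bar>u (h + x) - u (h + y)\<bar> \<partial>lebesgue)"
      by (subst integral_completion) auto
    also have "\<dots> = (\<integral>h. \<bar>u ((h + y) + (x - y)) - u (h + y)\<bar> \<partial>lebesgue)" by simp
    also have "\<dots> = (\<integral>h. \<bar>u (h + (x - y)) - u h\<bar> \<partial>lebesgue)"
      by (rule integral_lebesgue_translation[where g="\<lambda>h. \<bar>u (h + (x - y)) - u h\<bar>"])
        (intro borel_measurable_lebesgue_of_borel, measurable)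
    also have "\<dots> \<le> norm (x - y) * tv u" by (rule BV_translation_integral[OF u(1)])
    finally show ?thesis .
  qed
  define D where "D x = (\<integral>h. indicator ?B h * \<bar>u (x + h) - u x\<bar> \<partial>lborel)" for x
  have le: "\<bar>u x - G x / ?m\<bar> \<le> D x / ?m" for x
  proof -
    have "(\<integral>h. indicator ?B h * (u (x + h) - u x) \<partial>lborel) = G x - ?m * u x"
      unfolding G_def right_diff_distrib using i1[of x] ib by simp
    then have "\<bar>?m * u x - G x\<bar> = norm (\<integral>h. indicator ?B h * (u (x + h) - u x) \<partial>lborel)"
      by (simp add: abs_minus_commute)
    also have "\<dots> \<le> (\<integral>h. norm (indicator ?B h * (u (x + h) - u x)) \<partial>lborel)" by (rule integral_norm_bound)
    also have "\<dots> = D x" unfolding D_def by (intro Bochner_Integration.integral_cong) (auto simp: abs_mult)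
    finally have "\<bar>?m * u x - G x\<bar> / ?m \<le> D x / ?m" using m by (intro divide_right_mono) auto
    moreover have "u x - G x / ?m = (?m * u x - G x) / ?m" using m by (simp add: diff_divide_distrib)
    ultimately show ?thesis using m by (simp only: abs_divide abs_of_pos)
  qed
  have iD: "integrable lborel (\<lambda>x. D x / ?m)" unfolding D_def by (intro integrable_divide_zero osc(3))
  have i: "integrable lborel (\<lambda>x. u x - G x / ?m)"
  proof (rule Bochner_Integration.integrable_bound[OF iD])
    show "AE x in lborel. norm (u x - G x / ?m) \<le> norm (D x / ?m)"
      using le by (intro AE_I2) (metis abs_ge_self order_trans real_norm_def)
  qed measurable
  then show "integrable lebesgue (\<lambda>x. u x - G x / ?m)"
    by (subst integrable_borel_lebesgue) measurable
  have "(\<integral>x. \<bar>u x - G x / ?m\<bar> \<partial>lebesgue) = (\<integral>x. \<bar>u x - G x / ?m\<bar> \<partial>lborel)"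
    by (subst integral_completion) auto
  also have "\<dots> \<le> (\<integral>x. D x / ?m \<partial>lborel)" by (rule integral_mono[OF integrable_abs[OF i] iD le])
  also have "\<dots> = (\<integral>x. D x \<partial>lborel) / ?m" by simp
  also have "\<dots> \<le> (?m * d * tv u) / ?m" using osc(4) m unfolding D_def by (intro divide_right_mono) auto
  also have "\<dots> = d * tv u" using m by simp
  finally show "(\<integral>x. \<bar>u x - G x / ?m\<bar> \<partial>lebesgue) \<le> d * tv u" .
qed

lemma BV_compactness_borel:
  fixes u :: "nat \<Rightarrow> real^'n \<Rightarrow> real"
  assumes u: "\<And>n. u n \<in> BV" "\<And>n. u n \<in> borel_measurable borel"
    and K: "\<And>n. (\<integral>x. \<bar>u n x\<bar> \<partial>lebesgue) \<le> K" "\<And>n. tv (u n) \<le> K"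
  obtains r v where "strict_mono r" "v \<in> BV" "L1loc_lim (\<lambda>n. u (r n)) v"
proof -
  define d where "d k = 1 / real (Suc k)" for k
  have d: "d k > 0" for k unfolding d_def by simp
  define G where "G n k x = (\<integral>h. indicator (ball 0 (d k)) h * u n (x + h) \<partial>lborel)" for n k x
  define m where "m k = measure lborel (ball 0 (d k) :: (real^'n) set)" for k
  have m: "m k > 0" for k unfolding m_def by (rule ball_measure_pos[OF d])
  have K0: "K \<ge> 0" using K(2)[of 0] tv_nonneg[of "u 0"] by linarith
  have G1: "\<bar>G n k x\<bar> \<le> K" for n k x
    using BV_ball_average(1)[OF u d] K(1) unfolding G_def by (rule order_trans)
  have G2: "\<bar>G n k x - G n k y\<bar> \<le> norm (x - y) * K" for n k x y
    using BV_ball_average(2)[OF u(1)[of n] u(2)[of n] d[of k], of x y] mult_left_mono[OF K(2)[of n] norm_ge_zero[of "x - y"]]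
    unfolding G_def by linarith
  have G3: "integrable lebesgue (\<lambda>x. u n x - G n k x / m k)" for n k
    using BV_ball_average(3)[OF u d] unfolding G_def m_def .
  have G4: "(\<integral>x. \<bar>u n x - G n k x / m k\<bar> \<partial>lebesgue) \<le> d k * K" for n k
    using BV_ball_average(4)[OF u(1)[of n] u(2)[of n] d[of k]] mult_left_mono[OF K(2)[of n] less_imp_le[OF d[of k]]]
    unfolding G_def m_def by linarith
  have G5[measurable]: "G n k \<in> borel_measurable lebesgue" for n k
    using borel_measurable_lebesgue_of_borel[OF BV_ball_average(5)[OF u(1)[of n] u(2)[of n] d[of k]]] unfolding G_def .
  obtain Q :: "(real^'n) set" where Q: "countable Q" "\<And>X. open X \<Longrightarrow> X \<noteq> {} \<Longrightarrow> \<exists>q\<in>Q. q \<in> X"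
    using countable_dense_exists by metis
  \<comment> \<open>Indexing by pairs of a radius and a point of a dense set lets one diagonal
    extraction serve all radii at once.\<close>
  obtain r where r: "strict_mono (r :: nat \<Rightarrow> nat)"
    "\<And>p. p \<in> UNIV \<times> Q \<Longrightarrow> \<exists>l. (\<lambda>n. (\<lambda>n p. G n (fst p) (snd p)) (r n) p) \<longlonglongrightarrow> l"
  proof (rule function_convergent_subsequence[of "(UNIV :: nat set) \<times> Q" "\<lambda>n p. G n (fst p) (snd p)" K])
    show "countable ((UNIV :: nat set) \<times> Q)" using Q(1) by simp
  qed (use G1 in auto)
  have conv: "convergent (\<lambda>n. G (r n) k x)" for k x
  proof (rule Cauchy_convergent, rule metric_CauchyI)
    fix e :: real assume e: "e > 0"
    \<comment> \<open>The common Lipschitz constant \<open>K\<close> carries convergence from the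
      dense set to every point; \<open>K + 1\<close> keeps the denominator positive if
      \<open>K\<close> is 0.\<close>
    define \<delta> where "\<delta> = e / (4 * (K + 1))"
    have \<delta>: "\<delta> > 0" using e K0 by (simp add: \<delta>_def)
    obtain q where q: "q \<in> Q" "dist x q < \<delta>"
      using Q(2)[of "ball x \<delta>"] \<delta> by auto
    have "norm (x - q) * K \<le> \<delta> * (K + 1)"
      using q(2) K0 \<delta> by (intro mult_mono) (auto simp: dist_norm)
    also have "\<dots> = e / 4"
      using K0 nonzero_mult_divide_mult_cancel_right[of "K + 1" e 4] by (simp only: \<delta>_def) (simp add: mult.commute)
    finally have qe: "\<bar>G n k x - G n k q\<bar> \<le> e / 4" for n using G2[of n k x q] by linarith
    have "convergent (\<lambda>n. G (r n) k q)" using r(2)[of "(k, q)"] q(1) by (auto simp: convergent_def)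
    then have "Cauchy (\<lambda>n. G (r n) k q)" by (rule convergent_Cauchy)
    then obtain M where M: "\<And>i j. i \<ge> M \<Longrightarrow> j \<ge> M \<Longrightarrow> dist (G (r i) k q) (G (r j) k q) < e / 4"
      using e unfolding Cauchy_def by (metis zero_less_divide_iff zero_less_numeral)
    have "dist (G (r i) k x) (G (r j) k x) < e" if "i \<ge> M" "j \<ge> M" for i j
      using M[OF that] qe[of "r i"] qe[of "r j"] e unfolding dist_real_def by linarith
    then show "\<exists>M. \<forall>i\<ge>M. \<forall>j\<ge>M. dist (G (r i) k x) (G (r j) k x) < e" by blast
  qed
  define L where "L k x = lim (\<lambda>n. G (r n) k x)" for k x
  have GL: "(\<lambda>n. G (r n) k x) \<longlonglongrightarrow> L k x" for k x
    using conv[of k x] unfolding L_def by (simp add: convergent_LIMSEQ_iff)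
  have Lm[measurable]: "L k \<in> borel_measurable lebesgue" for k
    by (rule borel_measurable_LIMSEQ_real[where u="\<lambda>n. G (r n) k"]) (use GL in auto)
  have L1: "\<bar>L k x\<bar> \<le> K" for k x
    by (rule LIMSEQ_le_const2[OF tendsto_rabs[OF GL]]) (use G1 in auto)
  have bs[measurable]: "ball (0::real^'n) R \<in> sets lebesgue" for R by simp
  have iB: "integrable lebesgue (\<lambda>x. indicator (ball (0::real^'n) R) x * (2 * K))" for R
    by (simp add: integrable_completion integrable_indicator_iff emeasure_lborel_ball_finite[unfolded infinity_ennreal_def] less_top)
  have bnd: "norm (indicator (ball 0 R) x * \<bar>G (r n) k x - L k x\<bar>) \<le> indicator (ball 0 R) x * (2 * K)" for R n k x
    using G1[of "r n" k x] L1[of k x] by (auto simp: indicator_def)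
  have iGL: "integrable lebesgue (\<lambda>x. indicator (ball 0 R) x * \<bar>G (r n) k x - L k x\<bar>)" for R n k
  proof (rule Bochner_Integration.integrable_bound[OF iB[of R]])
    show "AE x in lebesgue. norm (indicator (ball 0 R) x * \<bar>G (r n) k x - L k x\<bar>) \<le> norm (indicator (ball 0 R) x * (2 * K))"
      using bnd by (intro AE_I2) (metis abs_ge_self order_trans real_norm_def)
  qed measurable
  have lim0: "(\<lambda>n. \<integral>x. indicator (ball 0 R) x * \<bar>G (r n) k x - L k x\<bar> \<partial>lebesgue) \<longlonglongrightarrow> 0" for R k
  proof -
    have "(\<lambda>n. \<integral>x. indicator (ball 0 R) x * \<bar>G (r n) k x - L k x\<bar> \<partial>lebesgue) \<longlonglongrightarrow> integral\<^sup>L lebesgue (\<lambda>x::real^'n. 0)"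
    proof (rule integral_dominated_convergence[OF _ _ iB[of R]])
      show "AE x in lebesgue. (\<lambda>n. indicator (ball 0 R) x * \<bar>G (r n) k x - L k x\<bar>) \<longlonglongrightarrow> 0"
      proof (intro AE_I2)
        fix x
        have "(\<lambda>n. indicator (ball 0 R) x * \<bar>G (r n) k x - L k x\<bar>) \<longlonglongrightarrow> indicator (ball 0 R) x * \<bar>L k x - L k x\<bar>"
          by (intro tendsto_intros GL)
        then show "(\<lambda>n. indicator (ball 0 R) x * \<bar>G (r n) k x - L k x\<bar>) \<longlonglongrightarrow> 0" by simp
      qed
      show "AE x in lebesgue. norm (indicator (ball 0 R) x * \<bar>G (r n) k x - L k x\<bar>) \<le> indicator (ball 0 R) x * (2 * K)" for n
        by (intro AE_I2 bnd)
    qed measurable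
    then show ?thesis by simp
  qed
  have Cauchy: "\<exists>M. \<forall>i\<ge>M. \<forall>j\<ge>M. (\<integral>x. indicator (ball 0 R) x * \<bar>u (r i) x - u (r j) x\<bar> \<partial>lebesgue) \<le> e" if e: "e > 0" for R e
  proof -
    \<comment> \<open>The radius is fixed first, so small that replacing \<open>u\<close> by its
      average costs at most e/4 for every member of the sequence.\<close>
    obtain k :: nat where k: "4 * (K + 1) / e < real (Suc k)"
      using reals_Archimedean2 by (metis less_trans of_nat_less_iff lessI)
    have "d k * K \<le> e / 4"
    proof -
      have "4 * (K + 1) < real (Suc k) * e" using k e by (simp add: pos_divide_less_eq)
      then have "K < real (Suc k) * e / 4" by simp
      then show ?thesis unfolding d_def using less_imp_le[of K "real (Suc k) * e / 4"] by (simp add: divide_simps mult_ac)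
    qed
    then have dk: "(\<integral>x. \<bar>u n x - G n k x / m k\<bar> \<partial>lebesgue) \<le> e / 4" for n using G4[of n k] by linarith
    \<comment> \<open>The error of the unnormalised averages has to beat the volume
      \<open>m k\<close>, a constant now that \<open>k\<close> is fixed.\<close>
    have "e / 4 * m k > 0" using e m by simp
    then obtain M where M: "\<And>n. n \<ge> M \<Longrightarrow> (\<integral>x. indicator (ball 0 R) x * \<bar>G (r n) k x - L k x\<bar> \<partial>lebesgue) < e / 4 * m k"
      using order_tendstoD(2)[OF lim0[of R k]] unfolding eventually_sequentially by blast
    define I where "I n = (\<integral>x. indicator (ball 0 R) x * \<bar>G (r n) k x - L k x\<bar> \<partial>lebesgue)" for n
    have "(\<integral>x. indicator (ball 0 R) x * \<bar>u (r i) x - u (r j) x\<bar> \<partial>lebesgue) \<le> e" if ij: "i \<ge> M" "j \<ge> M" for i j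
    proof -
      let ?f = "\<lambda>n x. \<bar>u (r n) x - G (r n) k x / m k\<bar>" and ?g = "\<lambda>n x. indicator (ball 0 R) x * \<bar>G (r n) k x - L k x\<bar> / m k"
      have if1: "integrable lebesgue (?f n)" for n using G3 by auto
      have ig: "integrable lebesgue (?g n)" for n using iGL by auto
      have "(\<integral>x. indicator (ball 0 R) x * \<bar>u (r i) x - u (r j) x\<bar> \<partial>lebesgue)
        \<le> (\<integral>x. ((?f i x + ?f j x) + (?g i x + ?g j x)) \<partial>lebesgue)"
      proof (rule integral_mono)
        show "integrable lebesgue (\<lambda>x. indicator (ball 0 R) x * \<bar>u (r i) x - u (r j) x\<bar>)"
          using BV_integrable[OF u(1)] by (intro integrable_indicator_mult integrable_abs Bochner_Integration.integrable_diff) auto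
        show "integrable lebesgue (\<lambda>x. ((?f i x + ?f j x) + (?g i x + ?g j x)))"
          by (intro Bochner_Integration.integrable_add if1 ig)
        fix x :: "real^'n"
        show "indicator (ball 0 R) x * \<bar>u (r i) x - u (r j) x\<bar> \<le> ((?f i x + ?f j x) + (?g i x + ?g j x))"
        proof (cases "x \<in> ball 0 R")
          case True
          have "\<bar>G (r i) k x / m k - G (r j) k x / m k\<bar> = \<bar>G (r i) k x - G (r j) k x\<bar> / m k"
            using m[of k] by (simp add: diff_divide_distrib[symmetric])
          also have "\<dots> \<le> (\<bar>G (r i) k x - L k x\<bar> + \<bar>G (r j) k x - L k x\<bar>) / m k"
            using m[of k] by (intro divide_right_mono) auto
          finally have "\<bar>G (r i) k x / m k - G (r j) k x / m k\<bar> \<le> \<bar>G (r i) k x - L k x\<bar> / m k + \<bar>G (r j) k x - L k x\<bar> / m k"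
            by (simp add: add_divide_distrib)
          then show ?thesis using True by (simp add: indicator_def)
        next
          case False
          then show ?thesis by (simp add: indicator_def)
        qed
      qed
      also have "\<dots> = ((\<integral>x. ?f i x \<partial>lebesgue) + (\<integral>x. ?f j x \<partial>lebesgue)) + (I i / m k + I j / m k)"
      proof -
        show ?thesis
          by (subst Bochner_Integration.integral_add, (intro Bochner_Integration.integrable_add if1 ig)+,
              subst Bochner_Integration.integral_add, (intro if1)+,
              subst Bochner_Integration.integral_add, (intro ig)+) (simp add: I_def)
      qed
      also have "\<dots> \<le> (e / 4 + e / 4) + (e / 4 + e / 4)"
      proof -
        have "I n / m k \<le> e / 4" if "n \<ge> M" for n
          using M[OF that] m[of k] unfolding I_def by (simp add: pos_divide_le_eq)
        then show ?thesis using dk ij by (intro add_mono) auto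
      qed
      finally show ?thesis by simp
    qed
    then show ?thesis by blast
  qed
  obtain v where v: "integrable lebesgue v" "(\<integral>x. \<bar>v x\<bar> \<partial>lebesgue) \<le> K" "L1loc_lim (\<lambda>n. u (r n)) v"
    using L1loc_complete[of "\<lambda>n. u (r n)" K, OF BV_integrable[OF u(1)] K(1) Cauchy] by blast
  have "v \<in> BV" by (rule BV_L1loc_limit(1)[OF u(1) K(2) v(1,3)])
  then show thesis using that[OF r(1) _ v(3)] by blast
qed

lemma L1loc_lim_cong_AE:
  assumes "\<And>n. AE x in lebesgue. u n x = w n x" "\<And>n. u n \<in> borel_measurable lebesgue"
    "\<And>n. w n \<in> borel_measurable lebesgue" "v \<in> borel_measurable lebesgue" "L1loc_lim w v"
  shows "L1loc_lim u v"
proof -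
  note [measurable] = assms(2,3,4)
  have "(\<integral>x. indicator (ball 0 R) x * \<bar>u n x - v x\<bar> \<partial>lebesgue) = (\<integral>x. indicator (ball 0 R) x * \<bar>w n x - v x\<bar> \<partial>lebesgue)" for R n
    by (intro integral_cong_AE borel_measurable_times borel_measurable_indicator) (use assms(1)[of n] in auto)
  then show ?thesis using assms(5) unfolding L1loc_lim_def by simp
qed

lemma BV_compactness:
  fixes u :: "nat \<Rightarrow> real^'n \<Rightarrow> real"
  assumes u: "\<And>n. u n \<in> BV" and K: "\<And>n. (\<integral>x. \<bar>u n x\<bar> \<partial>lebesgue) \<le> K" "\<And>n. tv (u n) \<le> K"
  obtains r v where "strict_mono r" "v \<in> BV" "L1loc_lim (\<lambda>n. u (r n)) v"
proof -
  have "\<exists>v. v \<in> borel_measurable borel \<and> (AE x in lebesgue. v x = u n x) \<and> v \<in> BV \<and> tv v = tv (u n)" for n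
    by (rule BV_borel_representative[OF u[of n]]) blast
  then obtain w where w: "\<And>n. w n \<in> borel_measurable borel" "\<And>n. AE x in lebesgue. w n x = u n x" "\<And>n. w n \<in> BV" "\<And>n. tv (w n) = tv (u n)"
    by metis
  have mu: "u n \<in> borel_measurable lebesgue" for n using BV_integrable[OF u] by auto
  have mw: "w n \<in> borel_measurable lebesgue" for n by (rule borel_measurable_lebesgue_of_borel[OF w(1)])
  have "(\<integral>x. \<bar>w n x\<bar> \<partial>lebesgue) = (\<integral>x. \<bar>u n x\<bar> \<partial>lebesgue)" for n
    by (intro integral_cong_AE) (use w(2)[of n] mu mw in auto)
  then have K': "(\<integral>x. \<bar>w n x\<bar> \<partial>lebesgue) \<le> K" "tv (w n) \<le> K" for n
    using K[of n] w(4)[of n] by simp_all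
  obtain r v where r: "strict_mono r" "v \<in> BV" "L1loc_lim (\<lambda>n. w (r n)) v"
    by (rule BV_compactness_borel[of w, OF w(3,1) K']) blast
  have "L1loc_lim (\<lambda>n. u (r n)) v"
  proof (rule L1loc_lim_cong_AE[OF _ mu mw _ r(3)])
    show "AE x in lebesgue. u (r n) x = w (r n) x" for n using w(2)[of "r n"] by (auto simp: eq_commute)
    show "v \<in> borel_measurable lebesgue" using BV_integrable[OF r(2)] by auto
  qed
  then show thesis using that r by blast
qed

section \<open>The nonlinearity\<close>

lemma powr_le_of_ge:
  fixes s m a b :: real
  assumes "m > 0" "\<bar>s\<bar> \<ge> m" "a \<le> b"
  shows "\<bar>s\<bar> powr a \<le> m powr (a - b) * \<bar>s\<bar> powr b"
proof -
  have "\<bar>s\<bar> powr a = \<bar>s\<bar> powr (a - b) * \<bar>s\<bar> powr b" by (simp add: powr_add[symmetric])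
  also have "\<dots> \<le> m powr (a - b) * \<bar>s\<bar> powr b"
    by (intro mult_right_mono powr_mono2') (use assms in auto)
  finally show ?thesis .
qed

text \<open>\<open>f 0 = 0\<close> encodes continuity together with the limit 0 at the origin. The
  exponent \<open>q\<close> is auxiliary: since it exceeds \<open>p\<close>, \<open>F\<close> is
  small against |s|^q at infinity, and since \<open>f\<close> vanishes at 0, \<open>F\<close> is
  small against |s| near 0.\<close>

locale nonlinearity =
  fixes f :: "real \<Rightarrow> real" and c1 c2 p q \<theta> :: real
  assumes cont: "continuous_on UNIV f" and f_0: "f 0 = 0" and f_mono: "strict_mono f"
    and growth: "\<And>s. \<bar>f s\<bar> \<le> c1 + c2 * \<bar>s\<bar> powr (p - 1)" and c: "c1 > 0" "c2 > 0"
    and p: "1 \<le> p" "p < q"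
    and \<theta>: "\<theta> > 1" and superlinear: "\<And>s. s \<noteq> 0 \<Longrightarrow> 0 < \<theta> * primitive f s \<and> \<theta> * primitive f s \<le> f s * s"
begin

abbreviation F :: "real \<Rightarrow> real" where "F \<equiv> primitive f"

lemma F_0: "F 0 = 0"
  by (simp add: primitive_def)

lemma F_deriv: "(F has_real_derivative f s) (at s)"
proof -
  \<comment> \<open>A base point to the left of both \<open>s\<close> and 0 gives a single formula
    for \<open>F\<close> across the case split in \<open>primitive\<close>.\<close>
  define a b where "a = min s 0 - 1" and "b = max s 0 + 1"
  have ab: "a < s" "s < b" "a < 0" "0 < b" unfolding a_def b_def by auto
  have int: "f integrable_on {x..y}" for x y
    by (rule integrable_continuous_real) (rule continuous_on_subset[OF cont], simp)
  have F_eq: "F x = integral {a..x} f - integral {a..0} f" if "a < x" for x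
  proof (cases "0 \<le> x")
    case True
    have "integral {a..0} f + integral {0..x} f = integral {a..x} f"
      by (rule Henstock_Kurzweil_Integration.integral_combine) (use ab True int in auto)
    then show ?thesis using True by (simp add: primitive_def)
  next
    case False
    have "integral {a..x} f + integral {x..0} f = integral {a..0} f"
      by (rule Henstock_Kurzweil_Integration.integral_combine) (use that False int in auto)
    then show ?thesis using False by (simp add: primitive_def)
  qed
  have "((\<lambda>x. integral {a..x} f) has_real_derivative f s) (at s within {a..b})"
    by (rule integral_has_real_derivative) (use ab in \<open>auto intro: continuous_on_subset[OF cont]\<close>)
  then have "((\<lambda>x. integral {a..x} f) has_real_derivative f s) (at s)"
    using ab at_within_Icc_at[of a s b] by simp
  then have "((\<lambda>x. integral {a..x} f - integral {a..0} f) has_real_derivative f s) (at s)"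
    by (auto intro!: derivative_eq_intros)
  then show ?thesis
    by (rule has_field_derivative_transform_within_open[where S="{a<..}"]) (use ab F_eq in auto)
qed

lemma F_continuous: "continuous_on UNIV F"
  using F_deriv by (auto intro!: continuous_at_imp_continuous_on DERIV_isCont)

lemma F_measurable [measurable]: "F \<in> borel_measurable borel"
  by (rule borel_measurable_continuous_onI[OF F_continuous])

lemma f_measurable [measurable]: "f \<in> borel_measurable borel"
  by (rule borel_measurable_continuous_onI[OF cont])

text \<open>Strict convexity in the form used later; the strictness is what makes the maximum on
  each ray unique.\<close>

lemma F_tangent_strict:
  assumes "a \<noteq> b"
  shows "F b > F a + f a * (b - a)"
proof -
  consider "a < b" | "b < a" using assms by linarith
  then show ?thesis
  proof cases
    case 1
    obtain z where z: "a < z" "z < b" "F b - F a = (b - a) * f z"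
      using MVT2[OF 1, of F f] F_deriv by auto
    have "f a < f z" using f_mono z(1) by (simp add: strict_mono_less)
    then have "(b - a) * f a < (b - a) * f z" using 1 by simp
    then show ?thesis using z(3) by (simp add: algebra_simps)
  next
    case 2
    obtain z where z: "b < z" "z < a" "F a - F b = (a - b) * f z"
      using MVT2[OF 2, of F f] F_deriv by auto
    have "f z < f a" using f_mono z(2) by (simp add: strict_mono_less)
    then have "(a - b) * f z < (a - b) * f a" using 2 by simp
    then show ?thesis using z(3) by (simp add: algebra_simps)
  qed
qed

lemma F_tangent: "F b \<ge> F a + f a * (b - a)"
  using F_tangent_strict[of a b] by (cases "a = b") auto

lemma F_nonneg: "F s \<ge> 0"
  using F_tangent[of 0 s] by (simp add: F_0 f_0)

lemma F_le: "F s \<le> f s * s"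
  using F_tangent[of s 0] by (simp add: F_0)

lemma F_convex:
  assumes "0 \<le> t" "t \<le> 1"
  shows "F ((1 - t) * x + t * y) \<le> (1 - t) * F x + t * F y"
proof -
  let ?a = "(1 - t) * x + t * y"
  have "(1 - t) * (F ?a + f ?a * (x - ?a)) \<le> (1 - t) * F x" "t * (F ?a + f ?a * (y - ?a)) \<le> t * F y"
    using assms by (auto intro!: mult_left_mono F_tangent)
  moreover have "(1 - t) * (F ?a + f ?a * (x - ?a)) + t * (F ?a + f ?a * (y - ?a)) = F ?a"
    by (simp add: algebra_simps)
  ultimately show ?thesis by linarith
qed

lemma F_scale: "0 \<le> t \<Longrightarrow> t \<le> 1 \<Longrightarrow> F (t * s) \<le> t * F s"
  using F_convex[of t 0 s] by (simp add: F_0)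

lemma F_scale_le: "0 \<le> t \<Longrightarrow> t \<le> 1 \<Longrightarrow> F (t * s) \<le> F s"
  using F_scale[of t s] mult_left_le_one_le[OF F_nonneg, of t s] by linarith

lemma f_sgn: "s > 0 \<Longrightarrow> f s > 0" "s < 0 \<Longrightarrow> f s < 0"
  using f_mono f_0 strict_mono_less[of f] by metis+

lemma f_abs_mono:
  assumes "0 \<le> t" "t \<le> T"
  shows "\<bar>f (t * s)\<bar> \<le> \<bar>f (T * s)\<bar>"
proof (cases "s \<ge> 0")
  case True
  then have "0 \<le> t * s" "t * s \<le> T * s" using assms by (auto intro: mult_right_mono)
  then have "f 0 \<le> f (t * s)" "f (t * s) \<le> f (T * s)" using f_mono by (simp_all add: strict_mono_less_eq)
  then show ?thesis using f_0 by simp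
next
  case False
  then have "t * s \<le> 0" "T * s \<le> t * s" using assms by (auto intro: mult_right_mono_neg mult_nonneg_nonpos)
  then have "f (t * s) \<le> f 0" "f (T * s) \<le> f (t * s)" using f_mono by (simp_all add: strict_mono_less_eq)
  then show ?thesis using f_0 by simp
qed

text \<open>The sum of the tangent inequalities at \<open>s\<close> in the directions
  \<open>w\<close> and \<open>- w\<close> shows that \<open>f u * w\<close> is integrable as soon as
  \<open>F\<close> is integrable on sums and differences, without a dual exponent.\<close>

lemma f_mult_le: "\<bar>f s * w\<bar> \<le> F (s + w) + F (s - w)"
  using F_tangent[of s "s + w"] F_tangent[of s "s - w"] F_nonneg[of s] F_nonneg[of "s + w"] F_nonneg[of "s - w"] by auto

section \<open>Growth estimates for \<open>F\<close>\<close>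

lemma F_growth: "F s \<le> c1 * \<bar>s\<bar> + c2 * \<bar>s\<bar> powr p"
proof (cases "s = 0")
  case False
  have "F s \<le> \<bar>f s\<bar> * \<bar>s\<bar>" using F_le[of s] abs_ge_self[of "f s * s"] by (simp add: abs_mult)
  also have "\<dots> \<le> (c1 + c2 * \<bar>s\<bar> powr (p - 1)) * \<bar>s\<bar>" by (intro mult_right_mono growth) auto
  also have "\<dots> = c1 * \<bar>s\<bar> + c2 * (\<bar>s\<bar> powr (p - 1) * \<bar>s\<bar> powr 1)" using False by (simp add: algebra_simps)
  also have "\<bar>s\<bar> powr (p - 1) * \<bar>s\<bar> powr 1 = \<bar>s\<bar> powr p" by (simp only: powr_add[symmetric]) simp
  finally show ?thesis .
qed (simp add: F_0)

lemma F_near_0: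
  assumes "\<eta> > 0"
  obtains m where "m > 0" "\<And>s. \<bar>s\<bar> \<le> m \<Longrightarrow> F s \<le> \<eta> * \<bar>s\<bar>"
proof -
  have "isCont f 0" using cont continuous_on_eq_continuous_at[of UNIV f] by simp
  then obtain m where m: "m > 0" "\<And>s. \<bar>s\<bar> < m \<Longrightarrow> \<bar>f s\<bar> < \<eta>"
    using assms f_0 unfolding continuous_at_eps_delta by (auto simp: dist_real_def)
  have "F s \<le> \<eta> * \<bar>s\<bar>" if "\<bar>s\<bar> \<le> m / 2" for s
  proof -
    have "F s \<le> \<bar>f s\<bar> * \<bar>s\<bar>" using F_le[of s] abs_ge_self[of "f s * s"] by (simp add: abs_mult)
    also have "\<dots> \<le> \<eta> * \<bar>s\<bar>" using m(2)[of s] m(1) that by (intro mult_right_mono) auto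
    finally show ?thesis .
  qed
  then show thesis using that[of "m/2"] m(1) by simp
qed

text \<open>Both exponents of \<open>m\<close> are negative. \<open>F_bound\<close> uses the
  constant at a fixed \<open>m\<close>, whereas \<open>F_tail\<close> makes it small by taking
  \<open>m\<close> large.\<close>

lemma F_far:
  assumes "m > 0" "\<bar>s\<bar> \<ge> m"
  shows "F s \<le> (c1 * m powr (1 - q) + c2 * m powr (p - q)) * \<bar>s\<bar> powr q"
proof -
  have "\<bar>s\<bar> powr 1 \<le> m powr (1 - q) * \<bar>s\<bar> powr q" "\<bar>s\<bar> powr p \<le> m powr (p - q) * \<bar>s\<bar> powr q"
    using p by (intro powr_le_of_ge[OF assms], simp)+
  then have "c1 * \<bar>s\<bar> powr 1 \<le> c1 * (m powr (1 - q) * \<bar>s\<bar> powr q)" "c2 * \<bar>s\<bar> powr p \<le> c2 * (m powr (p - q) * \<bar>s\<bar> powr q)"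
    using c by (intro mult_left_mono, simp, simp)+
  then show ?thesis using F_growth[of s] by (simp add: algebra_simps)
qed

lemma F_bound:
  assumes "\<eta> > 0"
  obtains C where "C > 0" "\<And>s. F s \<le> \<eta> * \<bar>s\<bar> + C * \<bar>s\<bar> powr q"
proof -
  obtain m where m: "m > 0" "\<And>s. \<bar>s\<bar> \<le> m \<Longrightarrow> F s \<le> \<eta> * \<bar>s\<bar>" by (rule F_near_0[OF assms]) blast
  define C where "C = c1 * m powr (1 - q) + c2 * m powr (p - q)"
  have C: "C > 0" unfolding C_def using c m(1) by (intro add_pos_pos mult_pos_pos) auto
  have "F s \<le> \<eta> * \<bar>s\<bar> + C * \<bar>s\<bar> powr q" for s
  proof (cases "\<bar>s\<bar> \<le> m")
    case True
    have "C * \<bar>s\<bar> powr q \<ge> 0" using C by simp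
    then show ?thesis using m(2)[OF True] by linarith
  next
    case False
    have "\<eta> * \<bar>s\<bar> \<ge> 0" using assms by simp
    moreover have "F s \<le> C * \<bar>s\<bar> powr q" unfolding C_def by (rule F_far[OF m(1)]) (use False in simp)
    ultimately show ?thesis by linarith
  qed
  then show thesis using that C by blast
qed

lemma F_tail:
  assumes "\<eta> > 0"
  obtains M where "M > 0" "\<And>s. \<bar>s\<bar> \<ge> M \<Longrightarrow> F s \<le> \<eta> * \<bar>s\<bar> powr q"
proof -
  have "((\<lambda>m. c1 * m powr (1 - q) + c2 * m powr (p - q)) \<longlongrightarrow> c1 * 0 + c2 * 0) at_top"
    using p by (intro tendsto_intros tendsto_neg_powr filterlim_ident) auto
  then have "\<forall>\<^sub>F m in at_top. c1 * m powr (1 - q) + c2 * m powr (p - q) < \<eta>"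
    using assms by (intro order_tendstoD(2)) auto
  then have "\<forall>\<^sub>F m in at_top. c1 * m powr (1 - q) + c2 * m powr (p - q) < \<eta> \<and> m > 0"
    using eventually_gt_at_top[of 0] by eventually_elim simp
  then obtain M where M: "c1 * M powr (1 - q) + c2 * M powr (p - q) < \<eta>" "M > 0"
    unfolding eventually_at_top_linorder by blast
  have "F s \<le> \<eta> * \<bar>s\<bar> powr q" if "\<bar>s\<bar> \<ge> M" for s
  proof -
    have "(c1 * M powr (1 - q) + c2 * M powr (p - q)) * \<bar>s\<bar> powr q \<le> \<eta> * \<bar>s\<bar> powr q"
      using M(1) by (intro mult_right_mono) auto
    then show ?thesis using F_far[OF M(2) that] by linarith
  qed
  then show thesis using that M(2) by blast
qed

text \<open>Both arguments are clipped to [-M, M], where \<open>F\<close> is Lipschitz; clipping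
  changes \<open>F\<close> by at most its own value beyond \<open>M\<close>, which is small against
  |s|^q. This is how L^1 convergence with an L^q bound controls integrals of
  \<open>F\<close>.\<close>

lemma F_diff_bound:
  assumes "\<eta> > 0"
  obtains L where "L > 0" "\<And>a b. \<bar>F a - F b\<bar> \<le> L * \<bar>a - b\<bar> + \<eta> * (\<bar>a\<bar> powr q + \<bar>b\<bar> powr q)"
proof -
  obtain M where M: "M > 0" "\<And>s. \<bar>s\<bar> \<ge> M \<Longrightarrow> F s \<le> \<eta> * \<bar>s\<bar> powr q" by (rule F_tail[OF assms]) blast
  define L where "L = \<bar>f M\<bar> + \<bar>f (- M)\<bar> + 1"
  define k where "k s = max (- M) (min M s)" for s
  have k: "k s \<in> {-M..M}" for s using M(1) by (auto simp: k_def)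
  have fL: "\<bar>f s\<bar> \<le> L" if "s \<in> {-M..M}" for s
  proof -
    have "f (- M) \<le> f s" "f s \<le> f M" using that f_mono by (simp_all add: strict_mono_less_eq)
    then show ?thesis unfolding L_def by linarith
  qed
  have 1: "\<bar>F (k a) - F (k b)\<bar> \<le> L * \<bar>a - b\<bar>" for a b
  proof -
    have "norm (F (k a) - F (k b)) \<le> L * norm (k a - k b)"
    proof (rule field_differentiable_bound[of "{-M..M}" F f L])
      show "(F has_field_derivative f z) (at z within {- M..M})" for z
        using F_deriv has_field_derivative_at_within by blast
    qed (use fL k in auto)
    also have "\<dots> \<le> L * \<bar>a - b\<bar>"
      by (intro mult_left_mono) (auto simp: k_def L_def)
    finally show ?thesis by simp
  qed
  have 2: "\<bar>F a - F (k a)\<bar> \<le> \<eta> * \<bar>a\<bar> powr q" for a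
  proof (cases "\<bar>a\<bar> \<le> M")
    case True
    then have "k a = a" by (auto simp: k_def)
    then show ?thesis using assms by simp
  next
    case False
    then have a0: "a \<noteq> 0" using M(1) by auto
    \<comment> \<open>Clipping a large number is scaling it by a factor below 1, and
      \<open>F\<close> does not increase towards 0 along a ray.\<close>
    have "k a = (M / \<bar>a\<bar>) * a"
      using False a0 M(1) by (cases "a > 0") (auto simp: k_def min_def max_def)
    moreover have "F ((M / \<bar>a\<bar>) * a) \<le> F a" by (rule F_scale_le) (use False M(1) in auto)
    ultimately have "F (k a) \<le> F a" by simp
    then show ?thesis using F_nonneg[of "k a"] M(2)[of a] False by simp
  qed
  have "\<bar>F a - F b\<bar> \<le> L * \<bar>a - b\<bar> + \<eta> * (\<bar>a\<bar> powr q + \<bar>b\<bar> powr q)" for a b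
    using 1[of a b] 2[of a] 2[of b] unfolding distrib_left by linarith
  moreover have "L > 0" unfolding L_def by simp
  ultimately show thesis using that by blast
qed

text \<open>The quotient of \<open>F (x * s)\<close> by \<open>x powr \<theta>\<close> has a
  derivative whose sign is that of \<open>f y * y - \<theta> * F y\<close> at
  \<open>y = x * s\<close>, so it is nondecreasing in \<open>x\<close>.\<close>

lemma F_power_growth:
  assumes "t \<ge> 1"
  shows "t powr \<theta> * F s \<le> F (t * s)"
proof (cases "s = 0")
  case False
  have "F (1 * s) * 1 powr (- \<theta>) \<le> F (t * s) * t powr (- \<theta>)"
  proof (rule DERIV_nonneg_imp_nondecreasing[OF assms])
    fix x :: real assume x: "1 \<le> x" "x \<le> t"
    have d: "((\<lambda>x. F (x * s) * x powr (- \<theta>)) has_real_derivative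
        (f (x * s) * s) * x powr (- \<theta>) + (- \<theta> * x powr (- \<theta> - 1)) * F (x * s)) (at x)"
    proof (rule DERIV_mult)
      show "((\<lambda>x. F (x * s)) has_real_derivative f (x * s) * s) (at x)"
        by (rule DERIV_chain2[OF F_deriv]) (auto intro!: derivative_eq_intros)
      show "((\<lambda>x. x powr (- \<theta>)) has_real_derivative - \<theta> * x powr (- \<theta> - 1)) (at x)"
        using x by (intro has_real_derivative_powr) auto
    qed
    have "x powr (- \<theta>) = x powr (- \<theta> - 1) * x"
      using x powr_add[of x "- \<theta> - 1" 1] by simp
    then have "(f (x * s) * s) * x powr (- \<theta>) + (- \<theta> * x powr (- \<theta> - 1)) * F (x * s)
       = x powr (- \<theta> - 1) * (f (x * s) * (x * s) - \<theta> * F (x * s))"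
      by (simp add: algebra_simps)
    also have "\<dots> \<ge> 0"
      using superlinear[of "x * s"] False x by (intro mult_nonneg_nonneg) auto
    finally show "\<exists>y. ((\<lambda>x. F (x * s) * x powr (- \<theta>)) has_real_derivative y) (at x) \<and> 0 \<le> y"
      using d by blast
  qed
  then have "F s \<le> F (t * s) / t powr \<theta>" by (simp add: powr_minus divide_inverse)
  then show ?thesis using assms by (simp add: pos_le_divide_eq mult.commute)
qed (simp add: F_0)

end

section \<open>The energy along rays\<close>

locale variational = nonlinearity f c1 c2 p q \<theta> for f and c1 c2 p q \<theta> :: real +
  fixes \<epsilon> V0 V1 :: real and dim :: "'n::finite itself"
  assumes N2: "CARD('n) \<ge> 2" and q_sub: "q < real CARD('n) / (real CARD('n) - 1)"
    and eps: "\<epsilon> > 0" and V0: "V0 > 0" "V0 \<le> V1"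
begin

text \<open>The class contains all translates of the potential and the constant \<open>V1\<close>;
  its two-sided bounds make every estimate uniform over the potentials that occur in limits.\<close>

definition weight :: "(real^'n \<Rightarrow> real) \<Rightarrow> bool" where
  "weight W \<longleftrightarrow> W \<in> borel_measurable lebesgue \<and> (\<forall>x. V0 \<le> W x \<and> W x \<le> V1)"

definition \<Phi> :: "(real^'n \<Rightarrow> real) \<Rightarrow> real" where
  "\<Phi> u = (\<integral>x. F (u x) \<partial>lebesgue)"

text \<open>For t \<ge> 0 this is the value of the functional at \<open>t u\<close>, with
  homogeneity of the norm already used, so that its concavity in \<open>t\<close> is
  visible.\<close>

definition energy :: "(real^'n \<Rightarrow> real) \<Rightarrow> real \<Rightarrow> (real^'n \<Rightarrow> real) \<Rightarrow> real" where
  "energy W t u = t * star_norm \<epsilon> W u - \<Phi> (\<lambda>x. t * u x)"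

section \<open>Weighted norms\<close>

lemma weight_bounds:
  assumes "weight W"
  shows "V0 \<le> W x" "W x \<le> V1" "0 < W x" "\<bar>W x\<bar> \<le> V1" "W \<in> borel_measurable lebesgue"
proof -
  show 1: "V0 \<le> W x" "W x \<le> V1" "W \<in> borel_measurable lebesgue" using assms unfolding weight_def by auto
  show 2: "0 < W x" using 1(1) V0 by linarith
  show "\<bar>W x\<bar> \<le> V1" using 1(2) 2 by simp
qed

lemma weight_integrable:
  assumes "weight W" "integrable lebesgue u"
  shows "integrable lebesgue (\<lambda>x. W x * \<bar>u x\<bar>)"
  using integrable_bounded_mult[OF integrable_abs[OF assms(2)] weight_bounds(5)[OF assms(1)] weight_bounds(4)[OF assms(1)]]
  by (simp add: mult.commute)

lemma star_norm_eq: "star_norm \<epsilon> W u = \<epsilon> * tv u + (\<integral>x. W x * \<bar>u x\<bar> \<partial>lebesgue)"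
  by (simp add: star_norm_def tv_def)

lemma star_norm_scale:
  assumes "u \<in> BV" "t \<ge> 0"
  shows "star_norm \<epsilon> W (\<lambda>x. t * u x) = t * star_norm \<epsilon> W u"
proof -
  have "(\<integral>x. W x * \<bar>t * u x\<bar> \<partial>lebesgue) = t * (\<integral>x. W x * \<bar>u x\<bar> \<partial>lebesgue)"
    using assms(2) by (simp add: abs_mult mult.left_commute[of _ t])
  then show ?thesis unfolding star_norm_eq BV_scale(2)[OF assms] by (simp add: algebra_simps)
qed

lemma star_norm_add:
  assumes "weight W" "u \<in> BV" "v \<in> BV"
  shows "star_norm \<epsilon> W (\<lambda>x. u x + v x) \<le> star_norm \<epsilon> W u + star_norm \<epsilon> W v"
proof -
  note i = weight_integrable[OF assms(1) BV_integrable]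
  have "(\<integral>x. W x * \<bar>u x + v x\<bar> \<partial>lebesgue) \<le> (\<integral>x. W x * \<bar>u x\<bar> + W x * \<bar>v x\<bar> \<partial>lebesgue)"
  proof (rule integral_mono[OF i[OF BV_add(1)[OF assms(2,3)]] Bochner_Integration.integrable_add[OF i[OF assms(2)] i[OF assms(3)]]])
    show "W x * \<bar>u x + v x\<bar> \<le> W x * \<bar>u x\<bar> + W x * \<bar>v x\<bar>" for x
      using weight_bounds(3)[OF assms(1), of x] by (simp flip: distrib_left)
  qed
  also have "\<dots> = (\<integral>x. W x * \<bar>u x\<bar> \<partial>lebesgue) + (\<integral>x. W x * \<bar>v x\<bar> \<partial>lebesgue)"
    by (rule Bochner_Integration.integral_add[OF i[OF assms(2)] i[OF assms(3)]])
  moreover have "\<epsilon> * tv (\<lambda>x. u x + v x) \<le> \<epsilon> * tv u + \<epsilon> * tv v"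
    using mult_left_mono[OF BV_add(2)[OF assms(2,3)], of \<epsilon>] eps by (simp add: distrib_left)
  ultimately show ?thesis unfolding star_norm_eq by linarith
qed

lemma star_norm_bounds:
  assumes "weight W" "u \<in> BV"
  shows "V0 * (\<integral>x. \<bar>u x\<bar> \<partial>lebesgue) \<le> star_norm \<epsilon> W u" "\<epsilon> * tv u \<le> star_norm \<epsilon> W u" "0 \<le> star_norm \<epsilon> W u"
proof -
  have "(\<integral>x. V0 * \<bar>u x\<bar> \<partial>lebesgue) \<le> (\<integral>x. W x * \<bar>u x\<bar> \<partial>lebesgue)"
    using weight_bounds(1)[OF assms(1)] BV_integrable[OF assms(2)]
    by (intro integral_mono weight_integrable[OF assms(1)]) (auto intro: mult_right_mono)
  moreover have "\<epsilon> * tv u \<ge> 0" using eps tv_nonneg[of u] by simp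
  moreover have "(\<integral>x. W x * \<bar>u x\<bar> \<partial>lebesgue) \<ge> 0"
    using weight_bounds(3)[OF assms(1)] by (intro integral_nonneg_AE AE_I2) (simp add: less_imp_le)
  ultimately show "V0 * (\<integral>x. \<bar>u x\<bar> \<partial>lebesgue) \<le> star_norm \<epsilon> W u" "\<epsilon> * tv u \<le> star_norm \<epsilon> W u" "0 \<le> star_norm \<epsilon> W u"
    unfolding star_norm_eq by auto
qed

lemma star_norm_pos:
  assumes "weight W" "u \<in> BV" "\<not> (AE x in lebesgue. u x = 0)"
  shows "0 < star_norm \<epsilon> W u"
proof (rule ccontr)
  assume "\<not> ?thesis"
  then have "V0 * (\<integral>x. \<bar>u x\<bar> \<partial>lebesgue) \<le> 0" using star_norm_bounds[OF assms(1,2)] by linarith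
  then have "(\<integral>x. \<bar>u x\<bar> \<partial>lebesgue) \<le> 0" using V0 by (simp add: mult_le_0_iff)
  moreover have "(\<integral>x. \<bar>u x\<bar> \<partial>lebesgue) \<ge> 0" by simp
  ultimately have "(\<integral>x. \<bar>u x\<bar> \<partial>lebesgue) = 0" by linarith
  then have "AE x in lebesgue. \<bar>u x\<bar> = 0"
    using BV_integrable[OF assms(2)] by (subst (asm) integral_nonneg_eq_0_iff_AE) auto
  then show False using assms(3) by simp
qed

lemma star_norm_mono:
  assumes "weight W" "weight W'" "u \<in> BV" "\<And>x. W x \<le> W' x"
  shows "star_norm \<epsilon> W u \<le> star_norm \<epsilon> W' u"
  unfolding star_norm_eq using assms BV_integrable[OF assms(3)]
  by (auto intro!: integral_mono weight_integrable mult_right_mono)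

lemma weight_translation:
  "weight W \<Longrightarrow> weight (\<lambda>x. W (x + a))"
  unfolding weight_def using measurable_lebesgue_translation by auto

lemma star_norm_translation:
  assumes "weight W" "u \<in> BV"
  shows "star_norm \<epsilon> (\<lambda>x. W (x + a)) (\<lambda>x. u (x + a)) = star_norm \<epsilon> W u"
  unfolding star_norm_eq BV_translation(2)[OF assms(2)]
  using integral_lebesgue_translation[where g="\<lambda>x. W x * \<bar>u x\<bar>" and a=a]
    borel_measurable_integrable[OF weight_integrable[OF assms(1) BV_integrable[OF assms(2)]]] by simp

text \<open>The weighted mass splits exactly because the two factors are nonnegative with sum 1;
  only the variation pays for the cut.\<close>

lemma star_norm_cutoff:
  assumes "weight W" "u \<in> BV" "R > 0"
  shows "star_norm \<epsilon> W (\<lambda>x. cutoff R x * u x) + star_norm \<epsilon> W (\<lambda>x. (1 - cutoff R x) * u x)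
    \<le> star_norm \<epsilon> W u + \<epsilon> * (8 / R * (\<integral>x. \<bar>u x\<bar> \<partial>lebesgue))"
proof -
  note i = weight_integrable[OF assms(1) BV_integrable]
  have "(\<integral>x. W x * \<bar>cutoff R x * u x\<bar> \<partial>lebesgue) + (\<integral>x. W x * \<bar>(1 - cutoff R x) * u x\<bar> \<partial>lebesgue)
    = (\<integral>x. W x * \<bar>cutoff R x * u x\<bar> + W x * \<bar>(1 - cutoff R x) * u x\<bar> \<partial>lebesgue)"
    using i[OF BV_cutoff(1)[OF assms(2,3)]] i[OF BV_cutoff(2)[OF assms(2,3)]]
    by (rule Bochner_Integration.integral_add[symmetric])
  also have "\<dots> = (\<integral>x. W x * \<bar>u x\<bar> \<partial>lebesgue)"
  proof (rule Bochner_Integration.integral_cong[OF refl])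
    fix x
    have "\<bar>cutoff R x * u x\<bar> + \<bar>(1 - cutoff R x) * u x\<bar> = \<bar>u x\<bar>"
      using cutoff_bounds[of R x] by (simp add: abs_mult flip: distrib_right)
    then show "W x * \<bar>cutoff R x * u x\<bar> + W x * \<bar>(1 - cutoff R x) * u x\<bar> = W x * \<bar>u x\<bar>"
      by (simp flip: distrib_left)
  qed
  finally have 1: "(\<integral>x. W x * \<bar>cutoff R x * u x\<bar> \<partial>lebesgue) + (\<integral>x. W x * \<bar>(1 - cutoff R x) * u x\<bar> \<partial>lebesgue)
    = (\<integral>x. W x * \<bar>u x\<bar> \<partial>lebesgue)" .
  have "\<epsilon> * (tv (\<lambda>x. cutoff R x * u x) + tv (\<lambda>x. (1 - cutoff R x) * u x)) \<le> \<epsilon> * (tv u + 8 / R * (\<integral>x. \<bar>u x\<bar> \<partial>lebesgue))"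
    using BV_cutoff(3)[OF assms(2,3)] eps by (intro mult_left_mono) auto
  then show ?thesis using 1 unfolding star_norm_eq distrib_left by linarith
qed

text \<open>Lower semicontinuity with a moving weight. The variation is bounded below by one nearly
  optimal field for \<open>b\<close>; in the weighted term \<open>a n\<close> is replaced by
  \<open>b\<close> at the cost of V1 times their L^1 distance, after which dominated convergence
  treats the weights.\<close>

lemma star_norm_lsc:
  fixes a :: "nat \<Rightarrow> real^'n \<Rightarrow> real"
  assumes W: "\<And>n. weight (W n)" "weight W'" "\<And>x. (\<lambda>n. W n x) \<longlonglongrightarrow> W' x"
    and a: "\<And>n. a n \<in> BV" "b \<in> BV" and lim: "(\<lambda>n. \<integral>x. \<bar>a n x - b x\<bar> \<partial>lebesgue) \<longlonglongrightarrow> 0" and \<eta>: "\<eta> > 0"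
  shows "\<forall>\<^sub>F n in sequentially. star_norm \<epsilon> (W n) (a n) \<ge> star_norm \<epsilon> W' b - \<eta>"
proof -
  have ia: "integrable lebesgue (a n)" "integrable lebesgue b" for n using a BV_integrable by auto
  have loc: "L1loc_lim a b"
    unfolding L1loc_lim_def
  proof
    fix R
    show "(\<lambda>n. \<integral>x. indicator (ball 0 R) x * \<bar>a n x - b x\<bar> \<partial>lebesgue) \<longlonglongrightarrow> 0"
    proof (rule tendsto_sandwich[OF _ _ tendsto_const lim])
      show "\<forall>\<^sub>F n in sequentially. 0 \<le> (\<integral>x. indicator (ball 0 R) x * \<bar>a n x - b x\<bar> \<partial>lebesgue)"
        by (intro always_eventually allI integral_nonneg_AE) auto
      show "\<forall>\<^sub>F n in sequentially. (\<integral>x. indicator (ball 0 R) x * \<bar>a n x - b x\<bar> \<partial>lebesgue) \<le> (\<integral>x. \<bar>a n x - b x\<bar> \<partial>lebesgue)"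
        using ia by (intro always_eventually allI integral_mono integrable_indicator_mult integrable_abs Bochner_Integration.integrable_diff)
          (auto simp: indicator_def)
    qed
  qed
  obtain \<phi> where \<phi>: "C1c_field \<phi>" "\<And>x. norm (\<phi> x) \<le> 1" "(\<integral>x. b x * divergence \<phi> x \<partial>lebesgue) > tv b - \<eta> / (4 * \<epsilon>)"
    using \<eta> eps by (rule_tac tv_approx[OF a(2), of "\<eta> / (4 * \<epsilon>)"]) auto
  have d: "(\<lambda>n. \<integral>x. a n x * divergence \<phi> x \<partial>lebesgue) \<longlonglongrightarrow> (\<integral>x. b x * divergence \<phi> x \<partial>lebesgue)"
    by (rule L1loc_divergence_tendsto[OF ia loc \<phi>(1)])
  have "(\<lambda>n. \<integral>x. W n x * \<bar>b x\<bar> \<partial>lebesgue) \<longlonglongrightarrow> (\<integral>x. W' x * \<bar>b x\<bar> \<partial>lebesgue)"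
  proof (rule integral_dominated_convergence[where w="\<lambda>x. V1 * \<bar>b x\<bar>"])
    show "AE x in lebesgue. (\<lambda>n. W n x * \<bar>b x\<bar>) \<longlonglongrightarrow> W' x * \<bar>b x\<bar>"
      by (intro AE_I2 tendsto_intros W)
    show "AE x in lebesgue. norm (W n x * \<bar>b x\<bar>) \<le> V1 * \<bar>b x\<bar>" for n
      using weight_bounds(4)[OF W(1)] by (intro AE_I2) (auto simp: abs_mult intro: mult_right_mono)
  qed (use weight_integrable[OF W(1) ia(2)] weight_integrable[OF W(2) ia(2)] ia in auto)
  then have v: "(\<lambda>n. (\<integral>x. W n x * \<bar>b x\<bar> \<partial>lebesgue) - V1 * (\<integral>x. \<bar>a n x - b x\<bar> \<partial>lebesgue)) \<longlonglongrightarrow> (\<integral>x. W' x * \<bar>b x\<bar> \<partial>lebesgue) - V1 * 0"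
    by (intro tendsto_diff tendsto_mult_left lim)
  have e1: "\<forall>\<^sub>F n in sequentially. (\<integral>x. a n x * divergence \<phi> x \<partial>lebesgue) > tv b - \<eta> / (4 * \<epsilon>)"
    by (rule order_tendstoD(1)[OF d \<phi>(3)])
  have e2: "\<forall>\<^sub>F n in sequentially. (\<integral>x. W n x * \<bar>b x\<bar> \<partial>lebesgue) - V1 * (\<integral>x. \<bar>a n x - b x\<bar> \<partial>lebesgue) > (\<integral>x. W' x * \<bar>b x\<bar> \<partial>lebesgue) - \<eta> / 2"
    by (rule order_tendstoD(1)[OF v]) (use \<eta> in simp)
  show ?thesis
    using e1 e2
  proof eventually_elim
    case (elim n)
    have "(\<integral>x. W n x * \<bar>b x\<bar> \<partial>lebesgue) - V1 * (\<integral>x. \<bar>a n x - b x\<bar> \<partial>lebesgue) = (\<integral>x. W n x * \<bar>b x\<bar> - V1 * \<bar>a n x - b x\<bar> \<partial>lebesgue)"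
      using weight_integrable[OF W(1)[of n] ia(2)] ia by simp
    also have "\<dots> \<le> (\<integral>x. W n x * \<bar>a n x\<bar> \<partial>lebesgue)"
    proof (rule integral_mono)
      show "integrable lebesgue (\<lambda>x. W n x * \<bar>b x\<bar> - V1 * \<bar>a n x - b x\<bar>)"
        using weight_integrable[OF W(1)[of n] ia(2)] ia by simp
      show "integrable lebesgue (\<lambda>x. W n x * \<bar>a n x\<bar>)" by (rule weight_integrable[OF W(1) ia(1)])
      fix x
      have "W n x * \<bar>b x\<bar> - W n x * \<bar>a n x\<bar> \<le> W n x * \<bar>a n x - b x\<bar>"
        using weight_bounds(3)[OF W(1), of n x] by (simp add: right_diff_distrib[symmetric])
      also have "\<dots> \<le> V1 * \<bar>a n x - b x\<bar>"
        using weight_bounds(2)[OF W(1), of n x] by (intro mult_right_mono) auto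
      finally show "W n x * \<bar>b x\<bar> - V1 * \<bar>a n x - b x\<bar> \<le> W n x * \<bar>a n x\<bar>" by linarith
    qed
    finally have 1: "(\<integral>x. W n x * \<bar>a n x\<bar> \<partial>lebesgue) \<ge> (\<integral>x. W' x * \<bar>b x\<bar> \<partial>lebesgue) - \<eta> / 2" using elim by linarith
    have "tv (a n) \<ge> tv b - \<eta> / (4 * \<epsilon>)" using tv_upper[OF a(1)[of n] \<phi>(1,2)] elim by linarith
    then have "\<epsilon> * tv (a n) \<ge> \<epsilon> * (tv b - \<eta> / (4 * \<epsilon>))" using eps by (intro mult_left_mono) auto
    also have "\<epsilon> * (tv b - \<eta> / (4 * \<epsilon>)) = \<epsilon> * tv b - \<eta> / 4" using eps by (simp add: right_diff_distrib)
    finally show ?case using 1 \<eta> unfolding star_norm_eq by linarith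
  qed
qed

section \<open>The nonlinear term on \<open>BV\<close>\<close>

lemma q_ge_1: "q \<ge> 1" "q > 1"
  using p by auto

lemma Lq_bound:
  obtains C where "C > 0" "\<And>u :: real^'n \<Rightarrow> real. u \<in> BV \<Longrightarrow> (\<integral>x. \<bar>u x\<bar> \<partial>lebesgue) \<le> K \<Longrightarrow> tv u \<le> K \<Longrightarrow>
     integrable lebesgue (\<lambda>x. \<bar>u x\<bar> powr q) \<and> (\<integral>x. \<bar>u x\<bar> powr q \<partial>lebesgue) \<le> C"
  by (rule BV_Lq_bound[OF N2 q_ge_1(1) q_sub, of K]) blast

lemma integrable_Lq:
  fixes u :: "real^'n \<Rightarrow> real"
  assumes "u \<in> BV"
  shows "integrable lebesgue (\<lambda>x. \<bar>u x\<bar> powr q)"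
proof -
  obtain C where "\<And>u :: real^'n \<Rightarrow> real. u \<in> BV \<Longrightarrow> (\<integral>x. \<bar>u x\<bar> \<partial>lebesgue) \<le> max (\<integral>x. \<bar>u x\<bar> \<partial>lebesgue) (tv u) \<Longrightarrow>
     tv u \<le> max (\<integral>x. \<bar>u x\<bar> \<partial>lebesgue) (tv u) \<Longrightarrow> integrable lebesgue (\<lambda>x. \<bar>u x\<bar> powr q)"
    using Lq_bound by (metis max.cobounded1 max.cobounded2)
  then show ?thesis using assms by simp
qed

lemma F_integrable:
  fixes u :: "real^'n \<Rightarrow> real"
  assumes "u \<in> BV"
  shows "integrable lebesgue (\<lambda>x. F (u x))"
proof -
  have [measurable]: "u \<in> borel_measurable lebesgue" using BV_integrable[OF assms] by auto
  obtain C where C: "C > 0" "\<And>s. F s \<le> 1 * \<bar>s\<bar> + C * \<bar>s\<bar> powr q" by (rule F_bound[of 1]) auto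
  show ?thesis
  proof (rule Bochner_Integration.integrable_bound)
    show "integrable lebesgue (\<lambda>x. 1 * \<bar>u x\<bar> + C * \<bar>u x\<bar> powr q)"
      using BV_integrable[OF assms] integrable_Lq[OF assms] by simp
    show "AE x in lebesgue. norm (F (u x)) \<le> norm (1 * \<bar>u x\<bar> + C * \<bar>u x\<bar> powr q)"
    proof (intro AE_I2)
      fix x show "norm (F (u x)) \<le> norm (1 * \<bar>u x\<bar> + C * \<bar>u x\<bar> powr q)"
        using C(2)[of "u x"] F_nonneg[of "u x"] by simp
    qed
  qed measurable
qed

lemma BV_scaled [simp]: "u \<in> BV \<Longrightarrow> t \<ge> 0 \<Longrightarrow> (\<lambda>x. t * u x) \<in> BV"
  by (rule BV_scale(1))

lemma \<Phi>_nonneg: "\<Phi> u \<ge> 0"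
  unfolding \<Phi>_def using F_nonneg by (intro integral_nonneg_AE) auto

lemma \<Phi>_mono:
  assumes "u \<in> BV" "v \<in> BV" "\<And>x. F (u x) \<le> F (v x)"
  shows "\<Phi> u \<le> \<Phi> v"
  unfolding \<Phi>_def by (intro integral_mono F_integrable assms)

lemma \<Phi>_scale:
  assumes "u \<in> BV" "0 \<le> s" "s \<le> t" "t > 0"
  shows "\<Phi> (\<lambda>x. s * u x) \<le> (s / t) * \<Phi> (\<lambda>x. t * u x)"
proof -
  have "\<Phi> (\<lambda>x. s * u x) \<le> (\<integral>x. (s / t) * F (t * u x) \<partial>lebesgue)"
    unfolding \<Phi>_def
  proof (rule integral_mono)
    show "F (s * u x) \<le> s / t * F (t * u x)" for x
      using F_scale[of "s / t" "t * u x"] assms by simp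
  qed (use assms F_integrable[OF BV_scaled] in auto)
  then show ?thesis unfolding \<Phi>_def by simp
qed

text \<open>A concave function vanishing at 0 lies above its chord from the origin.\<close>

lemma energy_ray:
  assumes "u \<in> BV" "0 \<le> s" "s \<le> t" "t > 0"
  shows "energy W s u \<ge> (s / t) * energy W t u"
  using \<Phi>_scale[OF assms] assms(4) unfolding energy_def by (simp add: right_diff_distrib)

lemma \<Phi>_pos:
  assumes "u \<in> BV" "\<not> (AE x in lebesgue. u x = 0)"
  shows "\<Phi> u > 0"
proof (rule ccontr)
  assume "\<not> ?thesis"
  then have "\<Phi> u = 0" using \<Phi>_nonneg[of u] by linarith
  then have "AE x in lebesgue. F (u x) = 0"
    unfolding \<Phi>_def using F_integrable[OF assms(1)] F_nonneg by (subst (asm) integral_nonneg_eq_0_iff_AE) auto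
  then have "AE x in lebesgue. u x = 0"
  proof eventually_elim
    case (elim x)
    have "F s \<noteq> 0" if "s \<noteq> 0" for s using superlinear[OF that] by auto
    then show ?case using elim by blast
  qed
  then show False using assms(2) by simp
qed

lemma \<Phi>_translation:
  assumes "u \<in> BV"
  shows "\<Phi> (\<lambda>x. u (x + a)) = \<Phi> u"
  unfolding \<Phi>_def
  using integral_lebesgue_translation[where g="\<lambda>x. F (u x)" and a=a] borel_measurable_integrable[OF F_integrable[OF assms]] by simp

lemma energy_translation:
  assumes "weight W" "u \<in> BV" "t \<ge> 0"
  shows "energy (\<lambda>x. W (x + a)) t (\<lambda>x. u (x + a)) = energy W t u"
  unfolding energy_def star_norm_translation[OF assms(1,2)]
  using \<Phi>_translation[OF BV_scaled[OF assms(2,3)], of a] by simp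

lemma energy_rescale:
  assumes "u \<in> BV" "r \<ge> 0"
  shows "energy W t (\<lambda>x. r * u x) = energy W (t * r) u"
  unfolding energy_def star_norm_scale[OF assms] by (simp add: mult_ac)

text \<open>Convergence in L^1 on \<open>A\<close> need not be upgraded to L^q: by
  \<open>F_diff_bound\<close> it controls the difference of the integrals up to a small multiple of
  the uniform L^q bounds.\<close>

lemma local_\<Phi>_tendsto:
  fixes w :: "nat \<Rightarrow> real^'n \<Rightarrow> real"
  assumes w: "\<And>n. w n \<in> BV" "\<And>n. (\<integral>x. \<bar>w n x\<bar> \<partial>lebesgue) \<le> K" "\<And>n. tv (w n) \<le> K" and v: "v \<in> BV"
    and A: "A \<in> sets lebesgue"
    and lim: "(\<lambda>n. \<integral>x. indicator A x * \<bar>w n x - v x\<bar> \<partial>lebesgue) \<longlonglongrightarrow> 0"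
  shows "(\<lambda>n. \<integral>x. indicator A x * F (w n x) \<partial>lebesgue) \<longlonglongrightarrow> (\<integral>x. indicator A x * F (v x) \<partial>lebesgue)"
proof (rule LIMSEQ_I)
  fix e :: real assume e: "e > 0"
  obtain C where C: "C > 0" "\<And>u :: real^'n \<Rightarrow> real. u \<in> BV \<Longrightarrow> (\<integral>x. \<bar>u x\<bar> \<partial>lebesgue) \<le> K \<Longrightarrow> tv u \<le> K \<Longrightarrow>
     integrable lebesgue (\<lambda>x. \<bar>u x\<bar> powr q) \<and> (\<integral>x. \<bar>u x\<bar> powr q \<partial>lebesgue) \<le> C" by (rule Lq_bound[of K]) blast
  define Cv where "Cv = (\<integral>x. \<bar>v x\<bar> powr q \<partial>lebesgue)"
  have Cv: "Cv \<ge> 0" unfolding Cv_def by (intro integral_nonneg_AE) auto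
  \<comment> \<open>Makes the L^q contribution at most e/2; the other half is left to the L^1
    distance through the threshold \<open>e / (2 * L)\<close>.\<close>
  define \<eta> where "\<eta> = e / (2 * (C + Cv))"
  have \<eta>: "\<eta> > 0" "\<eta> * (C + Cv) = e / 2" 
  proof -
    have pos: "C + Cv > 0" using C(1) Cv by simp
    show "\<eta> > 0" unfolding \<eta>_def using e pos by simp
    have "\<eta> * (C + Cv) = (e * (C + Cv)) / (2 * (C + Cv))" unfolding \<eta>_def by simp
    also have "\<dots> = e / 2" using pos by (subst mult_divide_mult_cancel_right) auto
    finally show "\<eta> * (C + Cv) = e / 2" .
  qed
  obtain L where L: "L > 0" "\<And>a b. \<bar>F a - F b\<bar> \<le> L * \<bar>a - b\<bar> + \<eta> * (\<bar>a\<bar> powr q + \<bar>b\<bar> powr q)"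
    by (rule F_diff_bound[OF \<eta>(1)]) blast
  have "e / (2 * L) > 0" using e L by simp
  then obtain M where M: "\<And>n. n \<ge> M \<Longrightarrow> (\<integral>x. indicator A x * \<bar>w n x - v x\<bar> \<partial>lebesgue) < e / (2 * L)"
    using order_tendstoD(2)[OF lim] unfolding eventually_sequentially by blast
  have "norm ((\<integral>x. indicator A x * F (w n x) \<partial>lebesgue) - (\<integral>x. indicator A x * F (v x) \<partial>lebesgue)) < e" if n: "n \<ge> M" for n
  proof -
    have i: "integrable lebesgue (\<lambda>x. indicator A x * F (w n x))" "integrable lebesgue (\<lambda>x. indicator A x * F (v x))"
      using F_integrable w(1) v A by (auto intro: integrable_indicator_mult)
    have iA: "integrable lebesgue (\<lambda>x. indicator A x * \<bar>w n x - v x\<bar>)"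
      using BV_integrable[OF w(1)] BV_integrable[OF v] A
      by (intro integrable_indicator_mult integrable_abs Bochner_Integration.integrable_diff)
    have iw: "integrable lebesgue (\<lambda>x. \<bar>w n x\<bar> powr q)" "(\<integral>x. \<bar>w n x\<bar> powr q \<partial>lebesgue) \<le> C"
      using C(2)[OF w] by auto
    have iv: "integrable lebesgue (\<lambda>x. \<bar>v x\<bar> powr q)" by (rule integrable_Lq[OF v])
    have ir: "integrable lebesgue (\<lambda>x. L * (indicator A x * \<bar>w n x - v x\<bar>) + \<eta> * (\<bar>w n x\<bar> powr q + \<bar>v x\<bar> powr q))"
      using iA iw iv by simp
    have "norm ((\<integral>x. indicator A x * F (w n x) \<partial>lebesgue) - (\<integral>x. indicator A x * F (v x) \<partial>lebesgue))
      = norm (\<integral>x. indicator A x * F (w n x) - indicator A x * F (v x) \<partial>lebesgue)" using i by simp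
    also have "\<dots> \<le> (\<integral>x. L * (indicator A x * \<bar>w n x - v x\<bar>) + \<eta> * (\<bar>w n x\<bar> powr q + \<bar>v x\<bar> powr q) \<partial>lebesgue)"
    proof (rule order_trans[OF integral_norm_bound integral_mono])
      show "integrable lebesgue (\<lambda>x. norm (indicator A x * F (w n x) - indicator A x * F (v x)))" using i by simp
      show "integrable lebesgue (\<lambda>x. L * (indicator A x * \<bar>w n x - v x\<bar>) + \<eta> * (\<bar>w n x\<bar> powr q + \<bar>v x\<bar> powr q))" by (rule ir)
      show "norm (indicator A x * F (w n x) - indicator A x * F (v x)) \<le> L * (indicator A x * \<bar>w n x - v x\<bar>) + \<eta> * (\<bar>w n x\<bar> powr q + \<bar>v x\<bar> powr q)" for x
        using L(2)[of "w n x" "v x"] \<eta>(1) by (auto simp: indicator_def)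
    qed
    also have "\<dots> = L * (\<integral>x. indicator A x * \<bar>w n x - v x\<bar> \<partial>lebesgue) + \<eta> * ((\<integral>x. \<bar>w n x\<bar> powr q \<partial>lebesgue) + Cv)"
      unfolding Cv_def using iA iw iv by simp
    also have "\<dots> \<le> L * (\<integral>x. indicator A x * \<bar>w n x - v x\<bar> \<partial>lebesgue) + \<eta> * (C + Cv)"
      using iw \<eta>(1) by (intro add_left_mono mult_left_mono) auto
    also have "\<dots> < L * (e / (2 * L)) + e / 2"
      unfolding \<eta>(2) using M[OF n] L(1) by (intro add_strict_right_mono mult_strict_left_mono)
    also have "\<dots> = e" using L(1) by simp
    finally show ?thesis .
  qed
  then show "\<exists>no. \<forall>n\<ge>no. norm ((\<integral>x. indicator A x * F (w n x) \<partial>lebesgue) - (\<integral>x. indicator A x * F (v x) \<partial>lebesgue)) < e" by blast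
qed

text \<open>For a fixed nonnegative factor x, the product of \<open>f (x * r)\<close> and
  \<open>r\<close> grows with |r|, so the defect has a nonnegative derivative in time. Its value at
  the final time \<open>\<tau>\<close> is then one error bound valid for all earlier times.\<close>

lemma split_defect_mono:
  assumes "0 \<le> t" "t \<le> \<tau>" "0 \<le> \<xi>" "\<xi> \<le> 1"
  shows "F (t * s) - F (t * (\<xi> * s)) \<le> F (\<tau> * s) - F (\<tau> * (\<xi> * s))"
proof (rule DERIV_nonneg_imp_nondecreasing[OF assms(2)])
  fix x :: real assume x: "t \<le> x" "x \<le> \<tau>"
  have "((\<lambda>t. F (t * s) - F (t * (\<xi> * s))) has_real_derivative f (x * s) * s - f (x * (\<xi> * s)) * (\<xi> * s)) (at x)"
    by (intro DERIV_diff DERIV_chain2[OF F_deriv]) (auto intro!: derivative_eq_intros)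
  moreover have "f (x * (\<xi> * s)) * (\<xi> * s) \<le> f (x * s) * s"
  proof -
    have eq: "f (x * r) * r = \<bar>f (x * r)\<bar> * \<bar>r\<bar>" for r
    proof -
      have "f (x * r) * r \<ge> 0"
      proof (cases "x * r = 0")
        case False
        then have "x > 0" using x assms(1) by (auto simp: less_le)
        then show ?thesis using f_sgn[of "x * r"] False
          by (cases "r > 0") (auto simp: zero_less_mult_iff mult_less_0_iff intro!: mult_nonneg_nonneg mult_nonpos_nonpos less_imp_le)
      qed (auto simp: f_0)
      then show ?thesis by (simp add: abs_mult[symmetric])
    qed
    have "\<bar>f (x * (\<xi> * s))\<bar> \<le> \<bar>f (x * s)\<bar>"
      using f_abs_mono[OF assms(3,4), of "x * s"] by (simp add: mult_ac)
    moreover have "\<bar>\<xi> * s\<bar> \<le> \<bar>s\<bar>" using assms(3,4) by (simp add: abs_mult mult_left_le_one_le)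
    ultimately show ?thesis unfolding eq[of s] eq[of "\<xi> * s"] by (intro mult_mono) auto
  qed
  ultimately show "\<exists>y. ((\<lambda>t. F (t * s) - F (t * (\<xi> * s))) has_real_derivative y) (at x) \<and> 0 \<le> y"
    by (intro exI conjI) auto
qed

text \<open>Outside radius R the near part vanishes and nothing is lost; inside, the far part is
  dropped and the defect at time \<open>\<tau>\<close> is paid. The open ball of radius R + 1 is
  there to contain the closed ball of radius R. The defect is local, so it passes to limits.\<close>

lemma \<Phi>_split:
  assumes u: "u \<in> BV" and R: "R > 0" and t: "0 \<le> t" "t \<le> \<tau>"
  shows "\<Phi> (\<lambda>x. t * u x) \<le> \<Phi> (\<lambda>x. t * (cutoff R x * u x)) + \<Phi> (\<lambda>x. t * ((1 - cutoff R x) * u x))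
     + (\<integral>x. indicator (ball 0 (R + 1)) x * (F (\<tau> * u x) - F (\<tau> * (cutoff R x * u x))) \<partial>lebesgue)"
proof -
  note b = BV_cutoff[OF u R]
  have \<tau>: "\<tau> \<ge> 0" using t by simp
  have i: "integrable lebesgue (\<lambda>x. F (t * u x))" "integrable lebesgue (\<lambda>x. F (t * (cutoff R x * u x)))"
    "integrable lebesgue (\<lambda>x. F (t * ((1 - cutoff R x) * u x)))" "integrable lebesgue (\<lambda>x. F (\<tau> * u x) - F (\<tau> * (cutoff R x * u x)))"
    using F_integrable[OF BV_scaled[OF u t(1)]] F_integrable[OF BV_scaled[OF b(1) t(1)]] F_integrable[OF BV_scaled[OF b(2) t(1)]]
      F_integrable[OF BV_scaled[OF u \<tau>]] F_integrable[OF BV_scaled[OF b(1) \<tau>]] by auto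
  have iB: "integrable lebesgue (\<lambda>x. indicator (ball 0 (R + 1)) x * (F (\<tau> * u x) - F (\<tau> * (cutoff R x * u x))))"
    by (rule integrable_indicator_mult[OF i(4)]) simp
  have "\<Phi> (\<lambda>x. t * u x) \<le> (\<integral>x. F (t * (cutoff R x * u x)) + F (t * ((1 - cutoff R x) * u x))
      + indicator (ball 0 (R + 1)) x * (F (\<tau> * u x) - F (\<tau> * (cutoff R x * u x))) \<partial>lebesgue)"
    unfolding \<Phi>_def
  proof (rule integral_mono)
    show "integrable lebesgue (\<lambda>x. F (t * (cutoff R x * u x)) + F (t * ((1 - cutoff R x) * u x))
      + indicator (ball 0 (R + 1)) x * (F (\<tau> * u x) - F (\<tau> * (cutoff R x * u x))))"
      by (intro Bochner_Integration.integrable_add i iB)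
    fix x
    show "F (t * u x) \<le> F (t * (cutoff R x * u x)) + F (t * ((1 - cutoff R x) * u x))
      + indicator (ball 0 (R + 1)) x * (F (\<tau> * u x) - F (\<tau> * (cutoff R x * u x)))"
    proof (cases "norm x \<le> R")
      case True
      then show ?thesis
        using split_defect_mono[OF t cutoff_bounds[of R x], of "u x"] F_nonneg[of "t * ((1 - cutoff R x) * u x)"] by simp
    next
      case False
      then show ?thesis using cutoff_outside[OF R, of x] F_nonneg[of "\<tau> * u x"] by (simp add: F_0)
    qed
  qed (rule i)
  also have "\<dots> = \<Phi> (\<lambda>x. t * (cutoff R x * u x)) + \<Phi> (\<lambda>x. t * ((1 - cutoff R x) * u x))
     + (\<integral>x. indicator (ball 0 (R + 1)) x * (F (\<tau> * u x) - F (\<tau> * (cutoff R x * u x))) \<partial>lebesgue)"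
    unfolding \<Phi>_def by (subst Bochner_Integration.integral_add[OF Bochner_Integration.integrable_add[OF i(2,3)] iB],
        subst Bochner_Integration.integral_add[OF i(2,3)]) simp
  finally show ?thesis .
qed

section \<open>Uniform energy estimates on normalised functions\<close>

lemma normalised_bounds:
  assumes "weight W" "u \<in> BV" "star_norm \<epsilon> W u \<le> 1"
  shows "(\<integral>x. \<bar>u x\<bar> \<partial>lebesgue) \<le> 1 / V0" "tv u \<le> 1 / \<epsilon>"
    "(\<integral>x. \<bar>u x\<bar> \<partial>lebesgue) \<le> max (1 / V0) (1 / \<epsilon>)" "tv u \<le> max (1 / V0) (1 / \<epsilon>)"
proof -
  show 1: "(\<integral>x. \<bar>u x\<bar> \<partial>lebesgue) \<le> 1 / V0" "tv u \<le> 1 / \<epsilon>"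
    using star_norm_bounds[OF assms(1,2)] assms(3) V0 eps by (simp_all add: pos_le_divide_eq mult.commute)
  show "(\<integral>x. \<bar>u x\<bar> \<partial>lebesgue) \<le> max (1 / V0) (1 / \<epsilon>)" "tv u \<le> max (1 / V0) (1 / \<epsilon>)"
    using 1 by auto
qed

text \<open>The mountain pass geometry: at one common time every normalised ray has reached a fixed
  positive height. This makes the ground level positive.\<close>

lemma energy_lower_bound:
  obtains m0 t0 where "m0 > 0" "t0 > 0"
    "\<And>W u. weight W \<Longrightarrow> u \<in> BV \<Longrightarrow> star_norm \<epsilon> W u = 1 \<Longrightarrow> energy W t0 u \<ge> m0"
proof -
  define K where "K = max (1 / V0) (1 / \<epsilon>)"
  obtain C where C: "C > 0" "\<And>u :: real^'n \<Rightarrow> real. u \<in> BV \<Longrightarrow> (\<integral>x. \<bar>u x\<bar> \<partial>lebesgue) \<le> K \<Longrightarrow> tv u \<le> K \<Longrightarrow>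
     integrable lebesgue (\<lambda>x. \<bar>u x\<bar> powr q) \<and> (\<integral>x. \<bar>u x\<bar> powr q \<partial>lebesgue) \<le> C" by (rule Lq_bound[of K]) blast
  obtain D where D: "D > 0" "\<And>s. F s \<le> V0 / 2 * \<bar>s\<bar> + D * \<bar>s\<bar> powr q"
    using V0 by (rule_tac F_bound[of "V0 / 2"]) auto
  \<comment> \<open>Solves \<open>D * C * t powr q = t / 4\<close>. With at most t/2 from the linear
    term, a quarter of \<open>t\<close> remains.\<close>
  define t where "t = (1 / (4 * D * C)) powr (1 / (q - 1))"
  have t: "t > 0" unfolding t_def using C D by simp
  have tq: "t powr q = t / (4 * D * C)"
  proof -
    have "t powr (q - 1) = 1 / (4 * D * C)"
      unfolding t_def using q_ge_1(2) C(1) D(1) by (simp add: powr_powr)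
    then show ?thesis using t powr_add[of t 1 "q - 1"] by simp
  qed
  show thesis
  proof (rule that[of "t / 4" t])
    fix W u assume W: "weight W" and u: "u \<in> BV" and n1: "star_norm \<epsilon> W u = 1"
    have nb: "(\<integral>x. \<bar>u x\<bar> \<partial>lebesgue) \<le> 1 / V0" "(\<integral>x. \<bar>u x\<bar> \<partial>lebesgue) \<le> K" "tv u \<le> K"
      using normalised_bounds[OF W u] n1 unfolding K_def by auto
    have iq: "integrable lebesgue (\<lambda>x. \<bar>u x\<bar> powr q)" "(\<integral>x. \<bar>u x\<bar> powr q \<partial>lebesgue) \<le> C" using C(2)[OF u nb(2,3)] by auto
    have "\<Phi> (\<lambda>x. t * u x) \<le> (\<integral>x. (V0 / 2 * t) * \<bar>u x\<bar> + (D * t powr q) * \<bar>u x\<bar> powr q \<partial>lebesgue)"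
      unfolding \<Phi>_def
    proof (rule integral_mono)
      show "integrable lebesgue (\<lambda>x. F (t * u x))" using t by (intro F_integrable BV_scaled u) simp
      show "integrable lebesgue (\<lambda>x. (V0 / 2 * t) * \<bar>u x\<bar> + (D * t powr q) * \<bar>u x\<bar> powr q)"
        using iq BV_integrable[OF u] by simp
      show "F (t * u x) \<le> (V0 / 2 * t) * \<bar>u x\<bar> + (D * t powr q) * \<bar>u x\<bar> powr q" for x
        using D(2)[of "t * u x"] t by (simp add: abs_mult powr_mult mult_ac)
    qed
    also have "\<dots> = (V0 / 2 * t) * (\<integral>x. \<bar>u x\<bar> \<partial>lebesgue) + (D * t powr q) * (\<integral>x. \<bar>u x\<bar> powr q \<partial>lebesgue)"
      using iq BV_integrable[OF u] by simp
    also have "\<dots> \<le> (V0 / 2 * t) * (1 / V0) + (D * t powr q) * C"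
      using V0 t D(1) iq nb by (intro add_mono mult_left_mono) auto
    also have "\<dots> = t / 2 + t / 4" unfolding tq using V0 C(1) D(1) by simp
    finally show "energy W t u \<ge> t / 4" unfolding energy_def n1 by simp
  qed (use t in auto)
qed

text \<open>If no unit ball carries much mass, then the large values of \<open>u\<close> carry
  little, and small values have small \<open>F\<close>. The nonlinear term at the given time is thus
  at most t/4 + 3/4; since \<open>t\<close> is free, the energy can be pushed above any prescribed
  level.\<close>

lemma energy_vanishing:
  assumes t: "t > 0"
  obtains k where "k > 0" "\<And>W u. weight W \<Longrightarrow> u \<in> BV \<Longrightarrow> star_norm \<epsilon> W u = 1 \<Longrightarrow>
    (\<And>y. (\<integral>x. indicator (ball y 1) x * \<bar>u x\<bar> \<partial>lebesgue) \<le> k) \<Longrightarrow> energy W t u \<ge> 3 / 4 * t - 3 / 4"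
proof -
  define K where "K = max (1 / V0) (1 / \<epsilon>)"
  obtain C where C: "C > 0" "\<And>u :: real^'n \<Rightarrow> real. u \<in> BV \<Longrightarrow> (\<integral>x. \<bar>u x\<bar> \<partial>lebesgue) \<le> K \<Longrightarrow> tv u \<le> K \<Longrightarrow>
     integrable lebesgue (\<lambda>x. \<bar>u x\<bar> powr q) \<and> (\<integral>x. \<bar>u x\<bar> powr q \<partial>lebesgue) \<le> C" by (rule Lq_bound[of K]) blast
  obtain m where m: "m > 0" "\<And>s. \<bar>s\<bar> \<le> m \<Longrightarrow> F s \<le> V0 / 4 * \<bar>s\<bar>"
    using V0 by (rule_tac F_near_0[of "V0 / 4"]) auto
  \<comment> \<open>The L^q contribution becomes 1/2.\<close>
  define \<eta> where "\<eta> = 1 / (2 * (t powr q * C))"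
  have \<eta>: "\<eta> > 0" "\<eta> * t powr q * C = 1 / 2" unfolding \<eta>_def using t C(1) by auto
  obtain L where L: "L > 0" "\<And>a b. \<bar>F a - F b\<bar> \<le> L * \<bar>a - b\<bar> + \<eta> * (\<bar>a\<bar> powr q + \<bar>b\<bar> powr q)"
    by (rule F_diff_bound[OF \<eta>(1)]) blast
  \<comment> \<open>The radius at which the mass of the large values, at most 2 d / \<epsilon>,
    contributes no more than 1/4 after multiplication by \<open>L * t\<close>.\<close>
  define d where "d = min 1 (\<epsilon> / (8 * (L * t)))"
  have d: "d > 0" "d \<le> 1" unfolding d_def using eps L(1) t by auto
  have dL: "L * t * (2 * d * (1 / \<epsilon>)) \<le> 1 / 4"
  proof -
    have "d \<le> \<epsilon> / (8 * (L * t))" unfolding d_def by simp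
    then have "d * (8 * (L * t)) \<le> \<epsilon>" using L(1) t by (subst (asm) pos_le_divide_eq) auto
    then show ?thesis using eps by (simp add: divide_simps) (simp add: mult_ac)
  qed
  define md where "md = measure lborel (ball 0 d :: (real^'n) set)"
  have md: "md > 0" unfolding md_def by (rule ball_measure_pos[OF d(1)])
  \<comment> \<open>Places the threshold \<open>2 * (k / md)\<close> of \<open>BV_vanishing\<close>
    at m/t, where |t u| leaves the range in which \<open>F\<close> is small.\<close>
  define k where "k = m / t * md / 2"
  have k: "k > 0" "2 * (k / md) = m / t" unfolding k_def using m t md by auto
  show thesis
  proof (rule that[OF k(1)])
    fix W u assume W: "weight W" and u: "u \<in> BV" and n1: "star_norm \<epsilon> W u = 1"
      and small: "\<And>y. (\<integral>x. indicator (ball y 1) x * \<bar>u x\<bar> \<partial>lebesgue) \<le> k"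
    have [measurable]: "u \<in> borel_measurable lebesgue" using BV_integrable[OF u] by auto
    have nb: "(\<integral>x. \<bar>u x\<bar> \<partial>lebesgue) \<le> 1 / V0" "tv u \<le> 1 / \<epsilon>" "(\<integral>x. \<bar>u x\<bar> \<partial>lebesgue) \<le> K" "tv u \<le> K"
      using normalised_bounds[OF W u] n1 unfolding K_def by auto
    have iq: "integrable lebesgue (\<lambda>x. \<bar>u x\<bar> powr q)" "(\<integral>x. \<bar>u x\<bar> powr q \<partial>lebesgue) \<le> C" using C(2)[OF u nb(3,4)] by auto
    define T where "T x = (if \<bar>u x\<bar> > m / t then \<bar>u x\<bar> else 0)" for x
    have iT: "integrable lebesgue T" unfolding T_def
      by (rule Bochner_Integration.integrable_bound[OF BV_integrable[OF u]]) auto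
    have "(\<integral>x. T x \<partial>lebesgue) \<le> 2 * d * tv u"
      using BV_vanishing[OF u d less_imp_le[OF k(1)] small] unfolding T_def k(2)[unfolded md_def] .
    also have "\<dots> \<le> 2 * d * (1 / \<epsilon>)" using nb(2) d by (intro mult_left_mono) auto
    finally have T: "(\<integral>x. T x \<partial>lebesgue) \<le> 2 * d * (1 / \<epsilon>)" .
    have "\<Phi> (\<lambda>x. t * u x) \<le> (\<integral>x. (V0 / 4 * t) * \<bar>u x\<bar> + (L * t) * T x + (\<eta> * t powr q) * \<bar>u x\<bar> powr q \<partial>lebesgue)"
      unfolding \<Phi>_def
    proof (rule integral_mono)
      show "integrable lebesgue (\<lambda>x. F (t * u x))" using t by (intro F_integrable BV_scaled u) simp
      show "integrable lebesgue (\<lambda>x. (V0 / 4 * t) * \<bar>u x\<bar> + (L * t) * T x + (\<eta> * t powr q) * \<bar>u x\<bar> powr q)"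
        using iq iT BV_integrable[OF u] by simp
      show "F (t * u x) \<le> (V0 / 4 * t) * \<bar>u x\<bar> + (L * t) * T x + (\<eta> * t powr q) * \<bar>u x\<bar> powr q" for x
      proof (cases "\<bar>u x\<bar> > m / t")
        case True
        have "F (t * u x) \<le> L * \<bar>t * u x\<bar> + \<eta> * \<bar>t * u x\<bar> powr q"
          using L(2)[of "t * u x" 0] F_nonneg[of "t * u x"] by (simp add: F_0)
        also have "\<dots> = (L * t) * T x + (\<eta> * t powr q) * \<bar>u x\<bar> powr q"
          using True t by (simp add: T_def abs_mult powr_mult)
        finally have "F (t * u x) \<le> (L * t) * T x + (\<eta> * t powr q) * \<bar>u x\<bar> powr q" .
        moreover have "(V0 / 4 * t) * \<bar>u x\<bar> \<ge> 0" using V0 t by simp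
        ultimately show ?thesis by linarith
      next
        case False
        then have "\<bar>t * u x\<bar> \<le> m" using t by (simp add: abs_mult not_less pos_le_divide_eq mult.commute)
        then have "F (t * u x) \<le> V0 / 4 * t * \<bar>u x\<bar>" using m(2)[of "t * u x"] t by (simp add: abs_mult)
        then show ?thesis using False \<eta>(1) by (simp add: T_def add_increasing2)
      qed
    qed
    also have "\<dots> = (V0 / 4 * t) * (\<integral>x. \<bar>u x\<bar> \<partial>lebesgue) + (L * t) * (\<integral>x. T x \<partial>lebesgue) + (\<eta> * t powr q) * (\<integral>x. \<bar>u x\<bar> powr q \<partial>lebesgue)"
      using iq iT BV_integrable[OF u] by simp
    also have "\<dots> \<le> (V0 / 4 * t) * (1 / V0) + (L * t) * (2 * d * (1 / \<epsilon>)) + (\<eta> * t powr q) * C"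
      using V0 t \<eta>(1) L(1) iq nb T by (intro add_mono mult_left_mono) auto
    also have "\<dots> \<le> t / 4 + 1 / 4 + 1 / 2"
      using dL \<eta>(2) V0 by simp
    finally show "energy W t u \<ge> 3 / 4 * t - 3 / 4" unfolding energy_def n1 by simp
  qed
qed

text \<open>\<open>c\<close> bounds the maxima of the energy along rays from below; quantifying over upper bounds \<open>M\<close> avoids
  the supremum of a set not yet known to be bounded.\<close>

definition level_ge :: "(real^'n \<Rightarrow> real) \<Rightarrow> real \<Rightarrow> bool" where
  "level_ge W c \<longleftrightarrow> (\<forall>u\<in>BV. \<not> (AE x in lebesgue. u x = 0) \<longrightarrow> (\<forall>M. (\<forall>t\<ge>0. energy W t u \<le> M) \<longrightarrow> c \<le> M))"

text \<open>Multiplication by the cutoff turns local convergence into convergence in L^1, as lower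
  semicontinuity of the norm requires.\<close>

lemma cutoff_L1_tendsto:
  fixes v :: "nat \<Rightarrow> real^'n \<Rightarrow> real"
  assumes v: "\<And>n. v n \<in> BV" "u \<in> BV" and lim: "L1loc_lim v u" and R: "R > 0"
  shows "(\<lambda>n. \<integral>x. \<bar>cutoff R x * v n x - cutoff R x * u x\<bar> \<partial>lebesgue) \<longlonglongrightarrow> 0"
proof (rule tendsto_sandwich[OF _ _ tendsto_const])
  show "(\<lambda>n. \<integral>x. indicator (ball 0 (R + 1)) x * \<bar>v n x - u x\<bar> \<partial>lebesgue) \<longlonglongrightarrow> 0"
    using lim unfolding L1loc_lim_def by blast
  show "\<forall>\<^sub>F n in sequentially. 0 \<le> (\<integral>x. \<bar>cutoff R x * v n x - cutoff R x * u x\<bar> \<partial>lebesgue)" by simp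
  show "\<forall>\<^sub>F n in sequentially. (\<integral>x. \<bar>cutoff R x * v n x - cutoff R x * u x\<bar> \<partial>lebesgue) \<le> (\<integral>x. indicator (ball 0 (R + 1)) x * \<bar>v n x - u x\<bar> \<partial>lebesgue)"
  proof (intro always_eventually allI integral_mono)
    fix n
    show "integrable lebesgue (\<lambda>x. \<bar>cutoff R x * v n x - cutoff R x * u x\<bar>)"
      using BV_integrable[OF BV_cutoff(1)[OF v(1) R]] BV_integrable[OF BV_cutoff(1)[OF v(2) R]] by auto
    show "integrable lebesgue (\<lambda>x. indicator (ball 0 (R + 1)) x * \<bar>v n x - u x\<bar>)"
      using BV_integrable[OF v(1)] BV_integrable[OF v(2)]
      by (intro integrable_indicator_mult integrable_abs Bochner_Integration.integrable_diff) auto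
    fix x
    show "\<bar>cutoff R x * v n x - cutoff R x * u x\<bar> \<le> indicator (ball 0 (R + 1)) x * \<bar>v n x - u x\<bar>"
    proof (cases "norm x \<le> R")
      case True
      then show ?thesis
        using cutoff_bounds[of R x] by (simp add: right_diff_distrib[symmetric] abs_mult mult_left_le_one_le)
    next
      case False
      then show ?thesis using cutoff_outside[OF R, of x] by simp
    qed
  qed
qed

section \<open>Existence of a minimiser\<close>

text \<open>Cut \<open>v n\<close> into a near part \<open>a n\<close> and a far part \<open>b n\<close>; up to a small error the energies
  add up. If the energy of the limit exceeded \<open>c\<close> at \<open>\<tau>\<close>, then either the energy of \<open>b n\<close> at \<open>\<tau>\<close> is
  nonnegative, or \<open>b n\<close> reaches energy nearly \<open>c\<close> at some time before \<open>\<tau>\<close>, at which the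
  concave function \<open>t \<mapsto> energy t (a n)\<close> is bounded away from zero; both are impossible.\<close>

lemma concentration:
  fixes v :: "nat \<Rightarrow> real^'n \<Rightarrow> real"
  assumes W: "\<And>n. weight (W n)" "weight W'" "\<And>x. (\<lambda>n. W n x) \<longlonglongrightarrow> W' x"
    and level: "\<And>n. level_ge (W n) c" and c: "c > 0"
    and v: "\<And>n. v n \<in> BV" "\<And>n. star_norm \<epsilon> (W n) (v n) = 1" "\<And>n t. t \<ge> 0 \<Longrightarrow> energy (W n) t (v n) \<le> M n"
    and M: "M \<longlonglongrightarrow> c" and u: "u \<in> BV" and lim: "L1loc_lim v u" and \<tau>0: "\<tau> \<ge> 0"
  shows "energy W' \<tau> u \<le> c"
proof (rule ccontr)
  assume "\<not> ?thesis"
  then have big: "energy W' \<tau> u > c" by simp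
  have \<tau>: "\<tau> > 0"
  proof (rule ccontr)
    assume "\<not> \<tau> > 0"
    then have "\<tau> = 0" using \<tau>0 by simp
    then have "energy W' \<tau> u \<le> 0" using \<Phi>_nonneg unfolding energy_def by simp
    then show False using big c by linarith
  qed
  define K where "K = max (1 / V0) (1 / \<epsilon>)"
  have vb: "(\<integral>x. \<bar>v n x\<bar> \<partial>lebesgue) \<le> K" "tv (v n) \<le> K" for n
    using normalised_bounds[OF W(1)[of n] v(1)[of n]] v(2)[of n] unfolding K_def by auto
  have K: "K > 0" unfolding K_def using V0 by (simp add: less_max_iff_disj)
  \<comment> \<open>The first bound leaves room for all approximation errors at time
    \<open>\<tau>\<close>, the second keeps \<open>c - \<eta>\<close> at least c/2, and the third
    makes \<open>4 * \<eta>\<close> at most the height c^2 / (4 \<tau>) that the near part will be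
    shown to have at the earlier time.\<close>
  define \<eta> where "\<eta> = min ((energy W' \<tau> u - c) / 5) (min (c / 2) (c * c / (16 * \<tau>)))"
  have \<eta>: "\<eta> > 0" "energy W' \<tau> u > c + 4 * \<eta>" "\<eta> \<le> c / 2" "\<eta> \<le> c * c / (16 * \<tau>)"
  proof -
    have "energy W' \<tau> u - c > 0" "c * c / (16 * \<tau>) > 0" using big c \<tau> by auto
    then show "\<eta> > 0" unfolding \<eta>_def using c by simp
    have "\<eta> \<le> (energy W' \<tau> u - c) / 5" unfolding \<eta>_def by (rule min.cobounded1)
    then have "5 * \<eta> \<le> energy W' \<tau> u - c" by simp
    then show "energy W' \<tau> u > c + 4 * \<eta>" using \<open>\<eta> > 0\<close> by linarith
  qed (auto simp: \<eta>_def)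
  let ?\<xi> = "\<lambda>k::nat. cutoff (real (Suc k)) :: real^'n \<Rightarrow> real"
  note bu = BV_cutoff(1)[OF u of_nat_0_less_iff[THEN iffD2, OF zero_less_Suc]]
  have [measurable]: "u \<in> borel_measurable lebesgue" using BV_integrable[OF u] by auto
  have m\<xi>[measurable]: "(cutoff R :: real^'n \<Rightarrow> real) \<in> borel_measurable lebesgue" for R
    by (rule borel_measurable_lebesgue_of_borel[OF cutoff_measurable])
  have "(\<lambda>k. \<integral>x. \<bar>?\<xi> k x * u x - u x\<bar> \<partial>lebesgue) \<longlonglongrightarrow> integral\<^sup>L lebesgue (\<lambda>x::real^'n. 0)"
  proof (rule integral_dominated_convergence[where w="\<lambda>x. \<bar>u x\<bar>"])
    show "AE x in lebesgue. (\<lambda>k. \<bar>?\<xi> k x * u x - u x\<bar>) \<longlonglongrightarrow> 0"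
    proof (intro AE_I2)
      fix x
      have "(\<lambda>k. \<bar>?\<xi> k x * u x - u x\<bar>) \<longlonglongrightarrow> \<bar>1 * u x - u x\<bar>" by (intro tendsto_intros cutoff_tendsto_1)
      then show "(\<lambda>k. \<bar>?\<xi> k x * u x - u x\<bar>) \<longlonglongrightarrow> 0" by simp
    qed
    show "AE x in lebesgue. norm \<bar>?\<xi> k x * u x - u x\<bar> \<le> \<bar>u x\<bar>" for k
    proof (intro AE_I2)
      fix x
      have "\<bar>?\<xi> k x * u x - u x\<bar> = (1 - ?\<xi> k x) * \<bar>u x\<bar>"
      proof -
        have "?\<xi> k x * u x - u x = - ((1 - ?\<xi> k x) * u x)" by (simp add: algebra_simps)
        then show ?thesis using cutoff_bounds[of "real (Suc k)" x] by (simp only: abs_minus_cancel abs_mult)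
      qed
      also have "\<dots> \<le> 1 * \<bar>u x\<bar>" using cutoff_bounds[of "real (Suc k)" x] by (intro mult_right_mono) auto
      finally show "norm \<bar>?\<xi> k x * u x - u x\<bar> \<le> \<bar>u x\<bar>" by simp
    qed
  qed (use BV_integrable[OF u] in auto)
  then have l1: "(\<lambda>k. \<integral>x. \<bar>?\<xi> k x * u x - u x\<bar> \<partial>lebesgue) \<longlonglongrightarrow> 0" by simp
  have e1: "\<forall>\<^sub>F k in sequentially. star_norm \<epsilon> W' (\<lambda>x. ?\<xi> k x * u x) \<ge> star_norm \<epsilon> W' u - \<eta> / \<tau>"
    by (rule star_norm_lsc[OF W(2) W(2) tendsto_const bu u l1]) (use \<eta> \<tau> in simp)
  have l2: "(\<lambda>k. \<Phi> (\<lambda>x. \<tau> * (?\<xi> k x * u x))) \<longlonglongrightarrow> \<Phi> (\<lambda>x. \<tau> * u x)"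
    unfolding \<Phi>_def
  proof (rule integral_dominated_convergence[where w="\<lambda>x. F (\<tau> * u x)"])
    show "AE x in lebesgue. (\<lambda>k. F (\<tau> * (?\<xi> k x * u x))) \<longlonglongrightarrow> F (\<tau> * u x)"
    proof (intro AE_I2)
      fix x
      have "(\<lambda>k. \<tau> * (?\<xi> k x * u x)) \<longlonglongrightarrow> \<tau> * (1 * u x)" by (intro tendsto_intros cutoff_tendsto_1)
      then show "(\<lambda>k. F (\<tau> * (?\<xi> k x * u x))) \<longlonglongrightarrow> F (\<tau> * u x)"
        using continuous_on_tendsto_compose[OF F_continuous, of _ "\<tau> * u x"] by simp
    qed
    show "AE x in lebesgue. norm (F (\<tau> * (?\<xi> k x * u x))) \<le> F (\<tau> * u x)" for k
    proof (intro AE_I2)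
      fix x
      have "F (?\<xi> k x * (\<tau> * u x)) \<le> F (\<tau> * u x)" by (rule F_scale_le[OF cutoff_bounds])
      then show "norm (F (\<tau> * (?\<xi> k x * u x))) \<le> F (\<tau> * u x)" using F_nonneg by (simp add: mult_ac)
    qed
  qed (use F_integrable[OF BV_scaled[OF u \<tau>0]] F_integrable[OF BV_scaled[OF bu \<tau>0]] in auto)
  have e2: "\<forall>\<^sub>F k in sequentially. \<Phi> (\<lambda>x. \<tau> * (?\<xi> k x * u x)) > \<Phi> (\<lambda>x. \<tau> * u x) - \<eta> / 4"
    by (rule order_tendstoD(1)[OF l2]) (use \<eta> in simp)
  have "(\<lambda>k. \<epsilon> * (8 * K) * inverse (real (Suc k))) \<longlonglongrightarrow> \<epsilon> * (8 * K) * 0"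
    by (intro tendsto_intros LIMSEQ_inverse_real_of_nat)
  then have l3: "(\<lambda>k. \<epsilon> * (8 / real (Suc k) * K)) \<longlonglongrightarrow> 0" by (simp add: divide_inverse mult_ac)
  have "min (\<eta> / (2 * \<tau>)) 1 > 0" using \<eta> \<tau> by simp
  then have e3: "\<forall>\<^sub>F k in sequentially. \<epsilon> * (8 / real (Suc k) * K) < min (\<eta> / (2 * \<tau>)) 1"
    by (rule order_tendstoD(2)[OF l3])
  \<comment> \<open>The radius is fixed before the index of the sequence: it depends only on the
    limit \<open>u\<close> and on the bound \<open>K\<close>, which is uniform in
    \<open>n\<close>.\<close>
  obtain k where k: "star_norm \<epsilon> W' (\<lambda>x. ?\<xi> k x * u x) \<ge> star_norm \<epsilon> W' u - \<eta> / \<tau>"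
    "\<Phi> (\<lambda>x. \<tau> * (?\<xi> k x * u x)) > \<Phi> (\<lambda>x. \<tau> * u x) - \<eta> / 4" "\<epsilon> * (8 / real (Suc k) * K) < min (\<eta> / (2 * \<tau>)) 1"
    using eventually_happens'[OF sequentially_bot eventually_conj[OF e1 eventually_conj[OF e2 e3]]] by blast
  define R where "R = real (Suc k)"
  have R: "R > 0" unfolding R_def by simp
  note k = k[folded R_def]
  define \<delta> where "\<delta> = \<epsilon> * (8 / R * K)"
  have \<delta>: "\<delta> < 1" "\<delta> * \<tau> < \<eta> / 2" "\<delta> \<ge> 0"
    using k(3) \<tau> eps K R unfolding \<delta>_def[symmetric] by (auto simp: field_simps \<delta>_def)
  define a where "a n x = cutoff R x * v n x" for n x
  define b where "b n x = (1 - cutoff R x) * v n x" for n x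
  define u' where "u' x = cutoff R x * u x" for x
  have aBV: "a n \<in> BV" "b n \<in> BV" "u' \<in> BV" for n
    unfolding a_def b_def u'_def using BV_cutoff[OF _ R] v(1) u by auto
  have u'E: "energy W' \<tau> u' > c + 3 * \<eta>"
  proof -
    have "\<tau> * star_norm \<epsilon> W' u' \<ge> \<tau> * (star_norm \<epsilon> W' u - \<eta> / \<tau>)"
      using k(1) \<tau> unfolding u'_def by (intro mult_left_mono) auto
    also have "\<tau> * (star_norm \<epsilon> W' u - \<eta> / \<tau>) = \<tau> * star_norm \<epsilon> W' u - \<eta>" using \<tau> by (simp add: right_diff_distrib)
    finally have "\<tau> * star_norm \<epsilon> W' u' \<ge> \<tau> * star_norm \<epsilon> W' u - \<eta>" .
    moreover have "\<Phi> (\<lambda>x. \<tau> * u' x) \<le> \<Phi> (\<lambda>x. \<tau> * u x)"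
    proof (rule \<Phi>_mono)
      show "F (\<tau> * u' x) \<le> F (\<tau> * u x)" for x
        using F_scale_le[OF cutoff_bounds, of R x "\<tau> * u x"] by (simp add: u'_def mult_ac)
    qed (use aBV u \<tau>0 in auto)
    ultimately show ?thesis using \<eta>(2) unfolding energy_def by linarith
  qed
  have split: "star_norm \<epsilon> (W n) (a n) + star_norm \<epsilon> (W n) (b n) \<le> 1 + \<delta>" for n
  proof -
    have "\<epsilon> * (8 / R * (\<integral>x. \<bar>v n x\<bar> \<partial>lebesgue)) \<le> \<delta>"
      unfolding \<delta>_def using vb(1)[of n] eps R by (intro mult_left_mono) auto
    then show ?thesis using star_norm_cutoff[OF W(1)[of n] v(1)[of n] R] v(2)[of n] unfolding a_def b_def by linarith
  qed
  define A where "A = ball (0::real^'n) (R + 1)"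
  have A: "A \<in> sets lebesgue" unfolding A_def by simp
  define E where "E n = (\<integral>x. indicator A x * (F (\<tau> * v n x) - F (\<tau> * (cutoff R x * v n x))) \<partial>lebesgue)" for n
  have sum_le: "energy (W n) t (a n) + energy (W n) t (b n) \<le> M n + \<delta> * \<tau> + E n" if t: "0 \<le> t" "t \<le> \<tau>" for n t
  proof -
    have "t * (star_norm \<epsilon> (W n) (a n) + star_norm \<epsilon> (W n) (b n)) \<le> t * (1 + \<delta>)"
      using split[of n] t by (intro mult_left_mono) auto
    moreover have "t * \<delta> \<le> \<delta> * \<tau>" using mult_right_mono[OF t(2) \<delta>(3)] by (simp add: mult.commute)
    moreover have "\<Phi> (\<lambda>x. t * v n x) \<le> \<Phi> (\<lambda>x. t * a n x) + \<Phi> (\<lambda>x. t * b n x) + E n"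
      using \<Phi>_split[OF v(1)[of n] R t] unfolding E_def A_def a_def b_def .
    moreover have "t * 1 - \<Phi> (\<lambda>x. t * v n x) \<le> M n" using v(3)[OF t(1), of n] unfolding energy_def v(2) .
    ultimately show ?thesis unfolding energy_def by (simp add: distrib_left)
  qed
  have la: "(\<lambda>n. \<integral>x. \<bar>a n x - u' x\<bar> \<partial>lebesgue) \<longlonglongrightarrow> 0"
    unfolding a_def u'_def by (rule cutoff_L1_tendsto[OF v(1) u lim R])
  have f1: "\<forall>\<^sub>F n in sequentially. star_norm \<epsilon> (W n) (a n) \<ge> star_norm \<epsilon> W' u' - \<eta> / (2 * \<tau>)"
    by (rule star_norm_lsc[OF W aBV(1,3) la]) (use \<eta> \<tau> in simp)
  \<comment> \<open>One constant for masses and variations of both scaled sequences, because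
    \<open>local_\<Phi>_tendsto\<close> takes a single bound.\<close>
  define K' where "K' = \<tau> * (K + 1 / \<epsilon> * (1 + \<delta>) + 1 / V0 * (1 + \<delta>))"
  have ab: "(\<integral>x. \<bar>\<tau> * v n x\<bar> \<partial>lebesgue) \<le> K'" "tv (\<lambda>x. \<tau> * v n x) \<le> K'"
    "(\<integral>x. \<bar>\<tau> * a n x\<bar> \<partial>lebesgue) \<le> K'" "tv (\<lambda>x. \<tau> * a n x) \<le> K'" for n
  proof -
    have pos: "0 \<le> 1 / \<epsilon> * (1 + \<delta>)" "0 \<le> 1 / V0 * (1 + \<delta>)" using eps V0 \<delta>(3) by auto
    have n2: "star_norm \<epsilon> (W n) (a n) \<le> 1 + \<delta>"
      using split[of n] star_norm_bounds(3)[OF W(1)[of n] aBV(2)[of n]] by linarith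
    have "tv (a n) \<le> 1 / \<epsilon> * (1 + \<delta>)"
      using star_norm_bounds(2)[OF W(1)[of n] aBV(1)[of n]] n2 eps by (simp add: pos_le_divide_eq mult.commute)
    moreover have "(\<integral>x. \<bar>a n x\<bar> \<partial>lebesgue) \<le> 1 / V0 * (1 + \<delta>)"
      using star_norm_bounds(1)[OF W(1)[of n] aBV(1)[of n]] n2 V0 by (simp add: pos_le_divide_eq mult.commute)
    ultimately have "\<tau> * tv (a n) \<le> K'" "\<tau> * (\<integral>x. \<bar>a n x\<bar> \<partial>lebesgue) \<le> K'" "\<tau> * tv (v n) \<le> K'" "\<tau> * (\<integral>x. \<bar>v n x\<bar> \<partial>lebesgue) \<le> K'"
      unfolding K'_def using vb[of n] pos K \<tau>0 by (auto intro!: mult_left_mono)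
    then show "(\<integral>x. \<bar>\<tau> * v n x\<bar> \<partial>lebesgue) \<le> K'" "tv (\<lambda>x. \<tau> * v n x) \<le> K'"
      "(\<integral>x. \<bar>\<tau> * a n x\<bar> \<partial>lebesgue) \<le> K'" "tv (\<lambda>x. \<tau> * a n x) \<le> K'"
      using \<tau>0 BV_scale(2)[OF v(1)[of n] \<tau>0] BV_scale(2)[OF aBV(1)[of n] \<tau>0] by (auto simp: abs_mult)
  qed
  have scaled: "(\<lambda>n. \<integral>x. indicator A x * \<bar>\<tau> * w n x - \<tau> * z x\<bar> \<partial>lebesgue) \<longlonglongrightarrow> 0"
    if "(\<lambda>n. \<integral>x. indicator A x * \<bar>w n x - z x\<bar> \<partial>lebesgue) \<longlonglongrightarrow> 0" for w :: "nat \<Rightarrow> real^'n \<Rightarrow> real" and z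
  proof -
    have "(\<integral>x. indicator A x * \<bar>\<tau> * w n x - \<tau> * z x\<bar> \<partial>lebesgue) = \<tau> * (\<integral>x. indicator A x * \<bar>w n x - z x\<bar> \<partial>lebesgue)" for n
      using \<tau>0 by (simp add: right_diff_distrib[symmetric] abs_mult mult.left_commute[of _ \<tau>])
    then show ?thesis using tendsto_mult_right_zero[OF that, of \<tau>] by simp
  qed
  have lv: "(\<lambda>n. \<integral>x. indicator A x * \<bar>v n x - u x\<bar> \<partial>lebesgue) \<longlonglongrightarrow> 0"
    using lim unfolding L1loc_lim_def A_def by blast
  have outA: "cutoff R x = 0" if "x \<notin> A" for x
    using that R unfolding A_def by (intro cutoff_outside) auto
  have "indicator A x * \<bar>a n x - u' x\<bar> = \<bar>a n x - u' x\<bar>" for n x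
    using outA[of x] unfolding a_def u'_def by (cases "x \<in> A") auto
  then have la': "(\<lambda>n. \<integral>x. indicator A x * \<bar>a n x - u' x\<bar> \<partial>lebesgue) \<longlonglongrightarrow> 0" using la by (simp only:)
  have Fa: "(\<lambda>n. \<integral>x. indicator A x * F (\<tau> * a n x) \<partial>lebesgue) \<longlonglongrightarrow> (\<integral>x. indicator A x * F (\<tau> * u' x) \<partial>lebesgue)"
    by (rule local_\<Phi>_tendsto[OF BV_scaled[OF aBV(1) \<tau>0] ab(3,4) BV_scaled[OF aBV(3) \<tau>0] A scaled[OF la']])
  have Fv: "(\<lambda>n. \<integral>x. indicator A x * F (\<tau> * v n x) \<partial>lebesgue) \<longlonglongrightarrow> (\<integral>x. indicator A x * F (\<tau> * u x) \<partial>lebesgue)"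
    by (rule local_\<Phi>_tendsto[OF BV_scaled[OF v(1) \<tau>0] ab(1,2) BV_scaled[OF u \<tau>0] A scaled[OF lv]])
  have iF: "integrable lebesgue (\<lambda>x. indicator A x * F (\<tau> * w x))" if "w \<in> BV" for w
    by (rule integrable_indicator_mult[OF F_integrable[OF BV_scaled[OF that \<tau>0]] A])
  have \<Phi>a: "\<Phi> (\<lambda>x. \<tau> * a n x) = (\<integral>x. indicator A x * F (\<tau> * a n x) \<partial>lebesgue)" for n
    unfolding \<Phi>_def using outA by (intro Bochner_Integration.integral_cong) (auto simp: indicator_def a_def F_0)
  have \<Phi>u': "\<Phi> (\<lambda>x. \<tau> * u' x) = (\<integral>x. indicator A x * F (\<tau> * u' x) \<partial>lebesgue)"
    unfolding \<Phi>_def using outA by (intro Bochner_Integration.integral_cong) (auto simp: indicator_def u'_def F_0)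
  have f2: "\<forall>\<^sub>F n in sequentially. \<Phi> (\<lambda>x. \<tau> * a n x) < \<Phi> (\<lambda>x. \<tau> * u' x) + \<eta> / 4"
    unfolding \<Phi>a \<Phi>u' by (rule order_tendstoD(2)[OF Fa]) (use \<eta> in simp)
  have Eeq: "E n = (\<integral>x. indicator A x * F (\<tau> * v n x) \<partial>lebesgue) - (\<integral>x. indicator A x * F (\<tau> * a n x) \<partial>lebesgue)" for n
    unfolding E_def a_def[symmetric] using iF[OF v(1)[of n]] iF[OF aBV(1)[of n]] by (simp add: right_diff_distrib)
  \<comment> \<open>The defect of the sequence tends to that of the limit, which is small because
    the radius was chosen so that cutting \<open>u\<close> hardly changes
    \<open>\<Phi>\<close>.\<close>
  have "E \<longlonglongrightarrow> (\<integral>x. indicator A x * F (\<tau> * u x) \<partial>lebesgue) - \<Phi> (\<lambda>x. \<tau> * u' x)"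
    unfolding Eeq \<Phi>u' by (rule tendsto_diff[OF Fv Fa])
  moreover have "(\<integral>x. indicator A x * F (\<tau> * u x) \<partial>lebesgue) \<le> \<Phi> (\<lambda>x. \<tau> * u x)"
    unfolding \<Phi>_def using F_nonneg by (intro integral_mono iF u F_integrable BV_scaled \<tau>0) (auto simp: indicator_def)
  then have "(\<integral>x. indicator A x * F (\<tau> * u x) \<partial>lebesgue) - \<Phi> (\<lambda>x. \<tau> * u' x) < \<eta> / 2"
    using k(2) \<eta>(1) unfolding u'_def by linarith
  ultimately have f3: "\<forall>\<^sub>F n in sequentially. E n < \<eta> / 2" by (rule order_tendstoD(2))
  have f4: "\<forall>\<^sub>F n in sequentially. M n < c + \<eta>" by (rule order_tendstoD(2)[OF M]) (use \<eta> in simp)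
  obtain n where n: "star_norm \<epsilon> (W n) (a n) \<ge> star_norm \<epsilon> W' u' - \<eta> / (2 * \<tau>)"
    "\<Phi> (\<lambda>x. \<tau> * a n x) < \<Phi> (\<lambda>x. \<tau> * u' x) + \<eta> / 4" "E n < \<eta> / 2" "M n < c + \<eta>"
    using eventually_happens'[OF sequentially_bot eventually_conj[OF f1 eventually_conj[OF f2 eventually_conj[OF f3 f4]]]] by blast
  have aE: "energy (W n) \<tau> (a n) > c + 2 * \<eta>"
  proof -
    have "\<tau> * star_norm \<epsilon> (W n) (a n) \<ge> \<tau> * (star_norm \<epsilon> W' u' - \<eta> / (2 * \<tau>))"
      using n(1) \<tau> by (intro mult_left_mono) auto
    also have "\<tau> * (star_norm \<epsilon> W' u' - \<eta> / (2 * \<tau>)) = \<tau> * star_norm \<epsilon> W' u' - \<eta> / 2" using \<tau> by (simp add: right_diff_distrib)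
    finally show ?thesis using n(2) u'E \<eta>(1) unfolding energy_def by linarith
  qed
  have bE: "energy (W n) \<tau> (b n) < 0"
    using sum_le[OF \<tau>0 order_refl, of n] aE n \<delta>(2) by linarith
  have b0: "\<not> (AE x in lebesgue. b n x = 0)"
  proof
    assume z: "AE x in lebesgue. b n x = 0"
    have mb[measurable]: "b n \<in> borel_measurable lebesgue" using BV_integrable[OF aBV(2)[of n]] by auto
    have "\<Phi> (\<lambda>x. \<tau> * b n x) = integral\<^sup>L lebesgue (\<lambda>x::real^'n. 0)"
      unfolding \<Phi>_def by (rule integral_cong_AE) (use z in \<open>auto simp: F_0\<close>)
    then have "energy (W n) \<tau> (b n) \<ge> 0"
      using star_norm_bounds(3)[OF W(1)[of n] aBV(2)[of n]] \<tau>0 unfolding energy_def by simp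
    then show False using bE by simp
  qed
  \<comment> \<open>Otherwise \<open>c - \<eta>\<close> would bound the energy on the whole ray of
    the nonzero function \<open>b n\<close>, against the level.\<close>
  obtain t where t: "t \<ge> 0" "energy (W n) t (b n) > c - \<eta>"
  proof (rule ccontr)
    assume "\<not> thesis"
    then have "\<forall>t\<ge>0. energy (W n) t (b n) \<le> c - \<eta>" using that by (meson not_less)
    then have "c \<le> c - \<eta>" using level[of n] aBV(2)[of n] b0 unfolding level_ge_def by blast
    then show False using \<eta>(1) by simp
  qed
  have tpos: "energy (W n) t (b n) > 0" using t(2) \<eta>(3) c by linarith
  have t\<tau>: "t \<le> \<tau>"
  proof (rule ccontr)
    assume "\<not> t \<le> \<tau>"
    then have "energy (W n) \<tau> (b n) \<ge> (\<tau> / t) * energy (W n) t (b n)"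
      using \<tau> by (intro energy_ray[OF aBV(2)]) auto
    moreover have "(\<tau> / t) * energy (W n) t (b n) \<ge> 0" using tpos \<tau> t(1) by simp
    ultimately show False using bE by linarith
  qed
  \<comment> \<open>Energy at least c/2 with norm at most 2 takes a definite time, so the near part,
    rising at least linearly up to time \<open>\<tau>\<close>, has a definite height at that
    moment.\<close>
  have "t \<ge> c / 4"
  proof -
    have "c / 2 \<le> energy (W n) t (b n)" using t(2) \<eta>(3) by linarith
    also have "\<dots> \<le> t * star_norm \<epsilon> (W n) (b n)" using \<Phi>_nonneg unfolding energy_def by simp
    also have "\<dots> \<le> t * 2"
      using split[of n] star_norm_bounds(3)[OF W(1)[of n] aBV(1)[of n]] \<delta>(1) t(1) by (intro mult_left_mono) auto
    finally show ?thesis by simp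
  qed
  then have "c / 4 / \<tau> * c \<le> t / \<tau> * energy (W n) \<tau> (a n)"
    using aE \<eta>(1) c \<tau> by (intro mult_mono divide_right_mono) auto
  also have "\<dots> \<le> energy (W n) t (a n)" by (rule energy_ray[OF aBV(1) t(1) t\<tau> \<tau>])
  finally have "c / 4 / \<tau> * c \<le> energy (W n) t (a n)" .
  moreover have "4 * \<eta> \<le> c / 4 / \<tau> * c"
    using \<eta>(4) by simp
  ultimately show False using sum_le[OF t(1) t\<tau>, of n] t(2) n(3,4) \<delta>(2) \<eta>(1) by linarith
qed

section \<open>Shape of the rays and the ground level\<close>

lemma level_geD:
  assumes "level_ge W c" "u \<in> BV" "\<not> (AE x in lebesgue. u x = 0)" "\<And>t. t \<ge> 0 \<Longrightarrow> energy W t u \<le> M"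
  shows "c \<le> M"
  using assms unfolding level_ge_def by simp

text \<open>Since \<theta> > 1, the growth t^\<theta> of the nonlinear term overtakes the linear
  growth of the norm.\<close>

lemma energy_eventually_negative:
  assumes W: "weight W" and u: "u \<in> BV" "\<not> (AE x in lebesgue. u x = 0)"
  obtains T where "T > 0" "\<And>t. t \<ge> T \<Longrightarrow> energy W t u < 0"
proof -
  have pos: "\<Phi> u > 0" by (rule \<Phi>_pos[OF u])
  \<comment> \<open>Beyond the second entry the nonlinear term exceeds
    \<open>t * (star_norm \<epsilon> W u + 1)\<close>; the entry 1 secures the hypothesis of
    \<open>F_power_growth\<close>.\<close>
  define T where "T = max 1 (((star_norm \<epsilon> W u + 1) / \<Phi> u) powr (1 / (\<theta> - 1)))"
  have n0: "star_norm \<epsilon> W u \<ge> 0" by (rule star_norm_bounds(3)[OF W u(1)])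
  have "energy W t u < 0" if t: "t \<ge> T" for t
  proof -
    have t1: "t \<ge> 1" using t unfolding T_def by simp
    have "\<Phi> (\<lambda>x. t * u x) \<ge> (\<integral>x. t powr \<theta> * F (u x) \<partial>lebesgue)"
      unfolding \<Phi>_def using t1 by (intro integral_mono F_power_growth integrable_mult_right F_integrable BV_scaled u) auto
    then have ge: "\<Phi> (\<lambda>x. t * u x) \<ge> t powr \<theta> * \<Phi> u" unfolding \<Phi>_def by simp
    have "(star_norm \<epsilon> W u + 1) / \<Phi> u = (((star_norm \<epsilon> W u + 1) / \<Phi> u) powr (1 / (\<theta> - 1))) powr (\<theta> - 1)"
      using \<theta> pos n0 by (simp add: powr_powr)
    also have "\<dots> \<le> t powr (\<theta> - 1)"
      using t \<theta> unfolding T_def by (intro powr_mono2) auto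
    finally have "star_norm \<epsilon> W u + 1 \<le> t powr (\<theta> - 1) * \<Phi> u" using pos by (simp add: pos_divide_le_eq)
    then have "t * (star_norm \<epsilon> W u + 1) \<le> t * (t powr (\<theta> - 1) * \<Phi> u)" using t1 by (intro mult_left_mono) auto
    also have "\<dots> = t powr \<theta> * \<Phi> u" using t1 powr_add[of t 1 "\<theta> - 1"] by simp
    finally show ?thesis using ge t1 unfolding energy_def by (simp add: distrib_left)
  qed
  moreover have "T > 0" unfolding T_def by simp
  ultimately show thesis using that by blast
qed

lemma energy_le_norm: "energy W t u \<le> t * star_norm \<epsilon> W u"
  using \<Phi>_nonneg unfolding energy_def by simp

lemma energy_bounded_above:
  assumes W: "weight W" and u: "u \<in> BV" "\<not> (AE x in lebesgue. u x = 0)"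
  obtains M where "\<And>t. t \<ge> 0 \<Longrightarrow> energy W t u \<le> M"
proof -
  obtain T where T: "T > 0" "\<And>t. t \<ge> T \<Longrightarrow> energy W t u < 0" by (rule energy_eventually_negative[OF assms]) blast
  have n0: "star_norm \<epsilon> W u \<ge> 0" by (rule star_norm_bounds(3)[OF W u(1)])
  have "energy W t u \<le> T * star_norm \<epsilon> W u" if "t \<ge> 0" for t
  proof (cases "t \<ge> T")
    case True
    have "T * star_norm \<epsilon> W u \<ge> 0" using T(1) n0 by simp
    then show ?thesis using T(2)[OF True] by linarith
  next
    case False
    then have "t * star_norm \<epsilon> W u \<le> T * star_norm \<epsilon> W u" using n0 by (intro mult_right_mono) auto
    then show ?thesis using energy_le_norm[of W t u] by linarith
  qed
  then show thesis using that by blast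
qed

lemma ground_level:
  assumes W: "weight W"
  obtains c where "c > 0" "level_ge W c"
    "\<And>e. e > 0 \<Longrightarrow> \<exists>u\<in>BV. star_norm \<epsilon> W u = 1 \<and> (\<forall>t\<ge>0. energy W t u \<le> c + e)"
proof -
  \<comment> \<open>Its infimum is the infimum over rays of the supremum of the energy, obtained
    without naming the inner supremum.\<close>
  define S where "S = {M. \<exists>u\<in>BV. \<not> (AE x in lebesgue. u x = 0) \<and> (\<forall>t\<ge>0. energy W t u \<le> M)}"
  obtain m0 t0 where m0: "m0 > 0" "t0 > 0"
    "\<And>W u. weight W \<Longrightarrow> u \<in> BV \<Longrightarrow> star_norm \<epsilon> W u = 1 \<Longrightarrow> energy W t0 u \<ge> m0"
    by (rule energy_lower_bound) blast
  \<comment> \<open>Rescaling only reparametrises the ray, so bounds valid for all times are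
    unaffected by normalisation.\<close>
  have normalise: "\<exists>w\<in>BV. star_norm \<epsilon> W w = 1 \<and> (\<forall>t\<ge>0. energy W t w \<le> M)"
    if u: "u \<in> BV" "\<not> (AE x in lebesgue. u x = 0)" "\<And>t. t \<ge> 0 \<Longrightarrow> energy W t u \<le> M" for u M
  proof -
    define r where "r = 1 / star_norm \<epsilon> W u"
    have pos: "star_norm \<epsilon> W u > 0" by (rule star_norm_pos[OF W u(1,2)])
    then have r: "r \<ge> 0" by (simp add: r_def)
    have "star_norm \<epsilon> W (\<lambda>x. r * u x) = 1" unfolding star_norm_scale[OF u(1) r] using pos by (simp add: r_def)
    moreover have "energy W t (\<lambda>x. r * u x) \<le> M" if "t \<ge> 0" for t
      unfolding energy_rescale[OF u(1) r] using u(3) that r by simp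
    ultimately show ?thesis using BV_scaled[OF u(1) r] by blast
  qed
  have lower: "m0 \<le> M" if MS: "M \<in> S" for M
  proof -
    obtain w where w: "w \<in> BV" "star_norm \<epsilon> W w = 1" "\<forall>t\<ge>0. energy W t w \<le> M"
      using MS normalise unfolding S_def by blast
    have "energy W t0 w \<le> M" using w(3) m0(2) by simp
    then show ?thesis using m0(3)[OF W w(1,2)] by linarith
  qed
  have bdd: "bdd_below S" using lower by (rule bdd_belowI)
  have "S \<noteq> {}"
  proof -
    have B: "(cutoff 1 :: real^'n \<Rightarrow> real) \<in> BV" by (rule cutoff_BV) simp
    have nz: "\<not> (AE x::real^'n in lebesgue. cutoff 1 x = 0)"
    proof
      assume "AE x::real^'n in lebesgue. cutoff 1 x = 0"
      moreover have "x \<in> ball 0 1 \<Longrightarrow> cutoff 1 x \<noteq> 0" for x :: "real^'n"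
        unfolding cutoff_def using abs_square_less_1[of "norm x"] by (auto simp: max_def)
      ultimately have "AE x::real^'n in lebesgue. x \<notin> ball 0 1"
        by (auto elim!: eventually_mono)
      then have "emeasure lebesgue (ball 0 1 :: (real^'n) set) = 0"
        by (subst (asm) AE_iff_measurable[of "ball 0 1"]) auto
      then have "measure lborel (ball 0 1 :: (real^'n) set) = 0" by (simp add: measure_def)
      then show False using ball_measure_pos[where 'n='n, of 1] by simp
    qed
    obtain M where "\<And>t. t \<ge> 0 \<Longrightarrow> energy W t (cutoff 1) \<le> M" by (rule energy_bounded_above[OF W B nz]) blast
    then have "M \<in> S" unfolding S_def using B nz by blast
    then show ?thesis by blast
  qed
  show thesis
  proof (rule that[of "Inf S"])
    show "Inf S > 0" using cInf_greatest[OF \<open>S \<noteq> {}\<close> lower] m0(1) by linarith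
    show "level_ge W (Inf S)"
      unfolding level_ge_def
    proof (intro ballI impI allI)
      fix u M assume "u \<in> BV" "\<not> (AE x in lebesgue. u x = 0)" "\<forall>t\<ge>0. energy W t u \<le> M"
      then have "M \<in> S" unfolding S_def by blast
      then show "Inf S \<le> M" by (rule cInf_lower[OF _ bdd])
    qed
    fix e :: real assume "e > 0"
    then have "Inf S < Inf S + e" by simp
    then obtain M where M: "M \<in> S" "M < Inf S + e"
      using cInf_lessD[OF \<open>S \<noteq> {}\<close>] by blast
    then obtain w where "w \<in> BV" "star_norm \<epsilon> W w = 1" "\<forall>t\<ge>0. energy W t w \<le> M"
      using normalise unfolding S_def by blast
    then show "\<exists>u\<in>BV. star_norm \<epsilon> W u = 1 \<and> (\<forall>t\<ge>0. energy W t u \<le> Inf S + e)"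
      using M(2) by (meson less_imp_le order_trans)
  qed
qed

lemma level_ge_translation:
  assumes W: "weight W" and "level_ge W c"
  shows "level_ge (\<lambda>x. W (x + a)) c"
  unfolding level_ge_def
proof (intro ballI impI allI)
  fix u M assume u: "u \<in> BV" "\<not> (AE x in lebesgue. u x = 0)" "\<forall>t\<ge>0. energy (\<lambda>x. W (x + a)) t u \<le> M"
  let ?u = "\<lambda>x. u (x + - a)"
  have B: "?u \<in> BV" by (rule BV_translation(1)[OF u(1)])
  have "\<not> (AE x in lebesgue. ?u x = 0)"
  proof
    assume "AE x in lebesgue. ?u x = 0"
    from AE_lebesgue_translation[OF this, of a] show False using u(2) by simp
  qed
  moreover have "energy W t ?u \<le> M" if "t \<ge> 0" for t
  proof -
    have "energy (\<lambda>x. W (x + a)) t u \<le> M" using u(3) that by blast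
    then show ?thesis using energy_translation[OF W B that, of a] by simp
  qed
  ultimately show "c \<le> M" by (rule level_geD[OF assms(2) B])
qed

text \<open>\<open>V1\<close> is at once the upper bound of the weights and the limit of
  \<open>V\<close>; this is how the assumption that \<open>V\<close> stays below its limit
  enters.\<close>

lemma minimiser_exists:
  fixes V :: "real^'n \<Rightarrow> real"
  assumes V: "weight V" "continuous_on UNIV V" "(V \<longlongrightarrow> V1) at_infinity"
    and c: "c > 0" "level_ge V c"
    and min: "\<And>e. e > 0 \<Longrightarrow> \<exists>u\<in>BV. star_norm \<epsilon> V u = 1 \<and> (\<forall>t\<ge>0. energy V t u \<le> c + e)"
  obtains u where "u \<in> BV" "\<not> (AE x in lebesgue. u x = 0)" "\<And>t. t \<ge> 0 \<Longrightarrow> energy V t u \<le> c"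
proof -
  \<comment> \<open>With this time \<open>energy_vanishing\<close> would give energy at least 3 c +
    9/4, more than the bound c + 1 available along the minimising sequence.\<close>
  define T where "T = 4 * c + 4"
  have "T > 0" using c(1) by (simp add: T_def)
  then obtain k where k: "k > 0" "\<And>W u. weight W \<Longrightarrow> u \<in> BV \<Longrightarrow> star_norm \<epsilon> W u = 1 \<Longrightarrow>
    (\<And>y. (\<integral>x. indicator (ball y 1) x * \<bar>u x\<bar> \<partial>lebesgue) \<le> k) \<Longrightarrow> energy W T u \<ge> 3 / 4 * T - 3 / 4"
    by (rule energy_vanishing) blast
  have "\<exists>u\<in>BV. star_norm \<epsilon> V u = 1 \<and> (\<forall>t\<ge>0. energy V t u \<le> c + inverse (real (Suc n)))" for n
    by (rule min) simp
  then obtain un where un: "\<And>n. un n \<in> BV" "\<And>n. star_norm \<epsilon> V (un n) = 1"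
    "\<And>n t. t \<ge> 0 \<Longrightarrow> energy V t (un n) \<le> c + inverse (real (Suc n))" by metis
  have "\<exists>y. (\<integral>x. indicator (ball y 1) x * \<bar>un n x\<bar> \<partial>lebesgue) > k" for n
  proof (rule ccontr)
    assume "\<not> ?thesis"
    then have "energy V T (un n) \<ge> 3 / 4 * T - 3 / 4" using k(2)[OF V(1) un(1,2)] by (meson not_less)
    moreover have "energy V T (un n) \<le> c + inverse (real (Suc n))" using un(3) \<open>T > 0\<close> by simp
    moreover have "inverse (real (Suc n)) \<le> 1" by (simp add: divide_simps)
    moreover have "3 / 4 * T - 3 / 4 = 3 * c + 9 / 4" unfolding T_def by (simp add: field_simps)
    ultimately show False using c(1) by linarith
  qed
  then obtain y where y: "\<And>n. (\<integral>x. indicator (ball (y n) 1) x * \<bar>un n x\<bar> \<partial>lebesgue) > k" by metis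
  \<comment> \<open>Either the centres return infinitely often to some ball, and a subsequence of
    them converges, or they leave every ball and the whole sequence goes to infinity.\<close>
  have "\<exists>s W'. strict_mono (s :: nat \<Rightarrow> nat) \<and> weight W' \<and> (\<forall>x. (\<lambda>n. V (x + y (s n))) \<longlonglongrightarrow> W' x) \<and>
    ((\<exists>a. W' = (\<lambda>x. V (x + a))) \<or> W' = (\<lambda>_. V1))"
  proof (cases "\<exists>B. \<exists>\<^sub>F n in sequentially. norm (y n) \<le> B")
    case True
    then obtain B where "\<exists>\<^sub>F n in sequentially. norm (y n) \<le> B" by blast
    then obtain s0 :: "nat \<Rightarrow> nat" where s0: "strict_mono s0" "\<And>n. norm (y (s0 n)) \<le> B"
      using infinite_enumerate[of "{n. norm (y n) \<le> B}"] unfolding frequently_cofinite[symmetric]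
      by (auto simp: cofinite_eq_sequentially)
    obtain a s1 where s1: "strict_mono (s1 :: nat \<Rightarrow> nat)" "((y \<circ> s0) \<circ> s1) \<longlonglongrightarrow> a"
      using compact_imp_seq_compact[OF compact_cball[of "0::real^'n" B]] s0(2) unfolding seq_compact_def
      by (metis (no_types, lifting) comp_apply mem_cball_0)
    have "(\<lambda>n. V (x + y ((s0 \<circ> s1) n))) \<longlonglongrightarrow> V (x + a)" for x
    proof -
      have "(\<lambda>n. x + ((y \<circ> s0) \<circ> s1) n) \<longlonglongrightarrow> x + a" by (intro tendsto_intros s1)
      from continuous_on_tendsto_compose[OF V(2) this] show ?thesis by simp
    qed
    moreover have "strict_mono (s0 \<circ> s1)" using s0 s1 by (simp add: strict_mono_o)
    ultimately show ?thesis using weight_translation[OF V(1), of a] by blast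
  next
    case False
    have inf: "filterlim y at_infinity sequentially"
      unfolding filterlim_at_infinity[OF order_refl]
    proof (intro allI impI)
      fix r :: real
      have "\<not> (\<exists>\<^sub>F n in sequentially. norm (y n) \<le> r)" using False by blast
      then have "\<forall>\<^sub>F n in sequentially. \<not> norm (y n) \<le> r" by (simp add: not_frequently)
      then show "\<forall>\<^sub>F n in sequentially. r \<le> norm (y n)" by eventually_elim simp
    qed
    have "(\<lambda>n. V (x + y n)) \<longlonglongrightarrow> V1" for x
    proof -
      have "filterlim (\<lambda>n. x + y n) at_infinity sequentially"
        by (rule tendsto_add_filterlim_at_infinity[OF tendsto_const inf])
      from filterlim_compose[OF V(3) this] show ?thesis .
    qed
    moreover have "weight (\<lambda>_. V1)" unfolding weight_def using V0 by simp
    ultimately show ?thesis using strict_mono_id by (intro exI[of _ id]) auto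
  qed
  then obtain s W' where s: "strict_mono (s :: nat \<Rightarrow> nat)" "weight W'" "\<And>x. (\<lambda>n. V (x + y (s n))) \<longlonglongrightarrow> W' x"
    "(\<exists>a. W' = (\<lambda>x. V (x + a))) \<or> W' = (\<lambda>_. V1)" by blast
  define v where "v n x = un (s n) (x + y (s n))" for n x
  define W where "W n x = V (x + y (s n))" for n x
  have Ww: "weight (W n)" for n unfolding W_def by (rule weight_translation[OF V(1)])
  have v: "v n \<in> BV" "star_norm \<epsilon> (W n) (v n) = 1" "\<And>t. t \<ge> 0 \<Longrightarrow> energy (W n) t (v n) \<le> c + inverse (real (Suc (s n)))" for n
  proof -
    show "v n \<in> BV" unfolding v_def by (rule BV_translation(1)[OF un(1)])
    show "star_norm \<epsilon> (W n) (v n) = 1" unfolding W_def v_def using star_norm_translation[OF V(1) un(1)] un(2) by simp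
    show "energy (W n) t (v n) \<le> c + inverse (real (Suc (s n)))" if "t \<ge> 0" for t
      unfolding W_def v_def energy_translation[OF V(1) un(1) that] by (rule un(3)[OF that])
  qed
  have vb: "(\<integral>x. \<bar>v n x\<bar> \<partial>lebesgue) \<le> max (1 / V0) (1 / \<epsilon>)" "tv (v n) \<le> max (1 / V0) (1 / \<epsilon>)" for n
    using normalised_bounds(3,4)[OF Ww[of n] v(1)[of n]] v(2)[of n] by simp_all
  obtain r u where r: "strict_mono (r :: nat \<Rightarrow> nat)" and u: "u \<in> BV" and lim: "L1loc_lim (\<lambda>n. v (r n)) u"
    by (rule BV_compactness[of v, OF v(1) vb]) blast
  have Mlim: "(\<lambda>n. c + inverse (real (Suc (s (r n))))) \<longlonglongrightarrow> c"
  proof -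
    have "(\<lambda>n. inverse (real (Suc ((s \<circ> r) n)))) \<longlonglongrightarrow> 0"
      using LIMSEQ_subseq_LIMSEQ[OF LIMSEQ_inverse_real_of_nat strict_mono_o[OF s(1) r]] by (simp add: comp_def)
    then have "(\<lambda>n. c + inverse (real (Suc ((s \<circ> r) n)))) \<longlonglongrightarrow> c + 0" by (intro tendsto_intros)
    then show ?thesis by simp
  qed
  have "(\<lambda>n. W (r n) x) \<longlonglongrightarrow> W' x" for x
    using LIMSEQ_subseq_LIMSEQ[OF s(3)[of x] r] unfolding W_def by (simp add: comp_def)
  note Wlim = this
  have level: "level_ge (W n) c" for n
    unfolding W_def[abs_def] by (rule level_ge_translation[OF V(1) c(2)])
  have conc: "energy W' t u \<le> c" if t: "t \<ge> 0" for t
  proof (rule concentration[where W="\<lambda>n. W (r n)" and v="\<lambda>n. v (r n)"])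
    show "energy (W (r n)) t (v (r n)) \<le> c + inverse (real (Suc (s (r n))))" if "t \<ge> 0" for n t
      by (rule v(3)[OF that])
    show "star_norm \<epsilon> (W (r n)) (v (r n)) = 1" for n by (rule v(2))
  qed (fact Ww s(2) Wlim level c(1) v(1) Mlim u lim t)+
  \<comment> \<open>After recentring, every \<open>v n\<close> has mass above \<open>k\<close> in
    the unit ball at the origin, and L1loc convergence cannot lose it there.\<close>
  have nz: "\<not> (AE x in lebesgue. u x = 0)"
  proof
    assume z: "AE x in lebesgue. u x = 0"
    have [measurable]: "u \<in> borel_measurable lebesgue" "v n \<in> borel_measurable lebesgue" for n
      using BV_integrable[OF u] BV_integrable[OF v(1)] by auto
    have ge: "(\<integral>x. indicator (ball 0 1) x * \<bar>v n x - u x\<bar> \<partial>lebesgue) > k" for n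
    proof -
      let ?y = "y (s n)"
      have m: "(\<lambda>x. indicator (ball ?y 1) x * \<bar>un (s n) x\<bar>) \<in> borel_measurable lebesgue"
        using BV_integrable[OF un(1)[of "s n"]] by (intro borel_measurable_times borel_measurable_indicator) auto
      have "(\<integral>x. indicator (ball ?y 1) x * \<bar>un (s n) x\<bar> \<partial>lebesgue) = (\<integral>x. indicator (ball ?y 1) (x + ?y) * \<bar>un (s n) (x + ?y)\<bar> \<partial>lebesgue)"
        by (rule integral_lebesgue_translation[OF m, symmetric])
      also have "\<dots> = (\<integral>x. indicator (ball 0 1) x * \<bar>v n x - u x\<bar> \<partial>lebesgue)"
      proof (rule integral_cong_AE)
        have ind: "indicator (ball ?y 1) (x + ?y) = (indicator (ball 0 1) x :: real)" for x
          by (simp add: indicator_def dist_norm)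
        show "AE x in lebesgue. indicator (ball ?y 1) (x + ?y) * \<bar>un (s n) (x + ?y)\<bar> = indicator (ball 0 1) x * \<bar>v n x - u x\<bar>"
          using z by eventually_elim (simp add: v_def ind)
        show "(\<lambda>x. indicator (ball ?y 1) (x + ?y) * \<bar>un (s n) (x + ?y)\<bar>) \<in> borel_measurable lebesgue"
          by (rule measurable_lebesgue_translation[OF m])
        show "(\<lambda>x. indicator (ball 0 1) x * \<bar>v n x - u x\<bar>) \<in> borel_measurable lebesgue"
          by (intro borel_measurable_times borel_measurable_indicator) auto
      qed
      finally show ?thesis using y[of "s n"] by simp
    qed
    have "(\<lambda>n. \<integral>x. indicator (ball 0 1) x * \<bar>v (r n) x - u x\<bar> \<partial>lebesgue) \<longlonglongrightarrow> 0"
      using lim unfolding L1loc_lim_def by blast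
    then have "k \<le> 0" by (rule LIMSEQ_le_const) (use ge in \<open>auto intro: less_imp_le\<close>)
    then show False using k(1) by simp
  qed
  from s(4) show thesis
  proof
    assume "W' = (\<lambda>_. V1)"
    have "energy V t u \<le> c" if "t \<ge> 0" for t
    proof -
      have "star_norm \<epsilon> V u \<le> star_norm \<epsilon> W' u"
        by (rule star_norm_mono[OF V(1) s(2) u]) (use weight_bounds(2)[OF V(1)] \<open>W' = _\<close> in simp)
      then have "energy V t u \<le> energy W' t u" unfolding energy_def using that by (simp add: mult_left_mono)
      then show ?thesis using conc[OF that] by linarith
    qed
    then show thesis using that u nz by blast
  next
    assume "\<exists>a. W' = (\<lambda>x. V (x + a))"
    then obtain a where W': "W' = (\<lambda>x. V (x + a))" by blast
    let ?u = "\<lambda>x. u (x + - a)"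
    have B: "?u \<in> BV" by (rule BV_translation(1)[OF u])
    have "\<not> (AE x in lebesgue. ?u x = 0)"
    proof
      assume "AE x in lebesgue. ?u x = 0"
      from AE_lebesgue_translation[OF this, of a] show False using nz by simp
    qed
    moreover have "energy V t ?u \<le> c" if "t \<ge> 0" for t
      using energy_translation[OF V(1) B that, of a] conc[OF that] W' by simp
    ultimately show thesis using that[OF B] by blast
  qed
qed

section \<open>Minimisers are solutions\<close>

lemma energy_concave:
  assumes u: "u \<in> BV" and ab: "0 \<le> a" "0 \<le> b" and l: "0 \<le> l" "l \<le> 1"
  shows "energy W ((1 - l) * a + l * b) u \<ge> (1 - l) * energy W a u + l * energy W b u"
proof -
  let ?m = "(1 - l) * a + l * b"
  have m: "?m \<ge> 0" using ab l by simp
  have "\<Phi> (\<lambda>x. ?m * u x) \<le> (\<integral>x. (1 - l) * F (a * u x) + l * F (b * u x) \<partial>lebesgue)"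
    unfolding \<Phi>_def
  proof (rule integral_mono)
    show "F (?m * u x) \<le> (1 - l) * F (a * u x) + l * F (b * u x)" for x
      using F_convex[OF l, of "a * u x" "b * u x"] by (simp add: algebra_simps)
  qed (use F_integrable[OF BV_scaled[OF u m]] F_integrable[OF BV_scaled[OF u ab(1)]] F_integrable[OF BV_scaled[OF u ab(2)]] in auto)
  also have "\<dots> = (1 - l) * \<Phi> (\<lambda>x. a * u x) + l * \<Phi> (\<lambda>x. b * u x)"
    unfolding \<Phi>_def using F_integrable[OF BV_scaled[OF u ab(1)]] F_integrable[OF BV_scaled[OF u ab(2)]] by simp
  finally have \<Phi>_le: "\<Phi> (\<lambda>x. ?m * u x) \<le> (1 - l) * \<Phi> (\<lambda>x. a * u x) + l * \<Phi> (\<lambda>x. b * u x)" .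
  have "?m * star_norm \<epsilon> W u = (1 - l) * (a * star_norm \<epsilon> W u) + l * (b * star_norm \<epsilon> W u)"
    by (simp add: algebra_simps)
  then show ?thesis using \<Phi>_le unfolding energy_def right_diff_distrib[of "1 - l"] right_diff_distrib[of l] by linarith
qed

text \<open>At the midpoint the linear terms of the two tangent inequalities cancel, leaving a
  strict inequality wherever \<open>u\<close> is nonzero, hence on a set of positive
  measure.\<close>

lemma energy_strictly_concave:
  assumes u: "u \<in> BV" "\<not> (AE x in lebesgue. u x = 0)" and ab: "0 \<le> a" "0 \<le> b" "a \<noteq> b"
  shows "energy W ((a + b) / 2) u > (energy W a u + energy W b u) / 2"
proof -
  let ?m = "(a + b) / 2"
  have m: "?m \<ge> 0" using ab by simp
  define H where "H x = F (a * u x) + F (b * u x) - 2 * F (?m * u x)" for x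
  note i = F_integrable[OF BV_scaled[OF u(1) ab(1)]] F_integrable[OF BV_scaled[OF u(1) ab(2)]] F_integrable[OF BV_scaled[OF u(1) m]]
  have iH: "integrable lebesgue H" unfolding H_def using i by simp
  have H: "H x > 0" if "u x \<noteq> 0" for x
  proof -
    have "?m * u x \<noteq> a * u x" "?m * u x \<noteq> b * u x" using that ab(3) by auto
    then have "F (a * u x) > F (?m * u x) + f (?m * u x) * (a * u x - ?m * u x)"
      "F (b * u x) > F (?m * u x) + f (?m * u x) * (b * u x - ?m * u x)"
      using F_tangent_strict by blast+
    moreover have "f (?m * u x) * (a * u x - ?m * u x) + f (?m * u x) * (b * u x - ?m * u x) = 0"
      by (simp add: field_simps)
    ultimately show ?thesis unfolding H_def by linarith
  qed
  have H0: "H x \<ge> 0" for x using H[of x] by (cases "u x = 0") (auto simp: H_def F_0)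
  have "integral\<^sup>L lebesgue H \<noteq> 0"
  proof
    assume "integral\<^sup>L lebesgue H = 0"
    then have "AE x in lebesgue. H x = 0" using iH H0 by (subst (asm) integral_nonneg_eq_0_iff_AE) auto
    then have "AE x in lebesgue. u x = 0" by eventually_elim (use H in force)
    then show False using u(2) by simp
  qed
  moreover have "integral\<^sup>L lebesgue H \<ge> 0" using H0 by (intro integral_nonneg_AE) auto
  moreover have "integral\<^sup>L lebesgue H = \<Phi> (\<lambda>x. a * u x) + \<Phi> (\<lambda>x. b * u x) - 2 * \<Phi> (\<lambda>x. ?m * u x)"
    unfolding H_def \<Phi>_def using i by simp
  ultimately have "2 * \<Phi> (\<lambda>x. ?m * u x) < \<Phi> (\<lambda>x. a * u x) + \<Phi> (\<lambda>x. b * u x)" by linarith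
  moreover have "2 * energy W ?m u = a * star_norm \<epsilon> W u + b * star_norm \<epsilon> W u - 2 * \<Phi> (\<lambda>x. ?m * u x)"
    unfolding energy_def by (simp add: field_simps)
  ultimately have "energy W a u + energy W b u < 2 * energy W ?m u" unfolding energy_def[of W a] energy_def[of W b] by linarith
  then show ?thesis by simp
qed

lemma energy_continuous:
  assumes u: "u \<in> BV" and T: "T \<ge> 0"
  shows "continuous_on {0..T} (\<lambda>t. energy W t u)"
proof -
  have [measurable]: "u \<in> borel_measurable lebesgue" using BV_integrable[OF u] by auto
  have "continuous_on {0..T} (\<lambda>t. \<Phi> (\<lambda>x. t * u x))"
    unfolding continuous_on_sequentially
  proof (intro allI ballI impI)
    fix X a assume a: "a \<in> {0..T}" and X: "(\<forall>n. X n \<in> {0..T}) \<and> X \<longlonglongrightarrow> a"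
    show "((\<lambda>t. \<Phi> (\<lambda>x. t * u x)) \<circ> X) \<longlonglongrightarrow> \<Phi> (\<lambda>x. a * u x)"
      unfolding comp_def \<Phi>_def
    \<comment> \<open>\<open>F\<close> does not decrease away from 0 along a ray, so the last time
      dominates all earlier ones.\<close>
    proof (rule integral_dominated_convergence[where w="\<lambda>x. F (T * u x)"])
      show "integrable lebesgue (\<lambda>x. F (T * u x))" by (rule F_integrable[OF BV_scaled[OF u T]])
      show "AE x in lebesgue. (\<lambda>n. F (X n * u x)) \<longlonglongrightarrow> F (a * u x)"
      proof (intro AE_I2)
        fix x
        have "(\<lambda>n. X n * u x) \<longlonglongrightarrow> a * u x" using X by (intro tendsto_intros) auto
        then show "(\<lambda>n. F (X n * u x)) \<longlonglongrightarrow> F (a * u x)"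
          using continuous_on_tendsto_compose[OF F_continuous, of _ "a * u x"] by simp
      qed
      show "AE x in lebesgue. norm (F (X n * u x)) \<le> F (T * u x)" for n
      proof (intro AE_I2)
        fix x
        have Xn: "0 \<le> X n" "X n \<le> T" using X by auto
        have "F (X n * u x) \<le> F (T * u x)"
        proof (cases "T = 0")
          case False
          then show ?thesis using F_scale_le[of "X n / T" "T * u x"] Xn T by simp
        qed (use Xn in simp)
        then show "norm (F (X n * u x)) \<le> F (T * u x)" using F_nonneg by simp
      qed
    qed measurable
  qed
  then show ?thesis unfolding energy_def by (intro continuous_intros)
qed

text \<open>The attained maximum is itself an upper bound for the ray, so the level property forces
  it up to \<open>c\<close>. It is not attained at 0, where the energy is 0.\<close>

lemma energy_maximum:
  assumes V: "weight V" and c: "c > 0" "level_ge V c"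
    and u: "u \<in> BV" "\<not> (AE x in lebesgue. u x = 0)" "\<And>t. t \<ge> 0 \<Longrightarrow> energy V t u \<le> c"
  obtains t where "t > 0" "energy V t u = c"
proof -
  obtain T where T: "T > 0" "\<And>t. t \<ge> T \<Longrightarrow> energy V t u < 0" by (rule energy_eventually_negative[OF V u(1,2)]) blast
  obtain t where t: "t \<in> {0..T}" "\<And>s. s \<in> {0..T} \<Longrightarrow> energy V s u \<le> energy V t u"
    using continuous_attains_sup[OF compact_Icc _ energy_continuous[OF u(1) less_imp_le[OF T(1)]], of V] T(1) by auto
  have e0: "energy V 0 u = 0" unfolding energy_def \<Phi>_def by (simp add: F_0)
  have "energy V s u \<le> energy V t u" if "s \<ge> 0" for s
  proof (cases "s \<le> T")
    case False
    then show ?thesis using T(2)[of s] t(2)[of 0] T(1) e0 by simp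
  qed (use t(2) that in auto)
  then have "c \<le> energy V t u" by (rule level_geD[OF c(2) u(1,2)])
  then have eq: "energy V t u = c" using u(3)[of t] t(1) by auto
  have "t \<noteq> 0" using eq e0 c(1) by auto
  then show thesis using that[of t] eq t(1) by auto
qed

lemma f_mult_integrable:
  fixes u w :: "real^'n \<Rightarrow> real"
  assumes "u \<in> BV" "w \<in> BV"
  shows "integrable lebesgue (\<lambda>x. f (u x) * w x)"
proof -
  have [measurable]: "u \<in> borel_measurable lebesgue" "w \<in> borel_measurable lebesgue"
    using BV_integrable[OF assms(1)] BV_integrable[OF assms(2)] by auto
  show ?thesis
  proof (rule Bochner_Integration.integrable_bound)
    show "integrable lebesgue (\<lambda>x. F (u x + w x) + F (u x - w x))"
      using F_integrable[OF BV_add(1)[OF assms]] F_integrable[OF BV_diff[OF assms]] by simp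
    show "AE x in lebesgue. norm (f (u x) * w x) \<le> norm (F (u x + w x) + F (u x - w x))"
    proof (intro AE_I2)
      fix x show "norm (f (u x) * w x) \<le> norm (F (u x + w x) + F (u x - w x))"
        using f_mult_le[of "u x" "w x"] by (metis abs_ge_self order_trans real_norm_def)
    qed
  qed measurable
qed

text \<open>If \<open>w\<close> violated the variational inequality, then the energies along the ray through
  \<open>(1 - s) u + s w\<close> would stay strictly below \<open>c\<close> for small \<open>s\<close>: near \<open>t = 1\<close> by convexity of \<open>F\<close>,
  and elsewhere because the ray of \<open>u\<close> has a strict maximum at \<open>t = 1\<close>.\<close>

lemma minimiser_BV_solution:
  assumes V: "weight V" and c: "c > 0" "level_ge V c"
    and u: "u \<in> BV" "\<not> (AE x in lebesgue. u x = 0)" "\<And>t. t \<ge> 0 \<Longrightarrow> energy V t u \<le> c" "energy V 1 u = c"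
  shows "BV_solution \<epsilon> V f u"
  unfolding BV_solution_def
proof (intro conjI ballI u(1))
  fix w assume w: "w \<in> (BV :: (real^'n \<Rightarrow> real) set)"
  define J where "J t = (\<integral>x. f (t * u x) * (w x - u x) \<partial>lebesgue)" for t
  have [measurable]: "u \<in> borel_measurable lebesgue" "w \<in> borel_measurable lebesgue"
    using BV_integrable[OF u(1)] BV_integrable[OF w] by auto
  show "star_norm \<epsilon> V w - star_norm \<epsilon> V u \<ge> (\<integral>x. f (u x) * (w x - u x) \<partial>lebesgue)"
  proof (rule ccontr)
    assume "\<not> ?thesis"
    then have viol: "star_norm \<epsilon> V w - star_norm \<epsilon> V u < J 1" unfolding J_def by simp
    \<comment> \<open>The amount by which \<open>w\<close> violates the inequality; every gain below
      is a fraction of it.\<close>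
    define D where "D = J 1 - (star_norm \<epsilon> V w - star_norm \<epsilon> V u)"
    have D: "D > 0" using viol by (simp add: D_def)
    have wu: "(\<lambda>x. w x - u x) \<in> BV" by (rule BV_diff[OF w u(1)])
    have iJ: "integrable lebesgue (\<lambda>x. f (t * u x) * (w x - u x))" if "t \<ge> 0" for t
      by (rule f_mult_integrable[OF BV_scaled[OF u(1) that] wu])
    have "(J \<longlongrightarrow> J 1) (at 1 within {0..2})"
      unfolding tendsto_at_iff_sequentially comp_def
    proof (intro allI impI)
      fix X assume X: "\<forall>i. X i \<in> {0..2} - {1::real}" "X \<longlonglongrightarrow> 1"
      show "(\<lambda>n. J (X n)) \<longlonglongrightarrow> J 1"
        unfolding J_def
      \<comment> \<open>All times lie in [0, 2] and |f| grows along rays, so time 2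
        dominates.\<close>
      proof (rule integral_dominated_convergence[where w="\<lambda>x. \<bar>f (2 * u x) * (w x - u x)\<bar>"])
        show "integrable lebesgue (\<lambda>x. \<bar>f (2 * u x) * (w x - u x)\<bar>)" using iJ[of 2] by simp
        show "AE x in lebesgue. (\<lambda>n. f (X n * u x) * (w x - u x)) \<longlonglongrightarrow> f (1 * u x) * (w x - u x)"
        proof (intro AE_I2 tendsto_mult_right)
          fix x
          have "(\<lambda>n. X n * u x) \<longlonglongrightarrow> 1 * u x" by (intro tendsto_intros X)
          then show "(\<lambda>n. f (X n * u x)) \<longlonglongrightarrow> f (1 * u x)"
            using continuous_on_tendsto_compose[OF cont, of _ "1 * u x"] by simp
        qed
        show "AE x in lebesgue. norm (f (X n * u x) * (w x - u x)) \<le> \<bar>f (2 * u x) * (w x - u x)\<bar>" for n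
        proof (intro AE_I2)
          fix x
          have "\<bar>f (X n * u x)\<bar> \<le> \<bar>f (2 * u x)\<bar>" using X(1) by (intro f_abs_mono) auto
          then show "norm (f (X n * u x) * (w x - u x)) \<le> \<bar>f (2 * u x) * (w x - u x)\<bar>"
            by (simp add: abs_mult mult_right_mono)
        qed
      qed measurable
    qed
    then have "\<forall>\<^sub>F t in at 1 within {0..2}. J t > J 1 - D / 2"
      by (rule order_tendstoD(1)) (use D in simp)
    then obtain d0 where d0: "d0 > 0" "\<And>t. t \<in> {0..2} \<Longrightarrow> t \<noteq> 1 \<Longrightarrow> dist t 1 < d0 \<Longrightarrow> J t > J 1 - D / 2"
      unfolding eventually_at by auto
    \<comment> \<open>On the closed interval of this radius around 1 half of the violation persists;
      the bound 1/2 keeps the interval inside [0, 2] and away from 0.\<close>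
    define \<delta> where "\<delta> = min (1/2) (d0 / 2)"
    have \<delta>: "0 < \<delta>" "\<delta> < 1" using d0(1) by (auto simp: \<delta>_def)
    have J\<delta>: "J t \<ge> J 1 - D / 2" if "1 - \<delta> \<le> t" "t \<le> 1 + \<delta>" for t
    proof (cases "t = 1")
      case False
      have "\<bar>t - 1\<bar> < d0" using that d0(1) unfolding \<delta>_def by (auto simp: min_def split: if_splits)
      then show ?thesis using d0(2)[of t] that \<delta> False by (auto simp: dist_real_def intro: less_imp_le)
    qed (use D in simp)
    have strict: "energy V t u < c" if t: "t \<ge> 0" "t \<noteq> 1" for t
    proof (rule ccontr)
      assume "\<not> ?thesis"
      then have "energy V t u = c" using u(3)[OF t(1)] by simp
      then have "energy V ((1 + t) / 2) u > c"
        using energy_strictly_concave[OF u(1,2), of 1 t V] t u(4) by simp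
      moreover have "energy V ((1 + t) / 2) u \<le> c" using t by (intro u(3)) simp
      ultimately show False by simp
    qed
    \<comment> \<open>The drop of the ray of \<open>u\<close> at the two ends, positive because its
      maximum is strict.\<close>
    define \<mu> where "\<mu> = min (c - energy V (1 - \<delta>) u) (c - energy V (1 + \<delta>) u)"
    have \<mu>: "\<mu> > 0" "energy V (1 - \<delta>) u \<le> c - \<mu>" "energy V (1 + \<delta>) u \<le> c - \<mu>"
      using strict[of "1 - \<delta>"] strict[of "1 + \<delta>"] \<delta> unfolding \<mu>_def by auto
    have uw: "(\<lambda>x. u x - w x) \<in> BV" by (rule BV_diff[OF u(1) w])
    define B where "B = star_norm \<epsilon> V (\<lambda>x. u x - w x) + \<Phi> w"
    have B: "B \<ge> 0" unfolding B_def using star_norm_bounds(3)[OF V uw] \<Phi>_nonneg[of w] by simp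
    \<comment> \<open>Ensures \<open>s * B < \<mu>\<close>, so that the perturbed ray is still lower
      at the ends than at time 1, and \<open>s * B < c\<close>, so that its energy at time 1 stays
      positive.\<close>
    define s where "s = min 1 (min \<mu> c / (2 * (B + 1)))"
    have s: "s > 0" "s \<le> 1" using \<mu>(1) c(1) B by (auto simp: s_def)
    have sB: "s * B < \<mu>" "s * B < c"
    proof -
      have mc: "min \<mu> c > 0" using \<mu>(1) c(1) by simp
      have "s * (B + 1) \<le> min \<mu> c / (2 * (B + 1)) * (B + 1)"
        using B unfolding s_def by (intro mult_right_mono) auto
      also have "\<dots> = min \<mu> c / 2"
        using B nonzero_mult_divide_mult_cancel_right[of "B + 1" "min \<mu> c" 2] by (simp only: times_divide_eq_left)
      also have "\<dots> < min \<mu> c" using mc by linarith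
      finally have "s * (B + 1) < min \<mu> c" .
      then show "s * B < \<mu>" "s * B < c" using s(1) by (auto simp: distrib_left)
    qed
    define g where "g x = (1 - s) * u x + s * w x" for x
    have g: "g \<in> BV" unfolding g_def using s u(1) w by (intro BV_add BV_scaled) auto
    have gn: "star_norm \<epsilon> V g \<le> (1 - s) * star_norm \<epsilon> V u + s * star_norm \<epsilon> V w"
      using star_norm_add[OF V BV_scaled[OF u(1), of "1 - s"] BV_scaled[OF w, of s]] s
        star_norm_scale[OF u(1), of "1 - s" V] star_norm_scale[OF w, of s V] unfolding g_def by simp
    \<comment> \<open>By the tangent inequality at \<open>t * u\<close> the nonlinear term gains at
      least \<open>s * t * J t\<close>, while convexity lets the norm term grow by at most
      \<open>s * t * (J 1 - D)\<close>. Near time 1 the gain wins by half of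
      \<open>D\<close>.\<close>
    have upper: "energy V t g \<le> energy V t u - s * t * (D / 2)" if t: "1 - \<delta> \<le> t" "t \<le> 1 + \<delta>" for t
    proof -
      have t0: "t \<ge> 0" using t \<delta> by simp
      have "\<Phi> (\<lambda>x. t * u x) + s * t * J t = (\<integral>x. F (t * u x) + s * t * (f (t * u x) * (w x - u x)) \<partial>lebesgue)"
        unfolding \<Phi>_def J_def using iJ[OF t0] F_integrable[OF BV_scaled[OF u(1) t0]] by simp
      also have "\<dots> \<le> \<Phi> (\<lambda>x. t * g x)"
        unfolding \<Phi>_def
      proof (rule integral_mono)
        show "integrable lebesgue (\<lambda>x. F (t * u x) + s * t * (f (t * u x) * (w x - u x)))"
          using iJ[OF t0] F_integrable[OF BV_scaled[OF u(1) t0]] by simp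
        show "integrable lebesgue (\<lambda>x. F (t * g x))" by (rule F_integrable[OF BV_scaled[OF g t0]])
        show "F (t * u x) + s * t * (f (t * u x) * (w x - u x)) \<le> F (t * g x)" for x
          using F_tangent[of "t * u x" "t * g x"] unfolding g_def by (simp add: algebra_simps)
      qed
      finally have \<Phi>g: "\<Phi> (\<lambda>x. t * u x) + s * t * J t \<le> \<Phi> (\<lambda>x. t * g x)" .
      have "t * star_norm \<epsilon> V g \<le> t * ((1 - s) * star_norm \<epsilon> V u + s * star_norm \<epsilon> V w)"
        using gn t0 by (rule mult_left_mono)
      also have "\<dots> = t * star_norm \<epsilon> V u + s * t * (J 1 - D)" unfolding D_def by (simp add: algebra_simps)
      finally have "energy V t g \<le> energy V t u + s * t * (J 1 - D) - s * t * J t" using \<Phi>g unfolding energy_def by linarith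
      moreover have "s * t * (J 1 - D / 2) \<le> s * t * J t" using J\<delta>[OF t] s(1) t0 by (intro mult_left_mono) auto
      moreover have "s * t * (J 1 - D) = s * t * (J 1 - D / 2) - s * t * (D / 2)" by (simp add: algebra_simps)
      ultimately show ?thesis by linarith
    qed
    have lower: "energy V 1 g \<ge> c - s * B"
    proof -
      have "u = (\<lambda>x. g x + s * (u x - w x))" unfolding g_def by (auto simp: algebra_simps)
      then have "star_norm \<epsilon> V u \<le> star_norm \<epsilon> V g + s * star_norm \<epsilon> V (\<lambda>x. u x - w x)"
        using star_norm_add[OF V g BV_scaled[OF uw, of s]] star_norm_scale[OF uw, of s V] s by simp
      moreover have "\<Phi> g \<le> (1 - s) * \<Phi> u + s * \<Phi> w"
      proof -
        have "\<Phi> g \<le> (\<integral>x. (1 - s) * F (u x) + s * F (w x) \<partial>lebesgue)"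
          unfolding \<Phi>_def
        proof (rule integral_mono)
          show "F (g x) \<le> (1 - s) * F (u x) + s * F (w x)" for x
            unfolding g_def using s by (intro F_convex) auto
        qed (use F_integrable[OF g] F_integrable[OF u(1)] F_integrable[OF w] in auto)
        then show ?thesis unfolding \<Phi>_def using F_integrable[OF u(1)] F_integrable[OF w] by simp
      qed
      moreover have "(1 - s) * \<Phi> u \<le> \<Phi> u" using s \<Phi>_nonneg[of u] by (simp add: mult_left_le_one_le)
      moreover have "star_norm \<epsilon> V u - \<Phi> u = c" using u(4) unfolding energy_def by simp
      ultimately show ?thesis unfolding energy_def B_def by (simp add: distrib_left)
    qed
    define e where "e = s * (1 - \<delta>) * (D / 2)"
    have e: "e > 0" unfolding e_def using s(1) \<delta> D by simp
    have inside: "energy V t g \<le> c - e" if t: "1 - \<delta> \<le> t" "t \<le> 1 + \<delta>" for t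
    proof -
      have "e \<le> s * t * (D / 2)" unfolding e_def using t s D by (intro mult_right_mono mult_left_mono) auto
      moreover have "energy V t u \<le> c" using t \<delta> by (intro u(3)) simp
      ultimately show ?thesis using upper[OF t] by linarith
    qed
    have ends: "energy V (1 - \<delta>) g < energy V 1 g" "energy V (1 + \<delta>) g < energy V 1 g"
    proof -
      have "s * t * (D / 2) \<ge> 0" if "t \<ge> 0" for t using s D that by simp
      from this[of "1 - \<delta>"] this[of "1 + \<delta>"] show "energy V (1 - \<delta>) g < energy V 1 g" "energy V (1 + \<delta>) g < energy V 1 g"
        using upper[of "1 - \<delta>"] upper[of "1 + \<delta>"] \<mu> lower sB \<delta> by auto
    qed
    \<comment> \<open>A concave function that is lower at an intermediate point than at 1 cannot
      exceed its value at 1 further out on the same side.\<close>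
    have outside: "energy V t g \<le> energy V 1 g"
      if t: "t \<ge> 0" "m = (1 - l) * 1 + l * t" "0 < l" "l \<le> 1" "energy V m g < energy V 1 g" for t m l
    proof -
      have "(1 - l) * energy V 1 g + l * energy V t g < energy V 1 g"
        using energy_concave[OF g, of 1 t l V] t by simp
      then have "l * energy V t g < l * energy V 1 g" by (simp add: algebra_simps)
      then show ?thesis using t(3) by simp
    qed
    have g1: "energy V 1 g \<le> c - e" by (rule inside) (use \<delta> in auto)
    have all: "energy V t g \<le> c - e" if t: "t \<ge> 0" for t
    proof -
      consider "t < 1 - \<delta>" | "1 - \<delta> \<le> t" "t \<le> 1 + \<delta>" | "t > 1 + \<delta>" by linarith
      then show ?thesis
      proof cases
        case 1
        have "energy V t g \<le> energy V 1 g"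
        proof (rule outside[OF t _ _ _ ends(1), where l="\<delta> / (1 - t)"])
          have eq: "\<delta> / (1 - t) * (1 - t) = \<delta>" using 1 \<delta> by simp
          have "1 - l * (1 - t) = (1 - l) * 1 + l * t" for l by (simp add: algebra_simps)
          from this[of "\<delta> / (1 - t)"] show "1 - \<delta> = (1 - \<delta> / (1 - t)) * 1 + \<delta> / (1 - t) * t" unfolding eq .
        qed (use 1 \<delta> in auto)
        then show ?thesis using g1 by linarith
      next
        case 3
        have "energy V t g \<le> energy V 1 g"
        proof (rule outside[OF t _ _ _ ends(2), where l="\<delta> / (t - 1)"])
          have eq: "\<delta> / (t - 1) * (t - 1) = \<delta>" using 3 \<delta> by simp
          have "1 + l * (t - 1) = (1 - l) * 1 + l * t" for l by (simp add: algebra_simps)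
          from this[of "\<delta> / (t - 1)"] show "1 + \<delta> = (1 - \<delta> / (t - 1)) * 1 + \<delta> / (t - 1) * t" unfolding eq .
        qed (use 3 \<delta> in auto)
        then show ?thesis using g1 by linarith
      qed (rule inside)
    qed
    \<comment> \<open>Otherwise the energy of \<open>g\<close> would be linear in time with positive
      slope and would reach \<open>c\<close>, although it stays below \<open>c - e\<close>.\<close>
    have "\<not> (AE x in lebesgue. g x = 0)"
    proof
      assume z: "AE x in lebesgue. g x = 0"
      have [measurable]: "g \<in> borel_measurable lebesgue" using BV_integrable[OF g] by auto
      have "\<Phi> (\<lambda>x. t * g x) = integral\<^sup>L lebesgue (\<lambda>x::real^'n. 0)" for t
        unfolding \<Phi>_def by (rule integral_cong_AE) (use z in \<open>auto simp: F_0\<close>)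
      then have eq: "energy V t g = t * star_norm \<epsilon> V g" for t unfolding energy_def by simp
      have pos: "star_norm \<epsilon> V g > 0" using lower sB(2) eq[of 1] by simp
      have "c / star_norm \<epsilon> V g * star_norm \<epsilon> V g \<le> c - e"
        using all[of "c / star_norm \<epsilon> V g"] eq c(1) pos by simp
      then show False using pos e by simp
    qed
    then have "c \<le> c - e" using all by (rule level_geD[OF c(2) g])
    then show False using e by simp
  qed
qed

lemma BV_solution_exists:
  assumes V: "weight V" "continuous_on UNIV V" "(V \<longlongrightarrow> V1) at_infinity"
  shows "\<exists>u. BV_solution \<epsilon> V f u \<and> \<not> (AE x in lebesgue. u x = 0)"
proof -
  obtain c where c: "c > 0" "level_ge V c"
    "\<And>e. e > 0 \<Longrightarrow> \<exists>u\<in>BV. star_norm \<epsilon> V u = 1 \<and> (\<forall>t\<ge>0. energy V t u \<le> c + e)"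
    by (rule ground_level[OF V(1)]) blast
  obtain u where u: "u \<in> BV" "\<not> (AE x in lebesgue. u x = 0)" "\<And>t. t \<ge> 0 \<Longrightarrow> energy V t u \<le> c"
    by (rule minimiser_exists[OF V c(1,2)]) (erule c(3), rule that)
  obtain r where r: "r > 0" "energy V r u = c" by (rule energy_maximum[OF V(1) c(1,2) u]) blast
  let ?u = "\<lambda>x. r * u x"
  have nz: "\<not> (AE x in lebesgue. ?u x = 0)" using r(1) u(2) by simp
  have "BV_solution \<epsilon> V f ?u"
  proof (rule minimiser_BV_solution[OF V(1) c(1,2)])
    show "?u \<in> BV" using r u(1) by simp
    show "energy V t ?u \<le> c" if "t \<ge> 0" for t
      using energy_rescale[OF u(1), of r V t] u(3)[of "t * r"] r that by simp
    show "energy V 1 ?u = c" using energy_rescale[OF u(1), of r V 1] r by simp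
    show "\<not> (AE x in lebesgue. ?u x = 0)" by (rule nz)
  qed
  then show ?thesis using nz by blast
qed

end

section \<open>Reduction of the hypotheses to the abstract setting\<close>

theorem theorem1p2:
  fixes f :: "real \<Rightarrow> real" and V :: "real^'n \<Rightarrow> real"
  assumes N2: "CARD('n) \<ge> 2"
    and f1: "f C1_differentiable_on UNIV"
    and f2: "(f \<longlongrightarrow> 0) (at 0)"
    and f3: "\<exists>c1 c2 p. c1 > 0 \<and> c2 > 0 \<and> 1 \<le> p \<and> p < real CARD('n) / (real CARD('n) - 1) \<and>
               (\<forall>s. \<bar>f s\<bar> \<le> c1 + c2 * \<bar>s\<bar> powr (p - 1))"
    and f4: "\<exists>\<theta>>1. \<forall>s. s \<noteq> 0 \<longrightarrow> 0 < \<theta> * primitive f s \<and> \<theta> * primitive f s \<le> f s * s"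
    and f5: "strict_mono f"
    and V1: "V \<in> borel_measurable lebesgue" "\<exists>M. AE x in lebesgue. \<bar>V x\<bar> \<le> M"
      "(INF x. V x) > 0"
    and V3: "continuous_on UNIV V" "(V \<longlongrightarrow> Vinf) at_infinity" "\<forall>x. V x \<le> Vinf"
    and eps: "\<epsilon> > 0"
  shows "\<exists>u. BV_solution \<epsilon> V f u \<and> \<not> (AE x in lebesgue. u x = 0)"
proof -
  obtain c1 c2 p where fp: "c1 > 0" "c2 > 0" "1 \<le> p" "p < real CARD('n) / (real CARD('n) - 1)"
    "\<And>s. \<bar>f s\<bar> \<le> c1 + c2 * \<bar>s\<bar> powr (p - 1)" using f3 by blast
  obtain \<theta> where \<theta>: "\<theta> > 1" "\<And>s. s \<noteq> 0 \<Longrightarrow> 0 < \<theta> * primitive f s \<and> \<theta> * primitive f s \<le> f s * s" using f4 by blast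
  \<comment> \<open>The spare exponent between the growth of \<open>f\<close> and the critical
    exponent.\<close>
  obtain q where q: "p < q" "q < real CARD('n) / (real CARD('n) - 1)" using dense[OF fp(4)] by blast
  have cont: "continuous_on UNIV f" by (rule C1_differentiable_imp_continuous_on[OF f1])
  then have "isCont f 0" by (simp add: continuous_on_eq_continuous_at)
  then have f0: "f 0 = 0" using f2 by (metis LIM_unique isCont_def)
  \<comment> \<open>For reals \<open>INF\<close> lies below all values only if the range is bounded
    below. A pointwise bound follows from continuity on a ball and the limit at infinity outside
    it.\<close>
  have "bdd_below (range V)"
  proof -
    have "\<forall>\<^sub>F x in at_infinity. V x > Vinf - 1" by (rule order_tendstoD(1)[OF V3(2)]) simp
    then obtain b where b: "\<And>x. norm x \<ge> b \<Longrightarrow> V x > Vinf - 1" unfolding eventually_at_infinity by blast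
    have "compact (V ` cball 0 b)"
      by (intro compact_continuous_image continuous_on_subset[OF V3(1)]) auto
    then have "bounded (V ` cball 0 b)" by (rule compact_imp_bounded)
    then obtain B where B: "\<And>x. norm x \<le> b \<Longrightarrow> \<bar>V x\<bar> \<le> B"
      unfolding bounded_iff by (metis dist_0_norm image_eqI mem_cball real_norm_def)
    have "min (- B) (Vinf - 1) \<le> V x" for x
      using b[of x] B[of x] by (cases "norm x \<le> b") (auto simp: min_le_iff_disj)
    then show ?thesis by (intro bdd_belowI[of _ "min (- B) (Vinf - 1)"]) auto
  qed
  then have V_ge: "(INF x. V x) \<le> V x" for x by (rule cINF_lower) simp
  interpret variational f c1 c2 p q \<theta> \<epsilon> "INF x. V x" Vinf "TYPE('n)"
  proof unfold_locales
    show "(INF x. V x) \<le> Vinf" using V_ge[of 0] V3(3) order_trans by blast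
  qed (use cont f0 f5 fp q \<theta> N2 eps V1(3) in auto)
  have "weight V" unfolding weight_def using assms(7) V_ge V3(3) by blast
  then show ?thesis by (rule BV_solution_exists[OF _ V3(1,2)])
qed

end
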